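(* A map $f$ of cubical transition systems is a weak equivalence in the left determined model structure of $\mathbf{CTS}$ if and only if $\mathrm{CSA}_1(f)$ is an isomorphism.
   Context: Fix a nonempty set $\Sigma$ (of labels). A weak higher dimensional transition system (weak HDTS) is a triple $(S,\mu:L\to\Sigma,T=\bigcup_{n\ge 1}T_n)$ where $S$ is a set (states), $L$ a set (actions), $\mu$ a set map (labelling map), $T_n\subset S\times L^n\times S$ (the $n$-transitions) such that: (Multiset axiom) if $(\alpha,u_1,\dots,u_n,\beta)\in T$, $n\ge 2$, then $(\alpha,u_{\sigma(1)},\dots,u_{\sigma(n)},\beta)\in T$ for every permutation $\sigma$; (Coherence axiom) for $n\ge 3$, $p,q\ge 1$, $p+q<n$, if $(\alpha,u_1,\dots,u_n,\beta)$, $(\alpha,u_1,\dots,u_p,\nu_1)$, $(\nu_1,u_{p+1},\dots,u_n,\beta)$, $(\alpha,u_1,\dots,u_{p+q},\nu_2)$, $(\nu_2,u_{p+q+1},\dots,u_n,\beta)$ are all transitions, then $(\nu_1,u_{p+1},\dots,u_{p+q},\nu_2)$ is a transition. A map $f$ of weak HDTS consists of a map $f_0$ on states and a label-preserving map $\widetilde f$ on actions carrying transitions to transitions. The category is $\mathbf{WHDTS}$. For $n\ge 0$ and $x_1,\dots,x_n\in\Sigma$, the $n$-cube $C_n[x_1,\dots,x_n]$ has states $\{0,1\}^n$, actions $\{(x_1,1),\dots,(x_n,n)\}$ with $\mu(x_i,i)=x_i$, and transitions all tuples $((\epsilon_1,\dots,\epsilon_n),(x_{i_1},i_1),\dots,(x_{i_d},i_d),(\epsilon'_1,\dots,\epsilon'_n))$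 with $d\geq 1$, $i_1,\dots,i_d$ pairwise distinct, $\epsilon_i\le\epsilon'_i$ for all $i$, and $\epsilon_i\ne\epsilon'_i$ iff $i\in\{i_1,\dots,i_d\}$. A subcube of $X$ is the image (smallest subobject through which the map factors) of a map $C_n[x_1,\dots,x_n]\to X$. A weak HDTS is a cubical transition system if it equals the union (least upper bound in its poset of subobjects) of its subcubes. $\mathbf{CTS}\subset\mathbf{WHDTS}$ is the full (coreflective, locally presentable) subcategory of cubical transition systems. A cofibration of cubical transition systems is a map $f$ of $\mathbf{CTS}$ such that $\widetilde f$ is injective on actions. For a class $\mathcal A$ of maps of a category $\mathcal K$, an $\mathcal A$-localizer is a class $\mathcal W$ of maps satisfying two-out-of-three, containing all maps with the right lifting property with respect to $\mathcal A$, and such that $\mathcal A\cap\mathcal W$ is closed under pushout and transfinite composition. The left determined model structure of $\mathbf{CTS}$ is the model structure (which exists and is unique) whose cofibrations are the cofibrations of cubical transition systems and whose weak equivalences form the smallest localizer of $\mathbf{CTS}$ with respect to this class of cofibrations. A cubical transition system satisfies CSA1 (First Cattani-Sassone axiom) if whenever $(\alpha,u,\beta)$ and $(\alpha,u',\beta)$ are transitions with $\mu(u)=\mu(u')$, one has $u=u'$. The full subcategory of cubical transition systems satisfying CSA1 is reflective in $\mathbf{CTS}$; $\mathrm{CSA}_1$ denotes the reflector. *)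

theory Defs
  imports Complex_Main "HOL-Library.FuncSet" "HOL-Library.Multiset"
begin

unbundle cardinal_syntax

section \<open>Categories, lifting, localizers, model structures\<close>

record ('o, 'm) cat =
  Obj  :: "'o set"
  Arr  :: "'m set"
  Dom  :: "'m \<Rightarrow> 'o"
  Cod  :: "'m \<Rightarrow> 'o"
  Ident :: "'o \<Rightarrow> 'm"
  Comp :: "'m \<Rightarrow> 'm \<Rightarrow> 'm"

definition hom :: "('o, 'm) cat \<Rightarrow> 'o \<Rightarrow> 'o \<Rightarrow> 'm set" where
  "hom C X Y = {f \<in> Arr C. Dom C f = X \<and> Cod C f = Y}"

definition category :: "('o, 'm) cat \<Rightarrow> bool" where
  "category C \<longleftrightarrow>
     (\<forall>f \<in> Arr C. Dom C f \<in> Obj C \<and> Cod C f \<in> Obj C) \<and>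
     (\<forall>X \<in> Obj C. Ident C X \<in> hom C X X) \<and>
     (\<forall>f \<in> Arr C. \<forall>g \<in> Arr C. Dom C g = Cod C f \<longrightarrow> Comp C g f \<in> hom C (Dom C f) (Cod C g)) \<and>
     (\<forall>f \<in> Arr C. Comp C f (Ident C (Dom C f)) = f \<and> Comp C (Ident C (Cod C f)) f = f) \<and>
     (\<forall>f \<in> Arr C. \<forall>g \<in> Arr C. \<forall>h \<in> Arr C. Dom C g = Cod C f \<and> Dom C h = Cod C g \<longrightarrow>
        Comp C h (Comp C g f) = Comp C (Comp C h g) f)"

definition full_subcat :: "('o, 'm) cat \<Rightarrow> 'o set \<Rightarrow> ('o, 'm) cat" where
  "full_subcat C S = C\<lparr>Obj := Obj C \<inter> S,
                      Arr := {f \<in> Arr C. Dom C f \<in> S \<and> Cod C f \<in> S}\<rparr>"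

definition is_iso :: "('o, 'm) cat \<Rightarrow> 'm \<Rightarrow> bool" where
  "is_iso C f \<longleftrightarrow> f \<in> Arr C \<and>
     (\<exists>g \<in> hom C (Cod C f) (Dom C f).
        Comp C g f = Ident C (Dom C f) \<and> Comp C f g = Ident C (Cod C f))"

definition has_lift :: "('o, 'm) cat \<Rightarrow> 'm \<Rightarrow> 'm \<Rightarrow> bool" where
  "has_lift C i p \<longleftrightarrow>
     (\<forall>u \<in> hom C (Dom C i) (Dom C p). \<forall>v \<in> hom C (Cod C i) (Cod C p).
        Comp C p u = Comp C v i \<longrightarrow>
        (\<exists>h \<in> hom C (Cod C i) (Dom C p). Comp C h i = u \<and> Comp C p h = v))"

definition rlp :: "('o, 'm) cat \<Rightarrow> 'm set \<Rightarrow> 'm set" where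
  "rlp C A = {p \<in> Arr C. \<forall>i \<in> A. has_lift C i p}"

definition llp :: "('o, 'm) cat \<Rightarrow> 'm set \<Rightarrow> 'm set" where
  "llp C B = {i \<in> Arr C. \<forall>p \<in> B. has_lift C i p}"

definition two_out_of_three :: "('o, 'm) cat \<Rightarrow> 'm set \<Rightarrow> bool" where
  "two_out_of_three C W \<longleftrightarrow>
     (\<forall>f \<in> Arr C. \<forall>g \<in> Arr C. Dom C g = Cod C f \<longrightarrow>
        (f \<in> W \<and> g \<in> W \<longrightarrow> Comp C g f \<in> W) \<and>
        (f \<in> W \<and> Comp C g f \<in> W \<longrightarrow> g \<in> W) \<and>
        (g \<in> W \<and> Comp C g f \<in> W \<longrightarrow> f \<in> W))"

text \<open>The square \<open>j \<circ> u = v \<circ> i\<close> exhibits \<open>j\<close> as the pushout of \<open>i\<close> along \<open>u\<close>.\<close>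

definition is_pushout :: "('o, 'm) cat \<Rightarrow> 'm \<Rightarrow> 'm \<Rightarrow> 'm \<Rightarrow> 'm \<Rightarrow> bool" where
  "is_pushout C i u j v \<longleftrightarrow>
     i \<in> Arr C \<and> u \<in> Arr C \<and> Dom C u = Dom C i \<and>
     j \<in> hom C (Cod C u) (Cod C j) \<and> v \<in> hom C (Cod C i) (Cod C j) \<and>
     Comp C j u = Comp C v i \<and>
     (\<forall>Q \<in> Obj C. \<forall>a \<in> hom C (Cod C u) Q. \<forall>b \<in> hom C (Cod C i) Q.
        Comp C a u = Comp C b i \<longrightarrow>
        (\<exists>!h. h \<in> hom C (Cod C j) Q \<and> Comp C h j = a \<and> Comp C h v = b))"

definition closed_under_pushout :: "('o, 'm) cat \<Rightarrow> 'm set \<Rightarrow> bool" where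
  "closed_under_pushout C B \<longleftrightarrow> (\<forall>i \<in> B. \<forall>u j v. is_pushout C i u j v \<longrightarrow> j \<in> B)"

text \<open>
  Ordinals are represented by (nonempty) well-orders \<open>r\<close>.  A diagram indexed by \<open>r\<close> consists of
  objects \<open>D x\<close> and maps \<open>d x y : D x \<rightarrow> D y\<close> for \<open>(x, y) \<in> r\<close>.
\<close>

definition is_diagram ::
    "('o, 'm) cat \<Rightarrow> 'i rel \<Rightarrow> ('i \<Rightarrow> 'o) \<Rightarrow> ('i \<Rightarrow> 'i \<Rightarrow> 'm) \<Rightarrow> bool" where
  "is_diagram C r D d \<longleftrightarrow>
     (\<forall>x \<in> Field r. D x \<in> Obj C \<and> d x x = Ident C (D x)) \<and>
     (\<forall>x y. (x, y) \<in> r \<longrightarrow> d x y \<in> hom C (D x) (D y)) \<and>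
     (\<forall>x y z. (x, y) \<in> r \<and> (y, z) \<in> r \<longrightarrow> d x z = Comp C (d y z) (d x y))"

definition is_cocone ::
    "('o, 'm) cat \<Rightarrow> 'i rel \<Rightarrow> 'i set \<Rightarrow> ('i \<Rightarrow> 'o) \<Rightarrow> ('i \<Rightarrow> 'i \<Rightarrow> 'm) \<Rightarrow> 'o \<Rightarrow> ('i \<Rightarrow> 'm) \<Rightarrow> bool" where
  "is_cocone C r I D d P c \<longleftrightarrow> P \<in> Obj C \<and>
     (\<forall>x \<in> I. c x \<in> hom C (D x) P) \<and>
     (\<forall>x \<in> I. \<forall>y \<in> I. (x, y) \<in> r \<longrightarrow> Comp C (c y) (d x y) = c x)"

text \<open>\<open>(P, c)\<close> is a colimit of the restriction of the diagram to the indices in \<open>I\<close>.\<close>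

definition is_colimit ::
    "('o, 'm) cat \<Rightarrow> 'i rel \<Rightarrow> 'i set \<Rightarrow> ('i \<Rightarrow> 'o) \<Rightarrow> ('i \<Rightarrow> 'i \<Rightarrow> 'm) \<Rightarrow> 'o \<Rightarrow> ('i \<Rightarrow> 'm) \<Rightarrow> bool" where
  "is_colimit C r I D d P c \<longleftrightarrow> is_cocone C r I D d P c \<and>
     (\<forall>Q q. is_cocone C r I D d Q q \<longrightarrow>
        (\<exists>!h. h \<in> hom C P Q \<and> (\<forall>x \<in> I. Comp C h (c x) = q x)))"

definition immediate_succ :: "'i rel \<Rightarrow> 'i \<Rightarrow> 'i \<Rightarrow> bool" where
  "immediate_succ r x y \<longleftrightarrow> (x, y) \<in> r \<and> x \<noteq> y \<and> (\<forall>z. (x, z) \<in> r \<and> z \<noteq> x \<longrightarrow> (y, z) \<in> r)"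

definition limit_index :: "'i rel \<Rightarrow> 'i \<Rightarrow> bool" where
  "limit_index r y \<longleftrightarrow> y \<in> Field r \<and> underS r y \<noteq> {} \<and> \<not> (\<exists>x. immediate_succ r x y)"

definition transfinite_composite :: "('o, 'm) cat \<Rightarrow> 'i rel \<Rightarrow> 'm set \<Rightarrow> 'm \<Rightarrow> bool" where
  "transfinite_composite C r B f \<longleftrightarrow> Well_order r \<and>
     (\<exists>D d P c. is_diagram C r D d \<and>
        (\<forall>y. limit_index r y \<longrightarrow> is_colimit C r (underS r y) D d (D y) (\<lambda>x. d x y)) \<and>
        (\<forall>x y. immediate_succ r x y \<longrightarrow> d x y \<in> B) \<and>
        is_colimit C r (Field r) D d P c \<and>
        (\<exists>x0 \<in> Field r. underS r x0 = {} \<and> f = c x0))"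

text \<open>
  Here and below the cardinal \<open>\<kappa>\<close> measures smallness: a set is small if its cardinality is less
  than \<open>\<kappa>\<close>.  Every ordinal of cardinality less than \<open>\<kappa>\<close> is the order type of a well-order on a
  subset of the type underlying \<open>\<kappa>\<close>.
\<close>

definition closed_under_transfinite_composition ::
    "'u rel \<Rightarrow> ('o, 'm) cat \<Rightarrow> 'm set \<Rightarrow> bool" where
  "closed_under_transfinite_composition \<kappa> C B \<longleftrightarrow>
     (\<forall>(r :: 'u rel) f. |Field r| <o \<kappa> \<and> transfinite_composite C r B f \<longrightarrow> f \<in> B)"

definition localizer :: "'u rel \<Rightarrow> ('o, 'm) cat \<Rightarrow> 'm set \<Rightarrow> 'm set \<Rightarrow> bool" where
  "localizer \<kappa> C A W \<longleftrightarrow> W \<subseteq> Arr C \<and>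
     two_out_of_three C W \<and>
     rlp C A \<subseteq> W \<and>
     closed_under_pushout C (A \<inter> W) \<and>
     closed_under_transfinite_composition \<kappa> C (A \<inter> W)"

definition smallest_localizer :: "'u rel \<Rightarrow> ('o, 'm) cat \<Rightarrow> 'm set \<Rightarrow> 'm set" where
  "smallest_localizer \<kappa> C A = \<Inter> {W. localizer \<kappa> C A W}"

definition is_retract :: "('o, 'm) cat \<Rightarrow> 'm \<Rightarrow> 'm \<Rightarrow> bool" where
  "is_retract C f g \<longleftrightarrow> f \<in> Arr C \<and> g \<in> Arr C \<and>
     (\<exists>s \<in> hom C (Dom C f) (Dom C g). \<exists>r \<in> hom C (Dom C g) (Dom C f).
      \<exists>s' \<in> hom C (Cod C f) (Cod C g). \<exists>r' \<in> hom C (Cod C g) (Cod C f).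
        Comp C r s = Ident C (Dom C f) \<and> Comp C r' s' = Ident C (Cod C f) \<and>
        Comp C g s = Comp C s' f \<and> Comp C f r = Comp C r' g)"

definition weak_factorization_system :: "('o, 'm) cat \<Rightarrow> 'm set \<Rightarrow> 'm set \<Rightarrow> bool" where
  "weak_factorization_system C L R \<longleftrightarrow> L = llp C R \<and> R = rlp C L \<and>
     (\<forall>f \<in> Arr C. \<exists>l \<in> L. \<exists>r \<in> R. Dom C r = Cod C l \<and> f = Comp C r l)"

definition model_structure :: "('o, 'm) cat \<Rightarrow> 'm set \<Rightarrow> 'm set \<Rightarrow> 'm set \<Rightarrow> bool" where
  "model_structure C Cof W Fib \<longleftrightarrow> W \<subseteq> Arr C \<and> two_out_of_three C W \<and>
     (\<forall>f g. is_retract C f g \<and> g \<in> W \<longrightarrow> f \<in> W) \<and>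
     weak_factorization_system C Cof (W \<inter> Fib) \<and>
     weak_factorization_system C (Cof \<inter> W) Fib"

definition left_determined_model_structure ::
    "'u rel \<Rightarrow> ('o, 'm) cat \<Rightarrow> 'm set \<Rightarrow> 'm set \<Rightarrow> 'm set \<Rightarrow> bool" where
  "left_determined_model_structure \<kappa> C Cof W Fib \<longleftrightarrow> model_structure C Cof W Fib \<and>
     localizer \<kappa> C Cof W \<and> (\<forall>W'. localizer \<kappa> C Cof W' \<longrightarrow> W \<subseteq> W')"

text \<open>
  The weak equivalences of the left determined model structure are by definition the members of the
  smallest localizer; the lemma after the definition records the agreement.
\<close>

definition left_determined_weak_equivalences ::
    "'u rel \<Rightarrow> ('o, 'm) cat \<Rightarrow> 'm set \<Rightarrow> 'm set" where
  "left_determined_weak_equivalences \<kappa> C Cof = smallest_localizer \<kappa> C Cof"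

lemma left_determined_model_structure_weak_equivalences:
  assumes "left_determined_model_structure \<kappa> C Cof W Fib"
  shows "W = left_determined_weak_equivalences \<kappa> C Cof"
  using assms
  unfolding left_determined_model_structure_def left_determined_weak_equivalences_def
    smallest_localizer_def
  by blast

lemma transfinite_composite_mono:
  assumes "transfinite_composite C r B f" "B \<subseteq> B'"
  shows "transfinite_composite C r B' f"
  using assms unfolding transfinite_composite_def by (meson subsetD)

lemma localizer_smallest_localizer:
  assumes "localizer \<kappa> C A W0"
  shows "localizer \<kappa> C A (smallest_localizer \<kappa> C A)"
proof -
  let ?S = "smallest_localizer \<kappa> C A"
  have sub: "?S \<subseteq> W" if "localizer \<kappa> C A W" for W
    using that by (auto simp: smallest_localizer_def)
  have mem: "f \<in> ?S" if "\<And>W. localizer \<kappa> C A W \<Longrightarrow> f \<in> W" for f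
    using that by (auto simp: smallest_localizer_def)
  have 1: "two_out_of_three C ?S"
    unfolding two_out_of_three_def
  proof (intro ballI impI)
    fix f g assume fg: "f \<in> Arr C" "g \<in> Arr C" "Dom C g = Cod C f"
    have W: "(f \<in> W \<and> g \<in> W \<longrightarrow> Comp C g f \<in> W) \<and> (f \<in> W \<and> Comp C g f \<in> W \<longrightarrow> g \<in> W) \<and>
        (g \<in> W \<and> Comp C g f \<in> W \<longrightarrow> f \<in> W)" if "localizer \<kappa> C A W" for W
      using that fg unfolding localizer_def two_out_of_three_def by blast
    show "(f \<in> ?S \<and> g \<in> ?S \<longrightarrow> Comp C g f \<in> ?S) \<and> (f \<in> ?S \<and> Comp C g f \<in> ?S \<longrightarrow> g \<in> ?S) \<and>
        (g \<in> ?S \<and> Comp C g f \<in> ?S \<longrightarrow> f \<in> ?S)"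
      using W sub mem by (meson subsetD)
  qed
  have 2: "closed_under_pushout C (A \<inter> ?S)"
    unfolding closed_under_pushout_def
  proof (intro ballI allI impI)
    fix i u j v assume i: "i \<in> A \<inter> ?S" "is_pushout C i u j v"
    have "j \<in> A \<inter> W" if "localizer \<kappa> C A W" for W
      using that i sub[OF that] unfolding localizer_def closed_under_pushout_def by blast
    then show "j \<in> A \<inter> ?S" using assms mem by blast
  qed
  have 3: "closed_under_transfinite_composition \<kappa> C (A \<inter> ?S)"
    unfolding closed_under_transfinite_composition_def
  proof (intro allI impI)
    fix r :: "'a rel" and f
    assume f: "|Field r| <o \<kappa> \<and> transfinite_composite C r (A \<inter> ?S) f"
    have "f \<in> A \<inter> W" if W: "localizer \<kappa> C A W" for W
    proof -
      have "transfinite_composite C r (A \<inter> W) f"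
        using transfinite_composite_mono f sub[OF W] by (metis Int_mono order_refl)
      then show ?thesis
        using W f unfolding localizer_def closed_under_transfinite_composition_def by blast
    qed
    then show "f \<in> A \<inter> ?S" using assms mem by blast
  qed
  have 4: "rlp C A \<subseteq> ?S" "?S \<subseteq> Arr C"
    using assms by (auto simp: smallest_localizer_def localizer_def)
  show ?thesis
    using 1 2 3 4 unfolding localizer_def by blast
qed

text \<open>
  A reflection of \<open>X\<close> in the full subcategory on the objects in \<open>S\<close>, given by its unit
  \<open>e : X \<rightarrow> Cod e\<close>, and the action on arrows of the resulting reflector.  Reflections are unique up
  to unique isomorphism; \<open>refl_unit\<close> chooses one for each object.
\<close>

definition is_reflection :: "('o, 'm) cat \<Rightarrow> 'o set \<Rightarrow> 'o \<Rightarrow> 'm \<Rightarrow> bool" where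
  "is_reflection C S X e \<longleftrightarrow> e \<in> Arr C \<and> Dom C e = X \<and> Cod C e \<in> Obj C \<inter> S \<and>
     (\<forall>Z \<in> Obj C \<inter> S. \<forall>g \<in> hom C X Z. \<exists>!h. h \<in> hom C (Cod C e) Z \<and> Comp C h e = g)"

definition refl_unit :: "('o, 'm) cat \<Rightarrow> 'o set \<Rightarrow> 'o \<Rightarrow> 'm" where
  "refl_unit C S X = (SOME e. is_reflection C S X e)"

definition reflector :: "('o, 'm) cat \<Rightarrow> 'o set \<Rightarrow> 'm \<Rightarrow> 'm" where
  "reflector C S f =
     (THE h. h \<in> hom C (Cod C (refl_unit C S (Dom C f))) (Cod C (refl_unit C S (Cod C f))) \<and>
        Comp C h (refl_unit C S (Dom C f)) = Comp C (refl_unit C S (Cod C f)) f)"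

lemma category_full_subcat: "category C \<Longrightarrow> category (full_subcat C S)"
  unfolding category_def full_subcat_def hom_def by simp


section \<open>Weak higher dimensional transition systems\<close>

text \<open>The set of labels is the type \<open>'l\<close>.\<close>

record ('s, 'a, 'l) hdts =
  states  :: "'s set"
  actions :: "'a set"
  label   :: "'a \<Rightarrow> 'l"
  trans   :: "('s \<times> 'a list \<times> 's) set"

text \<open>
  An \<open>n\<close>-transition is a triple whose middle component has length \<open>n\<close>; two lists are permutations of
  each other iff they have the same multiset of entries.  Labelling maps (and below, maps) are
  \<open>undefined\<close> outside their domain, so that equality of systems and of maps is the intended one.
\<close>

definition weak_hdts :: "('s, 'a, 'l) hdts \<Rightarrow> bool" where
  "weak_hdts X \<longleftrightarrow>
     label X \<in> extensional (actions X) \<and>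
     (\<forall>\<alpha> us \<beta>. (\<alpha>, us, \<beta>) \<in> trans X \<longrightarrow>
        \<alpha> \<in> states X \<and> \<beta> \<in> states X \<and> us \<noteq> [] \<and> set us \<subseteq> actions X) \<and>
     (\<forall>\<alpha> us vs \<beta>. (\<alpha>, us, \<beta>) \<in> trans X \<and> mset vs = mset us \<longrightarrow> (\<alpha>, vs, \<beta>) \<in> trans X) \<and>
     (\<forall>\<alpha> us vs ws \<beta> \<nu>1 \<nu>2. us \<noteq> [] \<and> vs \<noteq> [] \<and> ws \<noteq> [] \<and>
        (\<alpha>, us @ vs @ ws, \<beta>) \<in> trans X \<and>
        (\<alpha>, us, \<nu>1) \<in> trans X \<and> (\<nu>1, vs @ ws, \<beta>) \<in> trans X \<and>
        (\<alpha>, us @ vs, \<nu>2) \<in> trans X \<and> (\<nu>2, ws, \<beta>) \<in> trans X \<longrightarrow>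
        (\<nu>1, vs, \<nu>2) \<in> trans X)"

definition hdts_map ::
    "('s, 'a, 'l) hdts \<Rightarrow> ('t, 'b, 'l) hdts \<Rightarrow> ('s \<Rightarrow> 't) \<Rightarrow> ('a \<Rightarrow> 'b) \<Rightarrow> bool" where
  "hdts_map X Y f0 f1 \<longleftrightarrow>
     f0 \<in> states X \<rightarrow>\<^sub>E states Y \<and> f1 \<in> actions X \<rightarrow>\<^sub>E actions Y \<and>
     (\<forall>u \<in> actions X. label Y (f1 u) = label X u) \<and>
     (\<forall>\<alpha> us \<beta>. (\<alpha>, us, \<beta>) \<in> trans X \<longrightarrow> (f0 \<alpha>, map f1 us, f0 \<beta>) \<in> trans Y)"

text \<open>\<open>cube [x\<^sub>1, \<dots>, x\<^sub>n]\<close>: list positions start at \<open>0\<close>, so \<open>x\<^sub>i\<close> is \<open>xs ! (i - 1)\<close>.\<close>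

definition cube :: "'l list \<Rightarrow> (bool list, 'l \<times> nat, 'l) hdts" where
  "cube xs = \<lparr>
     states = {e. length e = length xs},
     actions = {(xs ! i, Suc i) | i. i < length xs},
     label = restrict fst {(xs ! i, Suc i) | i. i < length xs},
     trans = {(e, us, e'). length e = length xs \<and> length e' = length xs \<and>
                us \<noteq> [] \<and> set us \<subseteq> {(xs ! i, Suc i) | i. i < length xs} \<and> distinct (map snd us) \<and>
                (\<forall>i < length xs. e ! i \<le> e' ! i) \<and>
                (\<forall>i < length xs. e ! i \<noteq> e' ! i \<longleftrightarrow> Suc i \<in> snd ` set us)} \<rparr>"

text \<open>
  The monomorphisms of weak HDTS are the maps injective on states and on actions, so every subobject
  of \<open>X\<close> is represented by exactly one subsystem of \<open>X\<close> (whose transitions need not be all the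
  transitions of \<open>X\<close> between its states), and the order of subobjects is the order of subsystems.
\<close>

definition subsystem :: "('s, 'a, 'l) hdts \<Rightarrow> ('s, 'a, 'l) hdts \<Rightarrow> bool" where
  "subsystem Y X \<longleftrightarrow> weak_hdts Y \<and> states Y \<subseteq> states X \<and> actions Y \<subseteq> actions X \<and>
     label Y = restrict (label X) (actions Y) \<and> trans Y \<subseteq> trans X"

text \<open>The image of \<open>f : K \<rightarrow> X\<close>: the smallest subsystem of \<open>X\<close> through which \<open>f\<close> factors.\<close>

definition is_image ::
    "('t, 'b, 'l) hdts \<Rightarrow> ('s, 'a, 'l) hdts \<Rightarrow> ('t \<Rightarrow> 's) \<Rightarrow> ('b \<Rightarrow> 'a) \<Rightarrow> ('s, 'a, 'l) hdts \<Rightarrow> bool" where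
  "is_image K X f0 f1 Z \<longleftrightarrow> subsystem Z X \<and> hdts_map K Z f0 f1 \<and>
     (\<forall>Z'. subsystem Z' X \<and> hdts_map K Z' f0 f1 \<longrightarrow> subsystem Z Z')"

definition subcube :: "('s, 'a, 'l) hdts \<Rightarrow> ('s, 'a, 'l) hdts \<Rightarrow> bool" where
  "subcube Z X \<longleftrightarrow> (\<exists>xs f0 f1. hdts_map (cube xs) X f0 f1 \<and> is_image (cube xs) X f0 f1 Z)"

definition is_union :: "('s, 'a, 'l) hdts \<Rightarrow> ('s, 'a, 'l) hdts set \<Rightarrow> ('s, 'a, 'l) hdts \<Rightarrow> bool" where
  "is_union X \<Z> U \<longleftrightarrow> subsystem U X \<and> (\<forall>Z \<in> \<Z>. subsystem Z U) \<and>
     (\<forall>U'. subsystem U' X \<and> (\<forall>Z \<in> \<Z>. subsystem Z U') \<longrightarrow> subsystem U U')"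

definition cubical :: "('s, 'a, 'l) hdts \<Rightarrow> bool" where
  "cubical X \<longleftrightarrow> weak_hdts X \<and> is_union X {Z. subcube Z X} X"

definition CSA1 :: "('s, 'a, 'l) hdts \<Rightarrow> bool" where
  "CSA1 X \<longleftrightarrow> (\<forall>\<alpha> \<beta> u u'. (\<alpha>, [u], \<beta>) \<in> trans X \<and> (\<alpha>, [u'], \<beta>) \<in> trans X \<and>
      label X u = label X u' \<longrightarrow> u = u')"

section \<open>The categories\<close>

text \<open>
  The type \<open>'u\<close> carrying \<open>\<kappa>\<close> plays the role of the universe of small sets: the objects are the
  systems whose states and actions form small subsets of \<open>'u\<close>.  When \<open>\<kappa>\<close> is strongly inaccessible,
  this is (up to equivalence) the category of all systems in the Grothendieck universe of rank \<open>\<kappa>\<close>.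
\<close>

record ('u, 'l) hdts_arrow =
  source :: "('u, 'u, 'l) hdts"
  target :: "('u, 'u, 'l) hdts"
  state_map :: "'u \<Rightarrow> 'u"
  action_map :: "'u \<Rightarrow> 'u"

definition WHDTS :: "'u rel \<Rightarrow> (('u, 'u, 'l) hdts, ('u, 'l) hdts_arrow) cat" where
  "WHDTS \<kappa> =
     (let Ob = {X. weak_hdts X \<and> |states X| <o \<kappa> \<and> |actions X| <o \<kappa>} in
      \<lparr> Obj = Ob,
        Arr = {f. source f \<in> Ob \<and> target f \<in> Ob \<and>
                  hdts_map (source f) (target f) (state_map f) (action_map f)},
        Dom = source,
        Cod = target,
        Ident = (\<lambda>X. \<lparr>source = X, target = X,
                      state_map = restrict id (states X), action_map = restrict id (actions X)\<rparr>),
        Comp = (\<lambda>g f. \<lparr>source = source f, target = target g,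
                      state_map = compose (states (source f)) (state_map g) (state_map f),
                      action_map = compose (actions (source f)) (action_map g) (action_map f)\<rparr>) \<rparr>)"

definition CTS :: "'u rel \<Rightarrow> (('u, 'u, 'l) hdts, ('u, 'l) hdts_arrow) cat" where
  "CTS \<kappa> = full_subcat (WHDTS \<kappa>) {X. cubical X}"

definition CTS_cofibrations :: "'u rel \<Rightarrow> ('u, 'l) hdts_arrow set" where
  "CTS_cofibrations \<kappa> = {f \<in> Arr (CTS \<kappa>). inj_on (action_map f) (actions (source f))}"

definition CSA1_reflector :: "'u rel \<Rightarrow> ('u, 'l) hdts_arrow \<Rightarrow> ('u, 'l) hdts_arrow" where
  "CSA1_reflector \<kappa> = reflector (CTS \<kappa>) {X. CSA1 X}"

lemma weak_hdts_actions: "weak_hdts X \<Longrightarrow> (\<alpha>, us, \<beta>) \<in> trans X \<Longrightarrow> set us \<subseteq> actions X"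
  and weak_hdts_states: "weak_hdts X \<Longrightarrow> (\<alpha>, us, \<beta>) \<in> trans X \<Longrightarrow> \<alpha> \<in> states X \<and> \<beta> \<in> states X"
  unfolding weak_hdts_def by blast+

lemma hdts_map_restrict_id:
  assumes "weak_hdts X"
  shows "hdts_map X X (restrict id (states X)) (restrict id (actions X))"
proof -
  have "map (restrict id (actions X)) us = us" if "(\<alpha>, us, \<beta>) \<in> trans X" for \<alpha> us \<beta>
    using weak_hdts_actions[OF assms that] by (intro map_idI) auto
  then show ?thesis
    using weak_hdts_states[OF assms] unfolding hdts_map_def by (auto simp: PiE_iff)
qed

lemma hdts_map_compose:
  assumes X: "weak_hdts X" and f: "hdts_map X Y f0 f1" and g: "hdts_map Y Z g0 g1"
  shows "hdts_map X Z (compose (states X) g0 f0) (compose (actions X) g1 f1)"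
  unfolding hdts_map_def
proof (intro conjI allI impI ballI)
  show "compose (states X) g0 f0 \<in> states X \<rightarrow>\<^sub>E states Z"
    and "compose (actions X) g1 f1 \<in> actions X \<rightarrow>\<^sub>E actions Z"
    using f g unfolding hdts_map_def by (auto simp: compose_def PiE_iff)
  show "label Z (compose (actions X) g1 f1 u) = label X u" if "u \<in> actions X" for u
    using f g that unfolding hdts_map_def by (auto simp: compose_def PiE_iff)
  fix \<alpha> us \<beta> assume t: "(\<alpha>, us, \<beta>) \<in> trans X"
  have "map (compose (actions X) g1 f1) us = map g1 (map f1 us)"
    using weak_hdts_actions[OF X t] by (auto simp: compose_def)
  moreover have "(g0 (f0 \<alpha>), map g1 (map f1 us), g0 (f0 \<beta>)) \<in> trans Z"
    using f g t unfolding hdts_map_def by blast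
  ultimately show
    "(compose (states X) g0 f0 \<alpha>, map (compose (actions X) g1 f1) us, compose (states X) g0 f0 \<beta>)
       \<in> trans Z"
    using weak_hdts_states[OF X t] by (metis compose_eq)
qed

lemma category_WHDTS: "category (WHDTS \<kappa>)"
proof -
  have [simp]: "compose A f (restrict id A) = f" if "f \<in> A \<rightarrow>\<^sub>E B" for A B and f :: "'a \<Rightarrow> 'a"
    using that by (auto simp: compose_def PiE_iff extensional_def fun_eq_iff)
  have [simp]: "compose A (restrict id B) f = f" if "f \<in> A \<rightarrow>\<^sub>E B" for A B and f :: "'a \<Rightarrow> 'a"
    using that by (auto simp: compose_def PiE_iff extensional_def fun_eq_iff)
  have [simp]: "compose A h (compose A g f) = compose A (compose B h g) f" if "f \<in> A \<rightarrow>\<^sub>E B"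
    for A B and f g h :: "'a \<Rightarrow> 'a"
    using that by (auto simp: compose_def PiE_iff fun_eq_iff)
  show ?thesis
    unfolding category_def
  proof (intro conjI ballI impI)
    fix f g h :: "('a, 'b) hdts_arrow"
    assume *: "f \<in> Arr (WHDTS \<kappa>)" "g \<in> Arr (WHDTS \<kappa>)" "h \<in> Arr (WHDTS \<kappa>)"
      "Dom (WHDTS \<kappa>) g = Cod (WHDTS \<kappa>) f \<and> Dom (WHDTS \<kappa>) h = Cod (WHDTS \<kappa>) g"
    then have "state_map f \<in> states (source f) \<rightarrow>\<^sub>E states (source g)"
      "action_map f \<in> actions (source f) \<rightarrow>\<^sub>E actions (source g)"
      by (auto simp: WHDTS_def Let_def hdts_map_def)
    then show "Comp (WHDTS \<kappa>) h (Comp (WHDTS \<kappa>) g f) = Comp (WHDTS \<kappa>) (Comp (WHDTS \<kappa>) h g) f"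
      by (simp add: WHDTS_def Let_def)
  qed (auto simp: WHDTS_def Let_def hom_def hdts_map_restrict_id
        intro: hdts_map_compose, auto simp: hdts_map_def)
qed

lemma category_CTS: "category (CTS \<kappa>)"
  unfolding CTS_def by (intro category_full_subcat category_WHDTS)

end

theory Submission
  imports Defs
begin

text \<open>
  Call a map local if composition with it is a bijection on maps into every \<open>CSA1\<close> object.  A map is
  local iff its reflection is an isomorphism, and the local maps form a localizer.  For trivial
  fibrations \<open>p\<close> this holds because \<open>p\<close> has a section (lift along \<open>\<emptyset> \<rightarrow> Y\<close>), is bijective on states,
  and identifies only actions that every map into a \<open>CSA1\<close> object identifies.

  Conversely, every \<open>X\<close> has a reflection lying in all localizers.  Suppose \<open>u1\<close> and \<open>u2\<close> are two equally
  labelled actions between the same two states.  Adding a copy \<open>u'\<close> of \<open>u1\<close> to \<open>X\<close> that has only this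
  one transition is a trivial cofibration, and so is adding a copy with all the transitions of \<open>u1\<close>;
  hence the map from the first extension to the second is one too.  Its pushout along \<open>u' \<mapsto> u2\<close> is
  the identity on states and actions and makes \<open>u1\<close> replaceable by \<open>u2\<close> in every transition.  After
  \<open>\<omega>\<close> such steps, performed for all pairs at once, parallel actions have become indistinguishable,
  and the quotient identifying them is a trivial fibration onto a \<open>CSA1\<close> object.
\<close>

section \<open>Orthogonality and reflections\<close>

text \<open>The unit of the reflection merges actions, so in general it is not a cofibration; nor is
  it a trivial fibration, because the actions it merges may occur in different transitions. It
  therefore enters a localizer as a composite: a trivial cofibration that only adds transitions,
  followed by a trivial fibration that only merges actions. The first factor is possible because a
  cofibration has to be injective on actions and nothing else, so transitions may be added and
  states collapsed. Copies of actions are needed because the trivial cofibrations at hand are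
  sections of trivial fibrations, which add new actions; a transition between old actions appears
  only after one such section is cancelled against another and the copy is glued onto an old action.
  One round is not enough, since the added transitions can make further actions parallel. Countably
  many rounds are, since a transition has finitely many entries and the coherence axiom finitely
  many premises.\<close>

lemma categoryD:
  assumes "category C"
  shows "f \<in> Arr C \<Longrightarrow> Dom C f \<in> Obj C" "f \<in> Arr C \<Longrightarrow> Cod C f \<in> Obj C"
    "X \<in> Obj C \<Longrightarrow> Ident C X \<in> hom C X X"
    "f \<in> Arr C \<Longrightarrow> g \<in> Arr C \<Longrightarrow> Dom C g = Cod C f \<Longrightarrow> Comp C g f \<in> hom C (Dom C f) (Cod C g)"
    "f \<in> Arr C \<Longrightarrow> Comp C f (Ident C (Dom C f)) = f"
    "f \<in> Arr C \<Longrightarrow> Comp C (Ident C (Cod C f)) f = f"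
    "f \<in> Arr C \<Longrightarrow> g \<in> Arr C \<Longrightarrow> h \<in> Arr C \<Longrightarrow> Dom C g = Cod C f \<Longrightarrow> Dom C h = Cod C g \<Longrightarrow>
       Comp C h (Comp C g f) = Comp C (Comp C h g) f"
  using assms unfolding category_def by (elim conjE; blast)+

lemma hom_comp:
  assumes "category C" "f \<in> hom C X Y" "g \<in> hom C Y Z"
  shows "Comp C g f \<in> hom C X Z"
  using categoryD(4)[OF assms(1), of f g] assms(2,3) by (simp add: hom_def)

lemma comp_assoc:
  assumes "category C" "f \<in> hom C X Y" "g \<in> hom C Y Z" "h \<in> hom C Z V"
  shows "Comp C h (Comp C g f) = Comp C (Comp C h g) f"
  using categoryD(7)[OF assms(1), of f g h] assms(2-4) by (simp add: hom_def)

lemma hom_ident: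
  assumes "category C" "X \<in> Obj C"
  shows "Ident C X \<in> hom C X X"
  using categoryD(3)[OF assms] .

lemma comp_ident:
  assumes "category C" "f \<in> hom C X Y"
  shows "Comp C f (Ident C X) = f" "Comp C (Ident C Y) f = f"
  using categoryD(5,6)[OF assms(1), of f] assms(2) by (auto simp: hom_def)

lemma hom_objs:
  assumes "category C" "f \<in> hom C X Y"
  shows "X \<in> Obj C" "Y \<in> Obj C"
  using categoryD(1,2)[OF assms(1), of f] assms(2) by (auto simp: hom_def)

lemma arr_hom: "f \<in> Arr C \<Longrightarrow> f \<in> hom C (Dom C f) (Cod C f)"
  by (simp add: hom_def)

section \<open>Maps local with respect to a class of objects\<close>

definition orth :: "('o, 'm) cat \<Rightarrow> 'o set \<Rightarrow> 'm set" where
  "orth C S = {f \<in> Arr C. \<forall>Z \<in> Obj C \<inter> S.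
     bij_betw (\<lambda>h. Comp C h f) (hom C (Cod C f) Z) (hom C (Dom C f) Z)}"

lemma bij_betw_iff_ex1:
  assumes "f ` A \<subseteq> B"
  shows "bij_betw f A B \<longleftrightarrow> (\<forall>b \<in> B. \<exists>!a. a \<in> A \<and> f a = b)"
proof
  assume f: "bij_betw f A B"
  show "\<forall>b \<in> B. \<exists>!a. a \<in> A \<and> f a = b"
  proof
    fix b assume "b \<in> B"
    then obtain a where a: "a \<in> A" "f a = b" using f by (auto simp: bij_betw_def)
    then show "\<exists>!a. a \<in> A \<and> f a = b"
      using bij_betw_imp_inj_on[OF f] by (auto dest: inj_onD)
  qed
next
  assume ex: "\<forall>b \<in> B. \<exists>!a. a \<in> A \<and> f a = b"
  have "x = y" if "x \<in> A" "y \<in> A" "f x = f y" for x y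
    using ex[rule_format, of "f x"] assms that by auto
  moreover have "B \<subseteq> f ` A" using ex by blast
  ultimately show "bij_betw f A B" using assms by (auto simp: bij_betw_def inj_on_def)
qed

lemma precomp_image:
  assumes "category C" "f \<in> hom C X Y"
  shows "(\<lambda>h. Comp C h f) ` hom C Y Z \<subseteq> hom C X Z"
  using hom_comp[OF assms] by blast

text \<open>Both forms are used: bijectivity makes two-out-of-three immediate, while unique
  extension fits universal properties and the definition of a reflection.\<close>

lemma orth_iff:
  assumes "category C"
  shows "f \<in> orth C S \<longleftrightarrow> f \<in> Arr C \<and> (\<forall>Z \<in> Obj C \<inter> S. \<forall>g \<in> hom C (Dom C f) Z.
     \<exists>!h. h \<in> hom C (Cod C f) Z \<and> Comp C h f = g)"
proof (cases "f \<in> Arr C")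
  case True
  show ?thesis
    unfolding orth_def mem_Collect_eq bij_betw_iff_ex1[OF precomp_image[OF assms arr_hom[OF True]]] ..
qed (simp add: orth_def)

lemma orthI:
  assumes "category C" "f \<in> hom C X Y"
    and "\<And>Z g. Z \<in> Obj C \<inter> S \<Longrightarrow> g \<in> hom C X Z \<Longrightarrow> \<exists>!h. h \<in> hom C Y Z \<and> Comp C h f = g"
  shows "f \<in> orth C S"
proof -
  have "f \<in> Arr C" "Dom C f = X" "Cod C f = Y" using assms(2) by (auto simp: hom_def)
  then show ?thesis unfolding orth_iff[OF assms(1)] using assms(3) by blast
qed

lemma orthD:
  assumes "category C" "f \<in> orth C S" "f \<in> hom C X Y" "Z \<in> Obj C \<inter> S" "g \<in> hom C X Z"
  shows "\<exists>!h. h \<in> hom C Y Z \<and> Comp C h f = g"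
proof -
  have "Dom C f = X" "Cod C f = Y" using assms(3) by (auto simp: hom_def)
  then show ?thesis using assms unfolding orth_iff[OF assms(1)] by blast
qed

lemma is_reflection_iff_orth:
  assumes "category C"
  shows "is_reflection C S X e \<longleftrightarrow> e \<in> orth C S \<and> Dom C e = X \<and> Cod C e \<in> Obj C \<inter> S"
  unfolding is_reflection_def orth_iff[OF assms] by auto

lemma ident_in_orth:
  assumes "category C" "X \<in> Obj C"
  shows "Ident C X \<in> orth C S"
proof -
  have "Ident C X \<in> Arr C" "Dom C (Ident C X) = X" "Cod C (Ident C X) = X"
    using hom_ident[OF assms] by (auto simp: hom_def)
  then show ?thesis
    unfolding orth_iff[OF assms(1)] using comp_ident[OF assms(1)] by auto
qed

text \<open>Precomposition turns a composite of maps into a composite of functions, so this is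
  two-out-of-three for bijections between hom-sets.\<close>

lemma two_out_of_three_orth:
  assumes C: "category C"
  shows "two_out_of_three C (orth C S)"
  unfolding two_out_of_three_def
proof (intro ballI impI)
  fix f g assume f: "f \<in> Arr C" and g: "g \<in> Arr C" and fg: "Dom C g = Cod C f"
  let ?b = "\<lambda>f Z. bij_betw (\<lambda>h. Comp C h f) (hom C (Cod C f) Z) (hom C (Dom C f) Z)"
  have f': "f \<in> hom C (Dom C f) (Cod C f)" and g': "g \<in> hom C (Cod C f) (Cod C g)"
    using f g fg by (auto simp: hom_def)
  have gf: "Comp C g f \<in> hom C (Dom C f) (Cod C g)"
    using hom_comp[OF C f' g'] .
  have Dom: "Dom C (Comp C g f) = Dom C f" and Cod: "Cod C (Comp C g f) = Cod C g"
    using gf by (auto simp: hom_def)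
  have "(?b f Z \<longrightarrow> ?b g Z = ?b (Comp C g f) Z) \<and> (?b g Z \<longrightarrow> ?b f Z = ?b (Comp C g f) Z)" for Z
  proof -
    have eq: "((\<lambda>h. Comp C h f) \<circ> (\<lambda>h. Comp C h g)) h = Comp C h (Comp C g f)"
      if "h \<in> hom C (Cod C g) Z" for h
      using comp_assoc[OF C f' g' that] by simp
    have "?b (Comp C g f) Z \<longleftrightarrow>
        bij_betw ((\<lambda>h. Comp C h f) \<circ> (\<lambda>h. Comp C h g)) (hom C (Cod C g) Z) (hom C (Dom C f) Z)"
      unfolding Dom Cod by (rule bij_betw_cong) (simp only: eq)
    moreover have "?b g Z \<longleftrightarrow>
        bij_betw (\<lambda>h. Comp C h g) (hom C (Cod C g) Z) (hom C (Cod C f) Z)"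
      using fg by simp
    ultimately show ?thesis
      using bij_betw_comp_iff bij_betw_comp_iff2[OF _ precomp_image[OF C g']] by blast
  qed
  then show "(f \<in> orth C S \<and> g \<in> orth C S \<longrightarrow> Comp C g f \<in> orth C S) \<and>
      (f \<in> orth C S \<and> Comp C g f \<in> orth C S \<longrightarrow> g \<in> orth C S) \<and>
      (g \<in> orth C S \<and> Comp C g f \<in> orth C S \<longrightarrow> f \<in> orth C S)"
    using f g gf unfolding orth_def by (auto simp: hom_def)
qed

text \<open>To extend \<open>a\<close> along \<open>j\<close>, first extend \<open>a\<close> after
  \<open>u\<close> along \<open>i\<close> to some \<open>b\<close>, then apply the universal
  property to \<open>a\<close> and \<open>b\<close>. Every extension \<open>h\<close> of
  \<open>a\<close> satisfies \<open>h\<close> after \<open>v\<close> equals \<open>b\<close>,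
  because extensions along \<open>i\<close> are unique; hence \<open>h\<close> is unique
  too.\<close>

lemma orth_pushout:
  assumes C: "category C" and i: "i \<in> orth C S" and po: "is_pushout C i u j v"
  shows "j \<in> orth C S"
proof -
  have u: "u \<in> hom C (Dom C i) (Cod C u)" and i': "i \<in> hom C (Dom C i) (Cod C i)"
    and j: "j \<in> hom C (Cod C u) (Cod C j)" and v: "v \<in> hom C (Cod C i) (Cod C j)"
    and sq: "Comp C j u = Comp C v i"
    using po unfolding is_pushout_def by (auto simp: hom_def)
  have "\<exists>!h. h \<in> hom C (Cod C j) Z \<and> Comp C h j = a"
    if Z: "Z \<in> Obj C \<inter> S" and a': "a \<in> hom C (Cod C u) Z" for Z a
  proof -
    obtain b where b: "b \<in> hom C (Cod C i) Z" "Comp C b i = Comp C a u"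
      and bu: "\<And>b'. b' \<in> hom C (Cod C i) Z \<Longrightarrow> Comp C b' i = Comp C a u \<Longrightarrow> b' = b"
      using i Z hom_comp[OF C u a'] unfolding orth_iff[OF C] by metis
    have "\<exists>!h. h \<in> hom C (Cod C j) Z \<and> Comp C h j = a \<and> Comp C h v = b"
      using po Z a' b unfolding is_pushout_def by auto
    moreover have "Comp C h v = b" if h: "h \<in> hom C (Cod C j) Z" "Comp C h j = a" for h
      using bu[OF hom_comp[OF C v h(1)]] comp_assoc[OF C i' v h(1)] comp_assoc[OF C u j h(1)] sq h(2)
      by simp
    ultimately show ?thesis by blast
  qed
  then show ?thesis
    by (rule orthI[OF C j])
qed

text \<open>The cases match the data of a transfinite composite: its first stage, its single steps,
  and the stages that are required to be colimits.\<close>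

lemma well_order_cases_induct [consumes 2, case_names zero succ lim]:
  assumes r: "Well_order r" and y: "y \<in> Field r"
    and zero: "\<And>y. y \<in> Field r \<Longrightarrow> underS r y = {} \<Longrightarrow> P y"
    and succ: "\<And>x y. immediate_succ r x y \<Longrightarrow> P x \<Longrightarrow> P y"
    and lim: "\<And>y. limit_index r y \<Longrightarrow> (\<And>x. x \<in> underS r y \<Longrightarrow> P x) \<Longrightarrow> P y"
  shows "P y"
proof -
  have "y \<in> Field r \<longrightarrow> P y"
  proof (induction y rule: wo_rel.well_order_induct[of r])
    case 1 then show ?case using r by (simp add: wo_rel_def)
  next
    case (2 y)
    have IH: "P x" if "x \<in> underS r y" for x
      using 2 underS_E[OF that] FieldI1[of x y r] by blast
    show ?case
    proof
      assume y: "y \<in> Field r"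
      consider "underS r y = {}" | x where "immediate_succ r x y" | "limit_index r y"
        using y unfolding limit_index_def by blast
      then show "P y"
      proof cases
        case 1 then show ?thesis using zero[OF y] by blast
      next
        case (2 x)
        then have "x \<in> underS r y" by (auto simp: immediate_succ_def underS_def)
        then show ?thesis using succ[OF 2] IH by blast
      next
        case 3 then show ?thesis using lim IH by blast
      qed
    qed
  qed
  then show ?thesis using y by blast
qed

lemma well_order_least:
  assumes "Well_order r" "x0 \<in> Field r" "underS r x0 = {}" "y \<in> Field r"
  shows "(x0, y) \<in> r"
  using wo_rel.TOTALS[of r] assms(1,2,4) underS_I[of y x0 r] assms(3) unfolding wo_rel_def by blast

lemma diagramD:
  assumes "is_diagram C r D d"
  shows "x \<in> Field r \<Longrightarrow> D x \<in> Obj C" "x \<in> Field r \<Longrightarrow> d x x = Ident C (D x)"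
    "(x, y) \<in> r \<Longrightarrow> d x y \<in> hom C (D x) (D y)"
    "(x, y) \<in> r \<Longrightarrow> (y, z) \<in> r \<Longrightarrow> Comp C (d y z) (d x y) = d x z"
  using assms unfolding is_diagram_def by (blast, blast, blast, metis)

text \<open>The unique extensions of \<open>g\<close> along the maps \<open>d x0 x\<close> form a
  cocone, again by uniqueness. A map out of the colimit induces this cocone exactly when it
  restricts to \<open>g\<close> at \<open>x0\<close>, so the universal property becomes unique
  extension along \<open>c x0\<close>.\<close>

lemma orth_colimit:
  assumes C: "category C" and D: "is_diagram C r D d" and col: "is_colimit C r I D d P c"
    and x0: "x0 \<in> I" "\<And>x. x \<in> I \<Longrightarrow> (x0, x) \<in> r" and orth: "\<And>x. x \<in> I \<Longrightarrow> d x0 x \<in> orth C S"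
  shows "c x0 \<in> orth C S"
proof -
  have c: "c x \<in> hom C (D x) P" if "x \<in> I" for x
    using col that unfolding is_colimit_def is_cocone_def by blast
  have cc: "Comp C (c y) (d x y) = c x" if "x \<in> I" "y \<in> I" "(x, y) \<in> r" for x y
    using col that unfolding is_colimit_def is_cocone_def by blast
  have d: "d x y \<in> hom C (D x) (D y)" if "(x, y) \<in> r" for x y
    using diagramD(3)[OF D that] .
  have "\<exists>!h. h \<in> hom C P Z \<and> Comp C h (c x0) = g"
    if Z: "Z \<in> Obj C \<inter> S" and g: "g \<in> hom C (D x0) Z" for Z g
  proof -
    have ex: "\<exists>!h. h \<in> hom C (D x) Z \<and> Comp C h (d x0 x) = g" if "x \<in> I" for x
      using orthD[OF C orth[OF that] d[OF x0(2)[OF that]] Z g] .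
    define q where "q x = (THE h. h \<in> hom C (D x) Z \<and> Comp C h (d x0 x) = g)" for x
    have q: "q x \<in> hom C (D x) Z \<and> Comp C (q x) (d x0 x) = g" if "x \<in> I" for x
      unfolding q_def using theI'[OF ex[OF that]] .
    have qu: "h = q x" if "x \<in> I" "h \<in> hom C (D x) Z" "Comp C h (d x0 x) = g" for x h
      using ex[OF that(1)] q[OF that(1)] that(2,3) by blast
    have "Comp C (q y) (d x y) = q x" if "x \<in> I" "y \<in> I" "(x, y) \<in> r" for x y
    proof (rule qu[OF that(1)])
      show "Comp C (q y) (d x y) \<in> hom C (D x) Z"
        using hom_comp[OF C d[OF that(3)]] q[OF that(2)] by blast
      show "Comp C (Comp C (q y) (d x y)) (d x0 x) = g"
        using comp_assoc[OF C d[OF x0(2)[OF that(1)]] d[OF that(3)], of "q y" Z] q[OF that(2)]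
          diagramD(4)[OF D x0(2)[OF that(1)] that(3)] by simp
    qed
    then have "is_cocone C r I D d Z q"
      using q Z unfolding is_cocone_def by auto
    then have exP: "\<exists>!h. h \<in> hom C P Z \<and> (\<forall>x \<in> I. Comp C h (c x) = q x)"
      using col unfolding is_colimit_def by blast
    have "(\<forall>x \<in> I. Comp C h (c x) = q x) \<longleftrightarrow> Comp C h (c x0) = g" if h: "h \<in> hom C P Z" for h
    proof
      assume "\<forall>x \<in> I. Comp C h (c x) = q x"
      then have "Comp C h (c x0) = q x0" using x0 by blast
      then show "Comp C h (c x0) = g"
        using q[OF x0(1)] diagramD(2)[OF D FieldI1[OF x0(2)[OF x0(1)]]] comp_ident(1)[OF C, of "q x0" "D x0" Z]
        by simp
    next
      assume g: "Comp C h (c x0) = g"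
      show "\<forall>x \<in> I. Comp C h (c x) = q x"
      proof
        fix x assume x: "x \<in> I"
        show "Comp C h (c x) = q x"
          using qu[OF x hom_comp[OF C c[OF x] h]] g cc[OF x0(1) x x0(2)[OF x]]
            comp_assoc[OF C d[OF x0(2)[OF x]] c[OF x] h] by simp
      qed
    qed
    then have "(h \<in> hom C P Z \<and> (\<forall>x \<in> I. Comp C h (c x) = q x)) \<longleftrightarrow> (h \<in> hom C P Z \<and> Comp C h (c x0) = g)" for h
      by blast
    then show ?thesis using exP by simp
  qed
  then show ?thesis
    by (rule orthI[OF C c[OF x0(1)]])
qed

lemma orth_transfinite_composite:
  assumes C: "category C" and f: "transfinite_composite C r (orth C S) f"
  shows "f \<in> orth C S"
proof -
  obtain D d P c x0 where r: "Well_order r" and D: "is_diagram C r D d"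
    and colim: "\<And>y. limit_index r y \<Longrightarrow> is_colimit C r (underS r y) D d (D y) (\<lambda>x. d x y)"
    and step: "\<And>x y. immediate_succ r x y \<Longrightarrow> d x y \<in> orth C S"
    and col: "is_colimit C r (Field r) D d P c"
    and x0: "x0 \<in> Field r" "underS r x0 = {}" and fc: "f = c x0"
    using f unfolding transfinite_composite_def
    by (elim conjE exE bexE) (rule that, assumption+, simp_all)
  have least: "(x0, y) \<in> r" if "y \<in> Field r" for y
    using well_order_least[OF r x0 that] .
  have "d x0 y \<in> orth C S" if "y \<in> Field r" for y
    using r that
  proof (induction rule: well_order_cases_induct)
    case (zero y)
    then have "y = x0"
      using least[of y] by (auto simp: underS_def)
    then show ?case
      using diagramD(1,2)[OF D x0(1)] ident_in_orth[OF C] by simp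
  next
    case (succ x y)
    then have xy: "(x, y) \<in> r" and x: "x \<in> Field r"
      by (auto simp: immediate_succ_def Field_def)
    have "d x y \<in> orth C S" using succ(1) step by blast
    then have "Comp C (d x y) (d x0 x) \<in> orth C S"
      using succ(2) diagramD(3)[OF D xy] diagramD(3)[OF D least[OF x]]
        two_out_of_three_orth[OF C, of S, unfolded two_out_of_three_def, rule_format,
          of "d x0 x" "d x y"]
      by (simp add: hom_def)
    then show ?case using diagramD(4)[OF D least[OF x] xy] by simp
  next
    case (lim y)
    then have y: "y \<in> Field r" "underS r y \<noteq> {}" by (auto simp: limit_index_def)
    then have "x0 \<noteq> y" using x0 by blast
    then have "x0 \<in> underS r y" using least[OF y(1)] by (simp add: underS_def)
    then show ?case
      using orth_colimit[OF C D colim[OF lim(1)], of x0 S] least lim(2) underS_Field by fast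
  qed
  then show ?thesis
    using orth_colimit[OF C D col x0(1) least] fc by blast
qed

section \<open>Isomorphisms and the action of the reflector on maps\<close>

lemma hom_full_subcat:
  "hom (full_subcat C S) X Y = (if X \<in> S \<and> Y \<in> S then hom C X Y else {})"
  unfolding hom_def full_subcat_def by auto

lemma is_iso_full_subcat:
  assumes "Dom C f \<in> S" "Cod C f \<in> S"
  shows "is_iso (full_subcat C S) f \<longleftrightarrow> is_iso C f"
  using assms unfolding is_iso_def hom_full_subcat by (auto simp: full_subcat_def)

lemma iso_in_orth:
  assumes C: "category C" and f: "is_iso C f"
  shows "f \<in> orth C S"
proof -
  have f': "f \<in> hom C (Dom C f) (Cod C f)"
    by (rule arr_hom[OF conjunct1[OF f[unfolded is_iso_def]]])
  obtain g where g: "g \<in> hom C (Cod C f) (Dom C f)"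
    and gf: "Comp C g f = Ident C (Dom C f)" and fg: "Comp C f g = Ident C (Cod C f)"
    using f unfolding is_iso_def by blast
  have "\<exists>!h. h \<in> hom C (Cod C f) Z \<and> Comp C h f = a" if a: "a \<in> hom C (Dom C f) Z" for Z a
  proof (rule ex1I[of _ "Comp C a g"])
    show "Comp C a g \<in> hom C (Cod C f) Z \<and> Comp C (Comp C a g) f = a"
      using hom_comp[OF C g a] comp_assoc[OF C f' g a] gf comp_ident[OF C a] by simp
    show "h = Comp C a g" if "h \<in> hom C (Cod C f) Z \<and> Comp C h f = a" for h
      using comp_assoc[OF C g f' conjunct1[OF that]] fg comp_ident(1)[OF C conjunct1[OF that]] that
      by simp
  qed
  then show ?thesis
    by (rule orthI[OF C f'])
qed

lemma ex1_eq: "\<exists>!x. P x \<Longrightarrow> P a \<Longrightarrow> P b \<Longrightarrow> a = b"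
  by blast

text \<open>The Yoneda argument: extending the identity along \<open>f\<close> gives a left inverse
  \<open>g\<close>, and \<open>f\<close> after \<open>g\<close> is the identity since both extend
  \<open>f\<close> along \<open>f\<close>.\<close>

lemma orth_iso:
  assumes C: "category C" and f: "f \<in> orth C S" and S: "Dom C f \<in> S" "Cod C f \<in> S"
  shows "is_iso C f"
proof -
  have f': "f \<in> hom C (Dom C f) (Cod C f)"
    using f by (auto simp: orth_def hom_def)
  note ob = hom_objs[OF C f']
  have "\<exists>!g. g \<in> hom C (Cod C f) (Dom C f) \<and> Comp C g f = Ident C (Dom C f)"
    using orthD[OF C f f'] S ob hom_ident[OF C ob(1)] by simp
  then obtain g where g: "g \<in> hom C (Cod C f) (Dom C f)" "Comp C g f = Ident C (Dom C f)"
    by (elim ex1E conjE)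
  have *: "\<exists>!h. h \<in> hom C (Cod C f) (Cod C f) \<and> Comp C h f = f"
    using orthD[OF C f f'] S ob f' by simp
  have "Comp C (Comp C f g) f = f"
    using comp_assoc[OF C f' g(1) f'] g(2) comp_ident(1)[OF C f'] by simp
  then have fg: "Comp C f g = Ident C (Cod C f)"
    using hom_comp[OF C g(1) f'] hom_ident[OF C ob(2)] comp_ident(2)[OF C f']
    by - (rule ex1_eq[OF *]; intro conjI)
  show ?thesis
    unfolding is_iso_def
  proof (intro conjI bexI[of _ g])
    show "f \<in> Arr C" using f' by (simp add: hom_def)
  qed (fact g fg)+
qed

lemma iso_in_rlp:
  assumes C: "category C" and f: "is_iso C f" and A: "A \<subseteq> Arr C"
  shows "f \<in> rlp C A"
proof -
  have f': "f \<in> hom C (Dom C f) (Cod C f)"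
    by (rule arr_hom[OF conjunct1[OF f[unfolded is_iso_def]]])
  obtain g where g: "g \<in> hom C (Cod C f) (Dom C f)"
    and gf: "Comp C g f = Ident C (Dom C f)" and fg: "Comp C f g = Ident C (Cod C f)"
    using f unfolding is_iso_def by blast
  have "has_lift C i f" if "i \<in> A" for i
    unfolding has_lift_def
  proof (intro ballI impI)
    fix u v assume u: "u \<in> hom C (Dom C i) (Dom C f)" and v: "v \<in> hom C (Cod C i) (Cod C f)"
      and sq: "Comp C f u = Comp C v i"
    have i: "i \<in> hom C (Dom C i) (Cod C i)" using that A by (auto simp: hom_def)
    have "Comp C (Comp C g v) i = u"
      using comp_assoc[OF C i v g] comp_assoc[OF C u f' g] sq gf comp_ident[OF C u] by simp
    moreover have "Comp C f (Comp C g v) = v"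
      using comp_assoc[OF C v g f'] fg comp_ident[OF C v] by simp
    ultimately show "\<exists>h \<in> hom C (Cod C i) (Dom C f). Comp C h i = u \<and> Comp C f h = v"
      using hom_comp[OF C v g] by blast
  qed
  then show ?thesis using f unfolding rlp_def is_iso_def by blast
qed

lemma refl_unit:
  assumes "is_reflection C S X e"
  shows "is_reflection C S X (refl_unit C S X)"
  unfolding refl_unit_def using assms by (rule someI)

lemma reflector:
  assumes C: "category C" and f: "f \<in> Arr C"
    and X: "is_reflection C S (Dom C f) e" and Y: "is_reflection C S (Cod C f) e'"
  shows "reflector C S f \<in>
      hom C (Cod C (refl_unit C S (Dom C f))) (Cod C (refl_unit C S (Cod C f)))"
    "Comp C (reflector C S f) (refl_unit C S (Dom C f)) = Comp C (refl_unit C S (Cod C f)) f"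
proof -
  let ?e = "refl_unit C S (Dom C f)" and ?e' = "refl_unit C S (Cod C f)"
  have e: "is_reflection C S (Dom C f) ?e" and e': "is_reflection C S (Cod C f) ?e'"
    by (rule refl_unit[OF X], rule refl_unit[OF Y])
  have "Comp C ?e' f \<in> hom C (Dom C f) (Cod C ?e')"
    using hom_comp[OF C arr_hom[OF f], of ?e'] e' by (simp add: is_reflection_def hom_def)
  then have "\<exists>!h. h \<in> hom C (Cod C ?e) (Cod C ?e') \<and> Comp C h ?e = Comp C ?e' f"
    using e e' unfolding is_reflection_def by simp
  note th = theI'[OF this, folded reflector_def]
  show "reflector C S f \<in> hom C (Cod C ?e) (Cod C ?e')" by (rule conjunct1[OF th])
  show "Comp C (reflector C S f) ?e = Comp C ?e' f" by (rule conjunct2[OF th])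
qed

text \<open>In the naturality square of \<open>f\<close> both units are local, so by
  two-out-of-three the reflected map is local iff \<open>f\<close> is. Between objects of
  \<open>S\<close>, local means invertible.\<close>

lemma is_iso_reflector_iff:
  assumes C: "category C" and f: "f \<in> Arr C"
    and ex: "\<And>X. X \<in> Obj C \<Longrightarrow> \<exists>e. is_reflection C S X e"
  shows "is_iso (full_subcat C S) (reflector C S f) \<longleftrightarrow> f \<in> orth C S"
proof -
  let ?e = "refl_unit C S (Dom C f)" and ?e' = "refl_unit C S (Cod C f)" and ?R = "reflector C S f"
  obtain e e' where "is_reflection C S (Dom C f) e" "is_reflection C S (Cod C f) e'"
    using ex hom_objs[OF C arr_hom[OF f]] by blast
  note R = reflector[OF C f this] and refl_unit[OF this(1)] refl_unit[OF this(2)]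
  then have e: "?e \<in> orth C S" "Dom C ?e = Dom C f" "Cod C ?e \<in> S"
    and e': "?e' \<in> orth C S" "Dom C ?e' = Cod C f" "Cod C ?e' \<in> S"
    by (auto simp: is_reflection_iff_orth[OF C])
  have arr: "?e \<in> Arr C" "?e' \<in> Arr C" using e(1) e'(1) by (auto simp: orth_def)
  have R1: "?R \<in> Arr C" "Dom C ?R = Cod C ?e" "Cod C ?R = Cod C ?e'"
    using R(1) by (auto simp: hom_def)
  note t = two_out_of_three_orth[OF C, of S, unfolded two_out_of_three_def, rule_format]
  have "?R \<in> orth C S \<longleftrightarrow> Comp C ?R ?e \<in> orth C S"
    using t[OF arr(1) R1(1) R1(2)] e(1) by blast
  also have "\<dots> \<longleftrightarrow> f \<in> orth C S"
    using t[OF f arr(2) e'(2)] e'(1) R(2) by auto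
  finally have "?R \<in> orth C S \<longleftrightarrow> f \<in> orth C S" .
  moreover have "is_iso C ?R \<longleftrightarrow> ?R \<in> orth C S"
    using iso_in_orth[OF C] orth_iso[OF C, of ?R S] R1 e(3) e'(3) by auto
  ultimately show ?thesis
    using is_iso_full_subcat[of C ?R S] R1 e(3) e'(3) by simp
qed

section \<open>Weak higher dimensional transition systems\<close>

definition trans_space :: "'s set \<Rightarrow> 'a set \<Rightarrow> ('s \<times> 'a list \<times> 's) set" where
  "trans_space S A = {(\<alpha>, us, \<beta>). \<alpha> \<in> S \<and> \<beta> \<in> S \<and> us \<noteq> [] \<and> set us \<subseteq> A}"

text \<open>The multiset and coherence axioms are separated from the typing condition
  \<open>trans_space\<close>. Both parts are stable under intersection, which yields images and
  generated transitions.\<close>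

definition trans_closed :: "('s \<times> 'a list \<times> 's) set \<Rightarrow> bool" where
  "trans_closed T \<longleftrightarrow>
     (\<forall>\<alpha> us vs \<beta>. (\<alpha>, us, \<beta>) \<in> T \<and> mset vs = mset us \<longrightarrow> (\<alpha>, vs, \<beta>) \<in> T) \<and>
     (\<forall>\<alpha> us vs ws \<beta> \<nu>1 \<nu>2. us \<noteq> [] \<and> vs \<noteq> [] \<and> ws \<noteq> [] \<and>
        (\<alpha>, us @ vs @ ws, \<beta>) \<in> T \<and> (\<alpha>, us, \<nu>1) \<in> T \<and> (\<nu>1, vs @ ws, \<beta>) \<in> T \<and>
        (\<alpha>, us @ vs, \<nu>2) \<in> T \<and> (\<nu>2, ws, \<beta>) \<in> T \<longrightarrow> (\<nu>1, vs, \<nu>2) \<in> T)"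

lemma weak_hdts_iff:
  "weak_hdts X \<longleftrightarrow> label X \<in> extensional (actions X) \<and>
     trans X \<subseteq> trans_space (states X) (actions X) \<and> trans_closed (trans X)"
proof -
  have "trans X \<subseteq> trans_space (states X) (actions X) \<longleftrightarrow>
    (\<forall>\<alpha> us \<beta>. (\<alpha>, us, \<beta>) \<in> trans X \<longrightarrow>
        \<alpha> \<in> states X \<and> \<beta> \<in> states X \<and> us \<noteq> [] \<and> set us \<subseteq> actions X)"
    unfolding trans_space_def by fast
  then show ?thesis unfolding weak_hdts_def trans_closed_def by presburger
qed

lemma trans_closedI:
  assumes "\<And>\<alpha> us vs \<beta>. (\<alpha>, us, \<beta>) \<in> T \<Longrightarrow> mset vs = mset us \<Longrightarrow> (\<alpha>, vs, \<beta>) \<in> T"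
    and "\<And>\<alpha> us vs ws \<beta> \<nu>1 \<nu>2. us \<noteq> [] \<Longrightarrow> vs \<noteq> [] \<Longrightarrow> ws \<noteq> [] \<Longrightarrow>
      (\<alpha>, us @ vs @ ws, \<beta>) \<in> T \<Longrightarrow> (\<alpha>, us, \<nu>1) \<in> T \<Longrightarrow> (\<nu>1, vs @ ws, \<beta>) \<in> T \<Longrightarrow>
      (\<alpha>, us @ vs, \<nu>2) \<in> T \<Longrightarrow> (\<nu>2, ws, \<beta>) \<in> T \<Longrightarrow> (\<nu>1, vs, \<nu>2) \<in> T"
  shows "trans_closed T"
  unfolding trans_closed_def
proof (intro conjI allI impI)
qed (elim conjE; rule assms; assumption)+

lemma trans_closedD:
  assumes "trans_closed T"
  shows "(\<alpha>, us, \<beta>) \<in> T \<Longrightarrow> mset vs = mset us \<Longrightarrow> (\<alpha>, vs, \<beta>) \<in> T"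
    and "us \<noteq> [] \<Longrightarrow> vs \<noteq> [] \<Longrightarrow> ws \<noteq> [] \<Longrightarrow>
      (\<alpha>, us @ vs @ ws, \<beta>) \<in> T \<Longrightarrow> (\<alpha>, us, \<nu>1) \<in> T \<Longrightarrow> (\<nu>1, vs @ ws, \<beta>) \<in> T \<Longrightarrow>
      (\<alpha>, us @ vs, \<nu>2) \<in> T \<Longrightarrow> (\<nu>2, ws, \<beta>) \<in> T \<Longrightarrow> (\<nu>1, vs, \<nu>2) \<in> T"
  using assms unfolding trans_closed_def by blast+

lemma trans_spaceD:
  assumes "trans X \<subseteq> trans_space (states X) (actions X)" "(\<alpha>, us, \<beta>) \<in> trans X"
  shows "\<alpha> \<in> states X" "\<beta> \<in> states X" "us \<noteq> []" "set us \<subseteq> actions X"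
  using assms unfolding trans_space_def by auto

lemma trans_closed_trans_space: "trans_closed (trans_space S A)"
proof (rule trans_closedI, goal_cases)
  case (1 \<alpha> us vs \<beta>)
  then show ?case using mset_eq_setD[OF 1(2)] by (auto simp: trans_space_def)
qed (auto simp: trans_space_def)

lemma trans_closed_Int:
  assumes "trans_closed T" "trans_closed T'"
  shows "trans_closed (T \<inter> T')"
proof (rule trans_closedI, goal_cases)
  case (1 \<alpha> us vs \<beta>)
  then show ?case
    using trans_closedD(1)[OF assms(1), of \<alpha> us \<beta> vs] trans_closedD(1)[OF assms(2), of \<alpha> us \<beta> vs]
    by simp
next
  case (2 \<alpha> us vs ws \<beta> \<nu>1 \<nu>2)
  then show ?case
    using trans_closedD(2)[OF assms(1) 2(1-3), of \<alpha> \<beta> \<nu>1 \<nu>2]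
      trans_closedD(2)[OF assms(2) 2(1-3), of \<alpha> \<beta> \<nu>1 \<nu>2] by simp
qed

lemma trans_closed_Inter:
  assumes "\<And>T. T \<in> \<T> \<Longrightarrow> trans_closed T"
  shows "trans_closed (\<Inter>\<T>)"
proof (rule trans_closedI, goal_cases)
  case (1 \<alpha> us vs \<beta>)
  then show ?case using trans_closedD(1)[OF assms, of _ \<alpha> us \<beta> vs] by blast
next
  case (2 \<alpha> us vs ws \<beta> \<nu>1 \<nu>2)
  have "(\<nu>1, vs, \<nu>2) \<in> T" if "T \<in> \<T>" for T
    by (rule trans_closedD(2)[OF assms[OF that] 2(1-3), of \<alpha> \<beta>]) (use 2(4-8) that in simp_all)
  then show ?case by blast
qed

text \<open>Together with \<open>trans_gen_least\<close>, this reduces the claim that a map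
  preserves all generated transitions to a check on generators.\<close>

lemma trans_closed_preimage:
  assumes "trans_closed T"
  shows "trans_closed {(\<alpha>, us, \<beta>). (f0 \<alpha>, map f1 us, f0 \<beta>) \<in> T}"
proof (rule trans_closedI, goal_cases)
  case (1 \<alpha> us vs \<beta>)
  then show ?case using trans_closedD(1)[OF assms, of _ "map f1 us" _ "map f1 vs"] by simp
next
  case (2 \<alpha> us vs ws \<beta> \<nu>1 \<nu>2)
  then show ?case
    using trans_closedD(2)[OF assms, of "map f1 us" "map f1 vs" "map f1 ws" "f0 \<alpha>" "f0 \<beta>"] by simp
qed

text \<open>Needed for pushouts, where coherence can combine transitions coming from the two sides
  into a new one.\<close>

inductive_set trans_gen :: "('s \<times> 'a list \<times> 's) set \<Rightarrow> ('s \<times> 'a list \<times> 's) set"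
  for T where
  base: "t \<in> T \<Longrightarrow> t \<in> trans_gen T"
| perm: "(\<alpha>, us, \<beta>) \<in> trans_gen T \<Longrightarrow> mset vs = mset us \<Longrightarrow> (\<alpha>, vs, \<beta>) \<in> trans_gen T"
| coherence: "us \<noteq> [] \<Longrightarrow> vs \<noteq> [] \<Longrightarrow> ws \<noteq> [] \<Longrightarrow>
    (\<alpha>, us @ vs @ ws, \<beta>) \<in> trans_gen T \<Longrightarrow> (\<alpha>, us, \<nu>1) \<in> trans_gen T \<Longrightarrow>
    (\<nu>1, vs @ ws, \<beta>) \<in> trans_gen T \<Longrightarrow> (\<alpha>, us @ vs, \<nu>2) \<in> trans_gen T \<Longrightarrow>
    (\<nu>2, ws, \<beta>) \<in> trans_gen T \<Longrightarrow> (\<nu>1, vs, \<nu>2) \<in> trans_gen T"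

lemma trans_closed_gen: "trans_closed (trans_gen T)"
  by (rule trans_closedI; rule trans_gen.intros(2,3); assumption)

lemma trans_gen_least:
  assumes "T \<subseteq> T'" "trans_closed T'"
  shows "trans_gen T \<subseteq> T'"
proof
  fix t assume "t \<in> trans_gen T"
  then show "t \<in> T'"
  proof induction
    case (base t) then show ?case using assms(1) by blast
  next
    case (perm \<alpha> us \<beta> vs) then show ?case using trans_closedD(1)[OF assms(2)] by blast
  next
    case (coherence us vs ws \<alpha> \<beta> \<nu>1 \<nu>2)
    show ?case by (rule trans_closedD(2)[OF assms(2) coherence(1-3) coherence(9-13)])
  qed
qed

text \<open>
  Unlike in \<open>hdts_map\<close>, values outside the domain are not constrained, so that \<open>id\<close> and \<open>\<circ>\<close> serve
  as identities and composition.
\<close>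

definition hmor ::
    "('s, 'a, 'l) hdts \<Rightarrow> ('t, 'b, 'l) hdts \<Rightarrow> ('s \<Rightarrow> 't) \<Rightarrow> ('a \<Rightarrow> 'b) \<Rightarrow> bool" where
  "hmor X Y f0 f1 \<longleftrightarrow> f0 ` states X \<subseteq> states Y \<and> f1 ` actions X \<subseteq> actions Y \<and>
     (\<forall>u \<in> actions X. label Y (f1 u) = label X u) \<and>
     (\<forall>\<alpha> us \<beta>. (\<alpha>, us, \<beta>) \<in> trans X \<longrightarrow> (f0 \<alpha>, map f1 us, f0 \<beta>) \<in> trans Y)"

lemma hmorI:
  assumes "\<And>s. s \<in> states X \<Longrightarrow> f0 s \<in> states Y" "\<And>u. u \<in> actions X \<Longrightarrow> f1 u \<in> actions Y"
    and "\<And>u. u \<in> actions X \<Longrightarrow> label Y (f1 u) = label X u"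
    and "\<And>\<alpha> us \<beta>. (\<alpha>, us, \<beta>) \<in> trans X \<Longrightarrow> (f0 \<alpha>, map f1 us, f0 \<beta>) \<in> trans Y"
  shows "hmor X Y f0 f1"
  using assms unfolding hmor_def by blast

lemma hmorD:
  assumes "hmor X Y f0 f1"
  shows "s \<in> states X \<Longrightarrow> f0 s \<in> states Y" "u \<in> actions X \<Longrightarrow> f1 u \<in> actions Y"
    "u \<in> actions X \<Longrightarrow> label Y (f1 u) = label X u"
    "(\<alpha>, us, \<beta>) \<in> trans X \<Longrightarrow> (f0 \<alpha>, map f1 us, f0 \<beta>) \<in> trans Y"
  using assms unfolding hmor_def by blast+

lemma hmor_cong:
  assumes X: "trans X \<subseteq> trans_space (states X) (actions X)"
    and 0: "\<And>s. s \<in> states X \<Longrightarrow> f0 s = g0 s" and 1: "\<And>u. u \<in> actions X \<Longrightarrow> f1 u = g1 u"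
  shows "hmor X Y f0 f1 \<longleftrightarrow> hmor X Y g0 g1"
proof -
  have "(f0 \<alpha>, map f1 us, f0 \<beta>) = (g0 \<alpha>, map g1 us, g0 \<beta>)" if "(\<alpha>, us, \<beta>) \<in> trans X" for \<alpha> us \<beta>
    using trans_spaceD[OF X that] 0 1 by auto
  then have "(\<forall>\<alpha> us \<beta>. (\<alpha>, us, \<beta>) \<in> trans X \<longrightarrow> (f0 \<alpha>, map f1 us, f0 \<beta>) \<in> trans Y) \<longleftrightarrow>
      (\<forall>\<alpha> us \<beta>. (\<alpha>, us, \<beta>) \<in> trans X \<longrightarrow> (g0 \<alpha>, map g1 us, g0 \<beta>) \<in> trans Y)"
    by metis
  moreover have "f0 ` states X = g0 ` states X" "f1 ` actions X = g1 ` actions X"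
    using 0 1 by (auto intro: image_cong)
  ultimately show ?thesis
    unfolding hmor_def using 1 by simp
qed

lemma hmor_comp:
  assumes "hmor X Y f0 f1" "hmor Y Z g0 g1"
  shows "hmor X Z (g0 \<circ> f0) (g1 \<circ> f1)"
proof (rule hmorI)
  show "((g0 \<circ> f0) \<alpha>, map (g1 \<circ> f1) us, (g0 \<circ> f0) \<beta>) \<in> trans Z" if "(\<alpha>, us, \<beta>) \<in> trans X" for \<alpha> us \<beta>
    using hmorD(4)[OF assms(2) hmorD(4)[OF assms(1) that]] by simp
qed (auto simp: hmorD[OF assms(1)] hmorD[OF assms(2)])

lemma hdts_map_iff:
  "hdts_map X Y f0 f1 \<longleftrightarrow>
     hmor X Y f0 f1 \<and> f0 \<in> extensional (states X) \<and> f1 \<in> extensional (actions X)"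
  unfolding hdts_map_def hmor_def PiE_iff by auto

lemma hdts_map_restrict:
  assumes X: "trans X \<subseteq> trans_space (states X) (actions X)"
  shows "hdts_map X Y (restrict f0 (states X)) (restrict f1 (actions X)) \<longleftrightarrow> hmor X Y f0 f1"
  using hmor_cong[OF X, of "restrict f0 (states X)" f0 "restrict f1 (actions X)" f1 Y]
  by (simp add: hdts_map_iff)

lemma weak_hdtsD:
  assumes "weak_hdts X"
  shows "label X \<in> extensional (actions X)" "trans X \<subseteq> trans_space (states X) (actions X)"
    "trans_closed (trans X)"
  using assms by (auto simp: weak_hdts_iff)

section \<open>Subsystems and cubical systems\<close>

lemma subsystemD:
  assumes "subsystem U X"
  shows "weak_hdts U" "states U \<subseteq> states X" "actions U \<subseteq> actions X"
    "a \<in> actions U \<Longrightarrow> label U a = label X a" "trans U \<subseteq> trans X"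
  using assms by (auto simp: subsystem_def)

definition subsys ::
    "('s, 'a, 'l) hdts \<Rightarrow> 's set \<Rightarrow> 'a set \<Rightarrow> ('s \<times> 'a list \<times> 's) set \<Rightarrow> ('s, 'a, 'l) hdts" where
  "subsys X S A T = \<lparr>states = S, actions = A, label = restrict (label X) A, trans = T\<rparr>"

lemma subsys_simps [simp]:
  "states (subsys X S A T) = S" "actions (subsys X S A T) = A"
  "label (subsys X S A T) = restrict (label X) A" "trans (subsys X S A T) = T"
  by (simp_all add: subsys_def)

lemma subsystem_subsys:
  assumes "S \<subseteq> states X" "A \<subseteq> actions X" "T \<subseteq> trans X" "T \<subseteq> trans_space S A" "trans_closed T"
  shows "subsystem (subsys X S A T) X"
  using assms by (simp add: subsystem_def weak_hdts_iff)

lemma subsystem_antisym: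
  assumes "subsystem U X" "weak_hdts X"
    and "states X \<subseteq> states U" "actions X \<subseteq> actions U" "trans X \<subseteq> trans U"
  shows "U = X"
proof -
  have "actions U = actions X" using assms by (auto simp: subsystem_def)
  moreover have "restrict (label X) (actions X) = label X"
    using weak_hdtsD(1)[OF assms(2)] by (rule extensional_restrict)
  ultimately show ?thesis
    using assms by (intro hdts.equality) (auto simp: subsystem_def)
qed

lemma trans_cube: "trans (cube xs) \<subseteq> trans_space (states (cube xs)) (actions (cube xs))"
  by (auto simp: cube_def trans_space_def)

lemma trans_cube_distinct: "(e, us, e') \<in> trans (cube xs) \<Longrightarrow> distinct us"
  by (auto simp: cube_def distinct_map)

text \<open>Expresses that \<open>U\<close> contains every subcube of \<open>X\<close> through maps
  out of cubes, so that images need not be handled when cubicality is used or proved.\<close>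

definition factors_cubes :: "('s, 'a, 'l) hdts \<Rightarrow> ('s, 'a, 'l) hdts \<Rightarrow> bool" where
  "factors_cubes X U \<longleftrightarrow>
     (\<forall>xs f0 f1. hmor (cube xs) X f0 f1 \<longrightarrow> hmor (cube xs) U f0 f1)"

lemma hmor_subsystem: "subsystem U X \<Longrightarrow> hmor U X id id"
  using subsystemD[of U X] by (intro hmorI) auto

lemma hmor_into_subsystem:
  assumes "hmor K X f0 f1" "subsystem U X"
    and "f0 ` states K \<subseteq> states U" "f1 ` actions K \<subseteq> actions U"
    and "\<And>\<alpha> us \<beta>. (\<alpha>, us, \<beta>) \<in> trans K \<Longrightarrow> (f0 \<alpha>, map f1 us, f0 \<beta>) \<in> trans U"
  shows "hmor K U f0 f1"
proof (rule hmorI)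
  show "label U (f1 u) = label K u" if "u \<in> actions K" for u
    using subsystemD(4)[OF assms(2)] hmorD(3)[OF assms(1) that] assms(4) that by auto
qed (use assms(3-5) in auto)

lemma subsystem_refl: "weak_hdts X \<Longrightarrow> subsystem X X"
  using extensional_restrict[OF weak_hdtsD(1), symmetric] by (auto simp: subsystem_def)

lemma cubicalD:
  assumes "cubical X" and U: "subsystem U X" "factors_cubes X U"
  shows "U = X"
proof -
  have X: "weak_hdts X" using assms(1) by (simp add: cubical_def)
  have "subsystem Z U" if Z: "subcube Z X" for Z
  proof -
    obtain xs f0 f1 where f: "hdts_map (cube xs) X f0 f1" and im: "is_image (cube xs) X f0 f1 Z"
      using Z unfolding subcube_def by blast
    have "hdts_map (cube xs) U f0 f1"
      using f U(2) unfolding hdts_map_iff factors_cubes_def by blast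
    then show ?thesis using im U(1) unfolding is_image_def by blast
  qed
  then have "subsystem X U"
    using assms(1) U(1) unfolding cubical_def is_union_def by blast
  then show ?thesis
    using subsystem_antisym[OF U(1) X] by (simp add: subsystem_def)
qed

text \<open>The image is the intersection of all subsystems through which the map factors;
  \<open>X\<close> itself makes this family nonempty. In \<open>cubicalI\<close> it turns a bound on
  all subcubes into a factorization of all maps from cubes.\<close>

lemma is_image_ex:
  assumes X: "weak_hdts X" and K: "trans K \<subseteq> trans_space (states K) (actions K)"
    and f: "hdts_map K X f0 f1"
  shows "\<exists>Z. is_image K X f0 f1 Z"
proof -
  let ?P = "\<lambda>U. subsystem U X \<and> hdts_map K U f0 f1"
  let ?S = "\<Inter>(states ` Collect ?P)" and ?A = "\<Inter>(actions ` Collect ?P)"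
    and ?T = "\<Inter>(trans ` Collect ?P)"
  let ?Z = "subsys X ?S ?A ?T"
  have PX: "?P X" using f subsystem_refl[OF X] by blast
  have "?T \<subseteq> trans_space ?S ?A"
  proof
    fix t assume t: "t \<in> ?T"
    have "t \<in> trans_space (states U) (actions U)" if "?P U" for U
      using t that weak_hdtsD(2)[OF subsystemD(1), of U X] by blast
    then show "t \<in> trans_space ?S ?A"
      using PX unfolding trans_space_def by (cases t) auto
  qed
  moreover have "trans_closed ?T"
    by (rule trans_closed_Inter) (auto dest: subsystemD(1) weak_hdtsD(3))
  ultimately have Z: "subsystem ?Z X"
    using PX by (intro subsystem_subsys) auto
  have "hmor K ?Z f0 f1"
  proof (rule hmor_into_subsystem[OF _ Z])
    show "hmor K X f0 f1" using f by (simp add: hdts_map_iff)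
    show "f0 ` states K \<subseteq> states ?Z" "f1 ` actions K \<subseteq> actions ?Z"
      by (auto simp: hdts_map_iff dest: hmorD(1,2))
    show "(f0 \<alpha>, map f1 us, f0 \<beta>) \<in> trans ?Z" if "(\<alpha>, us, \<beta>) \<in> trans K" for \<alpha> us \<beta>
      using hmorD(4)[OF _ that] by (auto simp: hdts_map_iff)
  qed
  then have fZ: "hdts_map K ?Z f0 f1"
    using f by (simp add: hdts_map_iff)
  have "subsystem ?Z U" if U: "?P U" for U
  proof -
    have "?A \<subseteq> actions U" using U by blast
    then have "restrict (label X) ?A = restrict (label U) ?A"
      using subsystemD(4)[OF conjunct1[OF U]] by (intro restrict_ext) fastforce
    moreover have "?S \<subseteq> states U" "?T \<subseteq> trans U" using U by blast+
    ultimately show ?thesis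
      using \<open>?A \<subseteq> actions U\<close> subsystemD(1)[OF Z] unfolding subsystem_def by simp
  qed
  then show ?thesis using Z fZ unfolding is_image_def by blast
qed

lemma cubicalI:
  assumes X: "weak_hdts X"
    and gen: "\<And>U. subsystem U X \<Longrightarrow> factors_cubes X U \<Longrightarrow>
      states X \<subseteq> states U \<and> actions X \<subseteq> actions U \<and> trans X \<subseteq> trans U"
  shows "cubical X"
  unfolding cubical_def is_union_def
proof (intro conjI X subsystem_refl[OF X] ballI allI impI)
  show "subsystem Z X" if "Z \<in> {Z. subcube Z X}" for Z
    using that unfolding subcube_def is_image_def by blast
  fix U assume U: "subsystem U X \<and> (\<forall>Z \<in> {Z. subcube Z X}. subsystem Z U)"
  have "factors_cubes X U"
    unfolding factors_cubes_def
  proof (intro allI impI)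
    fix xs f0 f1 assume f: "hmor (cube xs) X f0 f1"
    let ?f0 = "restrict f0 (states (cube xs))" and ?f1 = "restrict f1 (actions (cube xs))"
    have f': "hdts_map (cube xs) X ?f0 ?f1"
      using f by (simp add: hdts_map_restrict[OF trans_cube])
    then obtain Z where Z: "is_image (cube xs) X ?f0 ?f1 Z"
      using is_image_ex[OF X trans_cube] by blast
    then have "subsystem Z U" using U f' unfolding subcube_def by blast
    moreover have "hmor (cube xs) Z f0 f1"
      using Z unfolding is_image_def by (simp add: hdts_map_restrict[OF trans_cube])
    ultimately show "hmor (cube xs) U f0 f1"
      using hmor_comp[OF _ hmor_subsystem] by fastforce
  qed
  then show "subsystem X U"
    using subsystem_antisym[of U X] gen[of U] U X by auto
qed

text \<open>The preimage of \<open>U\<close> in \<open>K\<close> is a subsystem containing every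
  cube of \<open>K\<close>, hence all of \<open>K\<close>. So a subsystem that captures cubes
  captures all cubical systems.\<close>

lemma cubical_hmor_factors:
  assumes K: "cubical K" and f: "hmor K R f0 f1" and U: "subsystem U R" "factors_cubes R U"
  shows "hmor K U f0 f1"
proof -
  let ?S = "{s \<in> states K. f0 s \<in> states U}" and ?A = "{a \<in> actions K. f1 a \<in> actions U}"
    and ?T = "trans K \<inter> {(\<alpha>, us, \<beta>). (f0 \<alpha>, map f1 us, f0 \<beta>) \<in> trans U}"
  let ?V = "subsys K ?S ?A ?T"
  have K': "weak_hdts K" using K by (simp add: cubical_def)
  note U' = subsystemD(1)[OF U(1)]
  have "?T \<subseteq> trans_space ?S ?A"
    using weak_hdtsD(2)[OF K'] weak_hdtsD(2)[OF U'] by (fastforce simp: trans_space_def)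
  moreover have "trans_closed ?T"
    by (intro trans_closed_Int trans_closed_preimage weak_hdtsD(3) K' U')
  ultimately have V: "subsystem ?V K"
    by (intro subsystem_subsys) auto
  have "factors_cubes K ?V"
    unfolding factors_cubes_def
  proof (intro allI impI)
    fix xs g0 g1 assume g: "hmor (cube xs) K g0 g1"
    have "hmor (cube xs) U (f0 \<circ> g0) (f1 \<circ> g1)"
      using hmor_comp[OF g f] U(2) unfolding factors_cubes_def by blast
    note h = hmorD[OF this]
    show "hmor (cube xs) ?V g0 g1"
    proof (rule hmor_into_subsystem[OF g V])
      show "(g0 \<alpha>, map g1 us, g0 \<beta>) \<in> trans ?V" if "(\<alpha>, us, \<beta>) \<in> trans (cube xs)" for \<alpha> us \<beta>
        using h(4)[OF that] hmorD(4)[OF g that] by simp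
    qed (use h(1,2) hmorD(1,2)[OF g] in auto)
  qed
  note VK = cubicalD[OF K V this]
  have S: "states K = ?S" and A: "actions K = ?A" and T: "trans K = ?T"
    by (subst VK[symmetric], simp)+
  show ?thesis
  proof (rule hmor_into_subsystem[OF f U(1)])
    show "f0 ` states K \<subseteq> states U" using S by blast
    show "f1 ` actions K \<subseteq> actions U" using A by blast
    show "(f0 \<alpha>, map f1 us, f0 \<beta>) \<in> trans U" if "(\<alpha>, us, \<beta>) \<in> trans K" for \<alpha> us \<beta>
      using T that by blast
  qed
qed

lemma cubical_weak: "cubical X \<Longrightarrow> weak_hdts X"
  by (simp add: cubical_def)

lemmas cubicalD_space = weak_hdtsD(2)[OF cubical_weak]

text \<open>Coherence is vacuous when every transition has length one. Bare states are images of the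
  \<open>0\<close>-cube and transitions are images of \<open>1\<close>-cubes; an action is reached
  by a cube only through a transition, whence the last assumption.\<close>

lemma cubical_dim1:
  assumes l: "label X \<in> extensional (actions X)"
    and T: "\<And>\<alpha> us \<beta>. (\<alpha>, us, \<beta>) \<in> trans X \<Longrightarrow>
        \<alpha> \<in> states X \<and> \<beta> \<in> states X \<and> (\<exists>u \<in> actions X. us = [u])"
    and used: "\<And>u. u \<in> actions X \<Longrightarrow> \<exists>\<alpha> \<beta>. (\<alpha>, [u], \<beta>) \<in> trans X"
  shows "cubical X"
proof (rule cubicalI)
  have "trans_closed (trans X)"
  proof (rule trans_closedI, goal_cases)
    case (1 \<alpha> us vs \<beta>)
    then show ?case using T[OF 1(1)] by auto
  next
    case (2 \<alpha> us vs ws \<beta> \<nu>1 \<nu>2)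
    then show ?case using T[OF 2(4)] by (auto simp: append_eq_Cons_conv)
  qed
  moreover have "trans X \<subseteq> trans_space (states X) (actions X)"
    using T by (fastforce simp: trans_space_def)
  ultimately show "weak_hdts X" using l by (simp add: weak_hdts_iff)
next
  fix U assume U: "subsystem U X" and fc: "factors_cubes X U"
  have 0: "s \<in> states U" if "s \<in> states X" for s
  proof -
    have "hmor (cube []) X (\<lambda>_. s) undefined"
      using that by (intro hmorI) (auto simp: cube_def)
    then have "hmor (cube []) U (\<lambda>_. s) undefined"
      using fc unfolding factors_cubes_def by blast
    from hmorD(1)[OF this, of "[]"] show ?thesis by (simp add: cube_def)
  qed
  have 1: "u \<in> actions U \<and> (\<alpha>, [u], \<beta>) \<in> trans U" if t: "(\<alpha>, [u], \<beta>) \<in> trans X" for \<alpha> u \<beta>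
  proof -
    let ?x = "label X u" and ?f0 = "\<lambda>e. if hd e then \<beta> else \<alpha>"
    have cube: "e = [False] \<and> us = [(?x, 1)] \<and> e' = [True]" if "(e, us, e') \<in> trans (cube [?x])" for e us e'
    proof -
      have us: "us \<noteq> []" "set us \<subseteq> {(?x, 1)}" "distinct us"
        and e: "length e = 1" "length e' = 1" "e ! 0 \<le> e' ! 0" "e ! 0 \<noteq> e' ! 0 \<longleftrightarrow> 1 \<in> snd ` set us"
        using that trans_cube_distinct[OF that] by (auto simp: cube_def)
      have "us = [(?x, 1)]"
        using us by (cases us; cases "tl us") auto
      then show ?thesis
        using e by (auto simp: length_Suc_conv)
    qed
    have "hmor (cube [?x]) X ?f0 (\<lambda>_. u)"
    proof (rule hmorI)
      show "(?f0 e, map (\<lambda>_. u) us, ?f0 e') \<in> trans X" if "(e, us, e') \<in> trans (cube [?x])" for e us e'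
        using cube[OF that] t by simp
    qed (use T[OF t] in \<open>auto simp: cube_def\<close>)
    then have h: "hmor (cube [?x]) U ?f0 (\<lambda>_. u)"
      using fc unfolding factors_cubes_def by blast
    have "(\<alpha>, [u], \<beta>) \<in> trans U"
      using hmorD(4)[OF h, of "[False]" "[(?x, 1)]" "[True]"] by (simp add: cube_def)
    then show ?thesis
      using trans_spaceD(4)[OF weak_hdtsD(2)[OF subsystemD(1)[OF U]]] by fastforce
  qed
  show "states X \<subseteq> states U \<and> actions X \<subseteq> actions U \<and> trans X \<subseteq> trans U"
  proof (intro conjI subsetI)
    fix t assume t: "t \<in> trans X"
    obtain \<alpha> us \<beta> where [simp]: "t = (\<alpha>, us, \<beta>)" by (cases t)
    show "t \<in> trans U" using T[of \<alpha> us \<beta>] t 1 by auto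
  qed (use 0 1 used in blast)+
qed

text \<open>The cartesian lift of \<open>X\<close> along \<open>\<pi>\<close> for the functor sending a system to its actions.\<close>

definition lift_sys :: "('s, 'a, 'l) hdts \<Rightarrow> 'b set \<Rightarrow> ('b \<Rightarrow> 'a) \<Rightarrow> ('s, 'b, 'l) hdts" where
  "lift_sys X A \<pi> = \<lparr>states = states X, actions = A, label = restrict (label X \<circ> \<pi>) A,
     trans = {(\<alpha>, us, \<beta>). set us \<subseteq> A \<and> (\<alpha>, map \<pi> us, \<beta>) \<in> trans X}\<rparr>"

lemma lift_sys_simps [simp]:
  "states (lift_sys X A \<pi>) = states X" "actions (lift_sys X A \<pi>) = A"
  "u \<in> A \<Longrightarrow> label (lift_sys X A \<pi>) u = label X (\<pi> u)"
  "(\<alpha>, us, \<beta>) \<in> trans (lift_sys X A \<pi>) \<longleftrightarrow> set us \<subseteq> A \<and> (\<alpha>, map \<pi> us, \<beta>) \<in> trans X"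
  by (auto simp: lift_sys_def)

lemma weak_hdts_lift_sys:
  assumes X: "weak_hdts X"
  shows "weak_hdts (lift_sys X A \<pi>)"
proof -
  have eq: "trans (lift_sys X A \<pi>) =
      trans_space (states X) A \<inter> {(\<alpha>, us, \<beta>). (id \<alpha>, map \<pi> us, id \<beta>) \<in> trans X}"
    using trans_spaceD[OF weak_hdtsD(2)[OF X]] by (fastforce simp: trans_space_def)
  show ?thesis
    unfolding weak_hdts_iff
  proof (intro conjI)
    show "label (lift_sys X A \<pi>) \<in> extensional (actions (lift_sys X A \<pi>))"
      by (simp add: lift_sys_def)
    show "trans_closed (trans (lift_sys X A \<pi>))"
      unfolding eq
      by (intro trans_closed_Int trans_closed_trans_space trans_closed_preimage weak_hdtsD(3) X)
  qed (simp add: eq)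
qed

text \<open>Transitions of the lift are tested in \<open>X\<close>, so every function
  \<open>k\<close> on actions that lies over \<open>g1\<close> gives a map.\<close>

lemma hmor_lift_sys:
  assumes g: "hmor K X g0 g1" and K: "trans K \<subseteq> trans_space (states K) (actions K)"
    and k: "\<And>u. u \<in> actions K \<Longrightarrow> k u \<in> A \<and> \<pi> (k u) = g1 u"
  shows "hmor K (lift_sys X A \<pi>) g0 k"
proof (rule hmorI)
  fix \<alpha> us \<beta> assume t: "(\<alpha>, us, \<beta>) \<in> trans K"
  have "map \<pi> (map k us) = map g1 us"
    using trans_spaceD(4)[OF K t] k by auto
  moreover have "set (map k us) \<subseteq> A" using trans_spaceD(4)[OF K t] k by auto
  ultimately show "(g0 \<alpha>, map k us, g0 \<beta>) \<in> trans (lift_sys X A \<pi>)"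
    using hmorD(4)[OF g t] unfolding lift_sys_simps(4) by (simp only: simp_thms)
qed (use hmorD[OF g] k in auto)

lemma hmor_lift_sys_proj:
  assumes "\<pi> ` A \<subseteq> actions X"
  shows "hmor (lift_sys X A \<pi>) X id \<pi>"
  using assms by (intro hmorI) auto

lemma ex_map_eq:
  assumes "set vs \<subseteq> f ` A"
  shows "\<exists>us. set us \<subseteq> A \<and> map f us = vs"
proof -
  have "map f (map (inv_into A f) vs) = vs"
    using assms by (auto intro!: map_idI simp: f_inv_into_f subset_iff)
  moreover have "set (map (inv_into A f) vs) \<subseteq> A"
    using assms by (auto intro: inv_into_into)
  ultimately show ?thesis by blast
qed

lemma mset_eq_map_lift:
  assumes "mset vs = mset (map f us)"
  shows "\<exists>us'. mset us' = mset us \<and> map f us' = vs"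
proof -
  have "list_all2 (\<lambda>v u. v = f u) (map f us) us" by (simp add: list_all2_conv_all_nth)
  from list_all2_reorder_left_invariance[OF this assms] show ?thesis
    by (auto simp: list_all2_conv_all_nth list_eq_iff_nth_eq)
qed

text \<open>The actions in a transition of a cube are distinct, so any list of lifts of their images
  comes from a function on actions.\<close>

lemma distinct_ex_map:
  assumes "distinct us" "length ws = length us"
  shows "\<exists>k. map k us = ws"
  using assms
proof (induction us arbitrary: ws)
  case (Cons u us)
  then obtain w ws' where ws: "ws = w # ws'" "length ws' = length us" by (cases ws) auto
  then obtain k where "map k us = ws'" using Cons by auto
  moreover have "map (k(u := w)) us = map k us" using Cons.prems by auto
  ultimately have "map (k(u := w)) (u # us) = ws" using ws by simp
  then show ?case by blast
qed simp

text \<open>Let \<open>U\<close> contain all cubes of the lift, and let \<open>?V\<close> consist of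
  those parts of \<open>X\<close> all of whose lifts lie in \<open>U\<close>. A map from a cube to
  \<open>X\<close> can be lifted with prescribed values on one action or on one transition, so
  \<open>?V\<close> contains all cubes of \<open>X\<close>. As \<open>X\<close> is cubical,
  \<open>?V\<close> is \<open>X\<close>, and \<open>U\<close> is the whole lift.\<close>

lemma cubical_lift_sys:
  assumes X: "cubical X" and \<pi>: "\<pi> ` A = actions X"
  shows "cubical (lift_sys X A \<pi>)"
proof (rule cubicalI)
  note wX = cubical_weak[OF X]
  note XD = weak_hdtsD(2)[OF wX]
  show "weak_hdts (lift_sys X A \<pi>)" using weak_hdts_lift_sys[OF wX] .
  fix U assume U: "subsystem U (lift_sys X A \<pi>)" and fc: "factors_cubes (lift_sys X A \<pi>) U"
  note wU = subsystemD(1)[OF U]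
  note UD = trans_spaceD[OF weak_hdtsD(2)[OF wU]]
  let ?A = "{a \<in> actions X. \<forall>b \<in> A. \<pi> b = a \<longrightarrow> b \<in> actions U}"
    and ?T = "{(\<alpha>, vs, \<beta>). (\<alpha>, vs, \<beta>) \<in> trans X \<and>
      (\<forall>us. set us \<subseteq> A \<and> map \<pi> us = vs \<longrightarrow> (\<alpha>, us, \<beta>) \<in> trans U)}"
  let ?V = "subsys X (states U) ?A ?T"
  have ex: "\<exists>us. set us \<subseteq> A \<and> map \<pi> us = vs" if "set vs \<subseteq> actions X" for vs
    using ex_map_eq[of vs \<pi> A] that \<pi> by simp
  have "subsystem ?V X"
  proof (rule subsystem_subsys)
    show "states U \<subseteq> states X" using subsystemD(2)[OF U] by simp
    show "?T \<subseteq> trans_space (states U) ?A"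
    proof clarify
      fix \<alpha> vs \<beta> assume t: "(\<alpha>, vs, \<beta>) \<in> trans X"
        and l: "\<forall>us. set us \<subseteq> A \<and> map \<pi> us = vs \<longrightarrow> (\<alpha>, us, \<beta>) \<in> trans U"
      note tD = trans_spaceD[OF XD t]
      obtain us where us: "set us \<subseteq> A" "map \<pi> us = vs" using ex[OF tD(4)] by blast
      then have "\<alpha> \<in> states U" "\<beta> \<in> states U" using l UD(1,2) by blast+
      moreover have "b \<in> actions U" if vb: "\<pi> b \<in> set vs" and b: "b \<in> A" for b
      proof -
        \<comment> \<open>Overwriting one entry of a lift of \<open>vs\<close> by \<open>b\<close>
          gives another lift. It belongs to \<open>U\<close> as all lifts do, so \<open>b\<close> is
          an action of \<open>U\<close>.\<close>
        have "\<exists>us. set us \<subseteq> A \<and> map \<pi> us = vs \<and> b \<in> set us"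
        proof -
          obtain n where n: "n < length vs" "vs ! n = \<pi> b" using vb by (auto simp: in_set_conv_nth)
          have len: "length us = length vs" using arg_cong[OF us(2), of length] by (simp only: length_map)
          have "map \<pi> (us[n := b]) = vs"
            unfolding map_update us(2) n(2)[symmetric] by (rule list_update_id)
          moreover have "set (us[n := b]) \<subseteq> A" by (rule set_update_subsetI[OF us(1) b])
          moreover have "b \<in> set (us[n := b])" using n(1) len by (simp only: set_update_memI)
          ultimately show ?thesis by (intro exI[of _ "us[n := b]"] conjI)
        qed
        then obtain us' where "set us' \<subseteq> A" "map \<pi> us' = vs" "b \<in> set us'" by blast
        then show ?thesis using UD(4)[OF l[rule_format, of us']] by blast
      qed
      ultimately show "(\<alpha>, vs, \<beta>) \<in> trans_space (states U) ?A"
        using tD by (auto simp: trans_space_def)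
    qed
    show "trans_closed ?T"
    proof (rule trans_closedI, goal_cases)
      case (1 \<alpha> us vs \<beta>)
      have "(\<alpha>, ws, \<beta>) \<in> trans U" if ws: "set ws \<subseteq> A" "map \<pi> ws = vs" for ws
      proof -
        obtain ws' where ws': "mset ws' = mset ws" "map \<pi> ws' = us"
          using mset_eq_map_lift[of us \<pi> ws] 1(2) ws(2) by auto
        then have "(\<alpha>, ws', \<beta>) \<in> trans U"
          using 1(1) mset_eq_setD[OF ws'(1)] ws(1) by auto
        then show ?thesis
          using trans_closedD(1)[OF weak_hdtsD(3)[OF wU]] ws'(1) by metis
      qed
      then show ?case
        using 1 trans_closedD(1)[OF weak_hdtsD(3)[OF wX], of \<alpha> us \<beta> vs] by blast
    next
      case (2 \<alpha> us vs ws \<beta> \<nu>1 \<nu>2)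
      have X': "(\<nu>1, vs, \<nu>2) \<in> trans X"
        by (rule trans_closedD(2)[OF weak_hdtsD(3)[OF wX] 2(1-3), of \<alpha> \<beta>]) (use 2(4-8) in simp_all)
      have tX: "(\<alpha>, us, \<nu>1) \<in> trans X" "(\<nu>2, ws, \<beta>) \<in> trans X" using 2(5,8) by simp_all
      have "(\<nu>1, vs', \<nu>2) \<in> trans U" if vs': "set vs' \<subseteq> A" "map \<pi> vs' = vs" for vs'
      proof -
        obtain us' where us': "set us' \<subseteq> A" "map \<pi> us' = us"
          using ex[OF trans_spaceD(4)[OF XD tX(1)]] by blast
        obtain ws' where ws': "set ws' \<subseteq> A" "map \<pi> ws' = ws"
          using ex[OF trans_spaceD(4)[OF XD tX(2)]] by blast
        have "us' \<noteq> []" "vs' \<noteq> []" "ws' \<noteq> []" using 2(1-3) us' vs' ws' by auto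
        moreover have "(\<alpha>, us' @ vs' @ ws', \<beta>) \<in> trans U" "(\<alpha>, us', \<nu>1) \<in> trans U"
          "(\<nu>1, vs' @ ws', \<beta>) \<in> trans U" "(\<alpha>, us' @ vs', \<nu>2) \<in> trans U" "(\<nu>2, ws', \<beta>) \<in> trans U"
          using 2(4-8) us' vs' ws' by auto
        ultimately show ?thesis
          by (rule trans_closedD(2)[OF weak_hdtsD(3)[OF wU]])
      qed
      then show ?case using X' by blast
    qed
  qed blast+
  moreover have "factors_cubes X ?V"
    unfolding factors_cubes_def
  proof (intro allI impI)
    fix xs f0 f1 assume f: "hmor (cube xs) X f0 f1"
    let ?s = "inv_into A \<pi>"
    have s: "?s (f1 c) \<in> A \<and> \<pi> (?s (f1 c)) = f1 c" if "c \<in> actions (cube xs)" for c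
      using hmorD(2)[OF f that] \<pi> by (metis f_inv_into_f inv_into_into)
    have lift: "hmor (cube xs) U f0 k"
      if "\<And>c. c \<in> actions (cube xs) \<Longrightarrow> k c \<in> A \<and> \<pi> (k c) = f1 c" for k
      using hmor_lift_sys[OF f trans_cube that] fc unfolding factors_cubes_def by blast
    show "hmor (cube xs) ?V f0 f1"
    proof (rule hmor_into_subsystem[OF f \<open>subsystem ?V X\<close>])
      show "f0 ` states (cube xs) \<subseteq> states ?V"
        using hmorD(1)[OF lift[OF s]] by auto
      show "f1 ` actions (cube xs) \<subseteq> actions ?V"
      proof clarsimp
        fix c assume c: "c \<in> actions (cube xs)"
        \<comment> \<open>Lift the cube by the chosen section of \<open>\<pi>\<close>, except at
          \<open>c\<close>, where the value is \<open>b\<close>.\<close>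
        have "b \<in> actions U" if "b \<in> A" "\<pi> b = f1 c" for b
          using hmorD(2)[OF lift[of "(\<lambda>c. ?s (f1 c))(c := b)"] c] s that by auto
        then show "f1 c \<in> actions X \<and> (\<forall>b \<in> A. \<pi> b = f1 c \<longrightarrow> b \<in> actions U)"
          using hmorD(2)[OF f c] by blast
      qed
      fix e us e' assume t: "(e, us, e') \<in> trans (cube xs)"
      have "(f0 e, ws, f0 e') \<in> trans U" if ws: "set ws \<subseteq> A" "map \<pi> ws = map f1 us" for ws
      proof -
        obtain k where k: "map k us = ws"
          using distinct_ex_map[OF trans_cube_distinct[OF t], of ws] ws(2) by (metis length_map)
        \<comment> \<open>The prescribed lifts are used on the actions of this transition and the
          chosen section on the remaining directions of the cube.\<close>
        let ?k = "\<lambda>c. if c \<in> set us then k c else ?s (f1 c)"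
        have "k c \<in> A \<and> \<pi> (k c) = f1 c" if "c \<in> set us" for c
          using that ws unfolding k[symmetric] by auto
        then have kU: "hmor (cube xs) U f0 ?k" using s by (intro lift) auto
        have "map ?k us = ws" unfolding k[symmetric] by simp
        then show ?thesis using hmorD(4)[OF kU t] by (simp only:)
      qed
      then show "(f0 e, map f1 us, f0 e') \<in> trans ?V"
        using hmorD(4)[OF f t] by simp
    qed
  qed
  ultimately have V: "?V = X" by (rule cubicalD[OF X])
  have S: "states X = states U" and A: "actions X = ?A" and T: "trans X = ?T"
    by (subst V[symmetric], simp)+
  show "states (lift_sys X A \<pi>) \<subseteq> states U \<and> actions (lift_sys X A \<pi>) \<subseteq> actions U \<and>
      trans (lift_sys X A \<pi>) \<subseteq> trans U"
  proof (intro conjI subsetI)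
    show "s \<in> states U" if "s \<in> states (lift_sys X A \<pi>)" for s using that S by simp
    show "b \<in> actions U" if "b \<in> actions (lift_sys X A \<pi>)" for b
      using that A \<pi> by auto
    fix t assume t: "t \<in> trans (lift_sys X A \<pi>)"
    obtain \<alpha> us \<beta> where [simp]: "t = (\<alpha>, us, \<beta>)" by (cases t)
    have "(\<alpha>, map \<pi> us, \<beta>) \<in> ?T" using t T by simp
    then show "t \<in> trans U" using t by simp
  qed
qed

text \<open>
  The pushout along \<open>(u0, u1) : A \<rightarrow> D\<close> of a map \<open>A \<rightarrow> B\<close> that is the identity on states and an
  inclusion on actions; the actions of \<open>B\<close> not in \<open>A\<close> are assumed not to be actions of \<open>D\<close>.
\<close>

definition po_map :: "('s, 'a, 'l) hdts \<Rightarrow> ('a \<Rightarrow> 'a) \<Rightarrow> 'a \<Rightarrow> 'a" where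
  "po_map A u1 b = (if b \<in> actions A then u1 b else b)"

definition po_sys ::
    "('s, 'a, 'l) hdts \<Rightarrow> ('s, 'a, 'l) hdts \<Rightarrow> ('t, 'a, 'l) hdts \<Rightarrow> ('s \<Rightarrow> 't) \<Rightarrow> ('a \<Rightarrow> 'a) \<Rightarrow>
      ('t, 'a, 'l) hdts" where
  "po_sys A B D u0 u1 = \<lparr>states = states D, actions = actions D \<union> (actions B - actions A),
     label = (\<lambda>a. if a \<in> actions D then label D a
       else if a \<in> actions B - actions A then label B a else undefined),
     trans = trans_gen (trans D \<union> {(u0 \<alpha>, map (po_map A u1) us, u0 \<beta>) | \<alpha> us \<beta>. (\<alpha>, us, \<beta>) \<in> trans B})\<rparr>"

lemma po_sys_simps [simp]:
  "states (po_sys A B D u0 u1) = states D"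
  "actions (po_sys A B D u0 u1) = actions D \<union> (actions B - actions A)"
  by (simp_all add: po_sys_def)

text \<open>As \<open>A\<close> and \<open>B\<close> have the same states and the map between them
  is the identity there, the pushout keeps the states of \<open>D\<close> and the map from
  \<open>B\<close> is \<open>u0\<close> on states. Disjointness makes its action set a plain
  union.\<close>

locale po_data =
  fixes A B :: "('s, 'a, 'l) hdts" and D :: "('t, 'a, 'l) hdts" and u0 :: "'s \<Rightarrow> 't" and u1 :: "'a \<Rightarrow> 'a"
  assumes A: "weak_hdts A" and B: "weak_hdts B" and D: "weak_hdts D"
    and AB: "states A = states B" "hmor A B id id"
    and u: "hmor A D u0 u1"
    and disj: "actions D \<inter> (actions B - actions A) = {}"
begin

abbreviation "P \<equiv> po_sys A B D u0 u1"
abbreviation "v1 \<equiv> po_map A u1"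

lemma v1_actions: "b \<in> actions B \<Longrightarrow> v1 b \<in> actions P"
  using hmorD(2)[OF u] by (auto simp: po_map_def)

lemma trans_P_least:
  assumes "trans_closed T" "trans D \<subseteq> T"
    and "\<And>\<alpha> us \<beta>. (\<alpha>, us, \<beta>) \<in> trans B \<Longrightarrow> (u0 \<alpha>, map v1 us, u0 \<beta>) \<in> T"
  shows "trans P \<subseteq> T"
  unfolding po_sys_def hdts.simps
  by (rule trans_gen_least[OF _ assms(1)]) (use assms(2,3) in blast)

lemma weak_P: "weak_hdts P"
  unfolding weak_hdts_iff
proof (intro conjI)
  show "label P \<in> extensional (actions P)" by (auto simp: po_sys_def extensional_def)
  show "trans_closed (trans P)" by (simp add: po_sys_def trans_closed_gen)
  show "trans P \<subseteq> trans_space (states P) (actions P)"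
  proof (rule trans_P_least)
    show "trans_closed (trans_space (states P) (actions P))" by (rule trans_closed_trans_space)
    show "trans D \<subseteq> trans_space (states P) (actions P)"
      using weak_hdtsD(2)[OF D] by (auto simp: trans_space_def)
    show "(u0 \<alpha>, map v1 us, u0 \<beta>) \<in> trans_space (states P) (actions P)"
      if t: "(\<alpha>, us, \<beta>) \<in> trans B" for \<alpha> us \<beta>
      using trans_spaceD[OF weak_hdtsD(2)[OF B] t] hmorD(1)[OF u] AB(1) v1_actions
      by (auto simp: trans_space_def)
  qed
qed

lemma hmor_D: "hmor D P id id"
proof (rule hmorI)
  show "(id \<alpha>, map id us, id \<beta>) \<in> trans P" if "(\<alpha>, us, \<beta>) \<in> trans D" for \<alpha> us \<beta>
    using that by (auto simp: po_sys_def intro: trans_gen.base)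
qed (auto simp: po_sys_def)

lemma hmor_B: "hmor B P u0 v1"
proof (rule hmorI)
  show "(u0 \<alpha>, map v1 us, u0 \<beta>) \<in> trans P" if "(\<alpha>, us, \<beta>) \<in> trans B" for \<alpha> us \<beta>
    using that by (auto simp: po_sys_def intro!: trans_gen.base)
  show "label P (v1 b) = label B b" if "b \<in> actions B" for b
    using that hmorD(2,3)[OF u] hmorD(3)[OF AB(2)] disj by (auto simp: po_sys_def po_map_def)
  show "u0 s \<in> states P" if "s \<in> states B" for s
    using hmorD(1)[OF u, of s] that AB(1) by simp
qed (rule v1_actions)

lemma hmor_out:
  assumes a: "hmor D Q a0 a1" and b: "hmor B Q b0 b1" and Q: "weak_hdts Q"
    and eq0: "\<And>s. s \<in> states A \<Longrightarrow> a0 (u0 s) = b0 s"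
    and eq1: "\<And>x. x \<in> actions A \<Longrightarrow> a1 (u1 x) = b1 x"
  shows "hmor P Q a0 (\<lambda>x. if x \<in> actions D then a1 x else b1 x)" (is "hmor P Q a0 ?h")
proof (rule hmorI)
  have hv: "?h (v1 x) = b1 x" if "x \<in> actions B" for x
    using that eq1 hmorD(2)[OF u] disj by (auto simp: po_map_def)
  have "trans P \<subseteq> {(\<alpha>, us, \<beta>). (a0 \<alpha>, map ?h us, a0 \<beta>) \<in> trans Q}"
  proof (rule trans_P_least)
    show "trans_closed {(\<alpha>, us, \<beta>). (a0 \<alpha>, map ?h us, a0 \<beta>) \<in> trans Q}"
      by (intro trans_closed_preimage weak_hdtsD(3) Q)
    show "trans D \<subseteq> {(\<alpha>, us, \<beta>). (a0 \<alpha>, map ?h us, a0 \<beta>) \<in> trans Q}"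
    proof clarify
      fix \<alpha> us \<beta> assume t: "(\<alpha>, us, \<beta>) \<in> trans D"
      have "map ?h us = map a1 us" using trans_spaceD(4)[OF weak_hdtsD(2)[OF D] t] by auto
      then show "(a0 \<alpha>, map ?h us, a0 \<beta>) \<in> trans Q" using hmorD(4)[OF a t] by (simp only:)
    qed
    fix \<alpha> us \<beta> assume t: "(\<alpha>, us, \<beta>) \<in> trans B"
    note tD = trans_spaceD[OF weak_hdtsD(2)[OF B] t]
    have "map ?h (map v1 us) = map b1 us"
      unfolding map_map
    proof (rule map_cong[OF refl])
      show "(?h \<circ> v1) x = b1 x" if "x \<in> set us" for x
        unfolding o_apply by (rule hv) (use that tD(4) in blast)
    qed
    moreover have "a0 (u0 \<alpha>) = b0 \<alpha>" "a0 (u0 \<beta>) = b0 \<beta>" using eq0 tD AB(1) by auto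
    ultimately show "(u0 \<alpha>, map v1 us, u0 \<beta>) \<in> {(\<alpha>, us, \<beta>). (a0 \<alpha>, map ?h us, a0 \<beta>) \<in> trans Q}"
      using hmorD(4)[OF b t] by (simp only: mem_Collect_eq prod.case)
  qed
  then show "(a0 \<alpha>, map ?h us, a0 \<beta>) \<in> trans Q" if "(\<alpha>, us, \<beta>) \<in> trans P" for \<alpha> us \<beta>
    using that by blast
  show "a0 s \<in> states Q" if "s \<in> states P" for s
    using hmorD(1)[OF a, of s] that by simp
  show "?h x \<in> actions Q" if "x \<in> actions P" for x
    using hmorD(2)[OF a, of x] hmorD(2)[OF b, of x] that by (cases "x \<in> actions D") simp_all
  show "label Q (?h x) = label P x" if "x \<in> actions P" for x
    using hmorD(3)[OF a, of x] hmorD(3)[OF b, of x] that by (cases "x \<in> actions D") (simp_all add: po_sys_def)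
qed

text \<open>A subsystem containing all cubes of \<open>P\<close> receives the maps from
  \<open>D\<close> and \<open>B\<close>, because these are cubical, and the transitions of
  \<open>P\<close> are generated by the images of theirs.\<close>

lemma cubical_P:
  assumes "cubical D" "cubical B"
  shows "cubical P"
proof (rule cubicalI[OF weak_P])
  fix U assume U: "subsystem U P" "factors_cubes P U"
  note d = cubical_hmor_factors[OF assms(1) hmor_D U] and b = cubical_hmor_factors[OF assms(2) hmor_B U]
  have "x \<in> actions U" if "x \<in> actions P" for x
    using that hmorD(2)[OF d, of x] hmorD(2)[OF b, of x] by (auto simp: po_map_def)
  moreover have "trans P \<subseteq> trans U"
  proof (rule trans_P_least)
    show "trans_closed (trans U)" by (intro weak_hdtsD(3) subsystemD(1)[OF U(1)])
    show "trans D \<subseteq> trans U" using hmorD(4)[OF d] by auto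
  qed (rule hmorD(4)[OF b])
  ultimately show "states P \<subseteq> states U \<and> actions P \<subseteq> actions U \<and> trans P \<subseteq> trans U"
    using hmorD(1)[OF d] by auto
qed

end

section \<open>The category of cubical transition systems\<close>

text \<open>Every direction of a cube labels one of its edges. Hence the subsystem on the actions
  that occur in \<open>1\<close>-transitions contains all cubes.\<close>

lemma used_actions:
  assumes X: "cubical X" and u: "u \<in> actions X"
  shows "\<exists>\<alpha> \<beta>. (\<alpha>, [u], \<beta>) \<in> trans X"
proof -
  note wX = cubical_weak[OF X]
  let ?A = "{u \<in> actions X. \<exists>\<alpha> \<beta>. (\<alpha>, [u], \<beta>) \<in> trans X}"
  let ?T = "trans X \<inter> trans_space (states X) ?A"
  let ?V = "subsys X (states X) ?A ?T"
  have V: "subsystem ?V X"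
    by (rule subsystem_subsys)
      (auto intro: trans_closed_Int trans_closed_trans_space weak_hdtsD(3)[OF wX])
  have "factors_cubes X ?V"
    unfolding factors_cubes_def
  proof (intro allI impI)
    fix xs f0 f1 assume f: "hmor (cube xs) X f0 f1"
    have act: "f1 c \<in> ?A" if c: "c \<in> actions (cube xs)" for c
    proof -
      obtain i where i: "i < length xs" "c = (xs ! i, Suc i)" using c by (auto simp: cube_def)
      \<comment> \<open>The edge in direction \<open>i\<close> that starts at the zero
        vertex.\<close>
      let ?e = "replicate (length xs) False"
      have "(?e, [c], ?e[i := True]) \<in> trans (cube xs)"
        using i by (auto simp: cube_def nth_list_update)
      from hmorD(4)[OF f this] show ?thesis using hmorD(2)[OF f c] by auto
    qed
    show "hmor (cube xs) ?V f0 f1"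
    proof (rule hmor_into_subsystem[OF f V])
      show "f0 ` states (cube xs) \<subseteq> states ?V" using hmorD(1)[OF f] by auto
      show "f1 ` actions (cube xs) \<subseteq> actions ?V" using act by auto
      fix e us e' assume t: "(e, us, e') \<in> trans (cube xs)"
      have "set (map f1 us) \<subseteq> ?A" using trans_spaceD(4)[OF trans_cube t] act by auto
      then show "(f0 e, map f1 us, f0 e') \<in> trans ?V"
        using hmorD(4)[OF f t] trans_spaceD[OF weak_hdtsD(2)[OF wX] hmorD(4)[OF f t]]
        unfolding trans_space_def by simp
    qed
  qed
  then have "?V = X" by (rule cubicalD[OF X V])
  have "actions X = ?A"
    by (rule HOL.trans[OF arg_cong[OF \<open>?V = X\<close>[symmetric], of actions] subsys_simps(2)])
  then show ?thesis using u by blast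
qed

section \<open>Arrows of the category as pairs of functions\<close>

definition mk_arrow :: "('u, 'u, 'l) hdts \<Rightarrow> ('u, 'u, 'l) hdts \<Rightarrow> ('u \<Rightarrow> 'u) \<Rightarrow> ('u \<Rightarrow> 'u) \<Rightarrow>
    ('u, 'l) hdts_arrow" where
  "mk_arrow X Y f0 f1 = \<lparr>source = X, target = Y,
     state_map = restrict f0 (states X), action_map = restrict f1 (actions X)\<rparr>"

lemma mk_arrow_simps [simp]:
  "source (mk_arrow X Y f0 f1) = X" "target (mk_arrow X Y f0 f1) = Y"
  "s \<in> states X \<Longrightarrow> state_map (mk_arrow X Y f0 f1) s = f0 s"
  "u \<in> actions X \<Longrightarrow> action_map (mk_arrow X Y f0 f1) u = f1 u"
  by (simp_all add: mk_arrow_def)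

text \<open>Restricting to the domain makes arrows canonical, so equations in the category become
  pointwise equations on states and actions.\<close>

lemma mk_arrow_eq_iff:
  "mk_arrow X Y f0 f1 = mk_arrow X Y g0 g1 \<longleftrightarrow>
     (\<forall>s \<in> states X. f0 s = g0 s) \<and> (\<forall>u \<in> actions X. f1 u = g1 u)"
  unfolding mk_arrow_def by (auto simp: fun_eq_iff restrict_def)

lemma Dom_CTS [simp]: "Dom (CTS \<kappa>) = source" and Cod_CTS [simp]: "Cod (CTS \<kappa>) = target"
  by (simp_all add: CTS_def full_subcat_def WHDTS_def)

lemma Obj_CTS: "X \<in> Obj (CTS \<kappa>) \<longleftrightarrow> cubical X \<and> |states X| <o \<kappa> \<and> |actions X| <o \<kappa>"
  by (auto simp: CTS_def full_subcat_def WHDTS_def cubical_weak)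

lemma hom_CTS:
  "f \<in> hom (CTS \<kappa>) X Y \<longleftrightarrow> X \<in> Obj (CTS \<kappa>) \<and> Y \<in> Obj (CTS \<kappa>) \<and> source f = X \<and> target f = Y \<and>
     hdts_map X Y (state_map f) (action_map f)"
  unfolding hom_def Obj_CTS
  by (auto simp: CTS_def full_subcat_def WHDTS_def cubical_weak)

lemma Obj_space: "X \<in> Obj (CTS \<kappa>) \<Longrightarrow> trans X \<subseteq> trans_space (states X) (actions X)"
  by (simp add: Obj_CTS cubicalD_space)

lemma mk_arrow_hom:
  assumes "X \<in> Obj (CTS \<kappa>)" "Y \<in> Obj (CTS \<kappa>)"
  shows "mk_arrow X Y f0 f1 \<in> hom (CTS \<kappa>) X Y \<longleftrightarrow> hmor X Y f0 f1"
  using hdts_map_restrict[OF Obj_space[OF assms(1)]] assms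
  by (simp add: hom_CTS mk_arrow_def)

lemma hom_hmor: "f \<in> hom (CTS \<kappa>) X Y \<Longrightarrow> hmor X Y (state_map f) (action_map f)"
  by (simp add: hom_CTS hdts_map_iff)

lemma hom_mk_arrow:
  assumes "f \<in> hom (CTS \<kappa>) X Y"
  shows "mk_arrow X Y (state_map f) (action_map f) = f"
proof -
  have "restrict (state_map f) (states X) = state_map f"
    "restrict (action_map f) (actions X) = action_map f"
    using assms by (auto simp: hom_CTS hdts_map_iff intro: extensional_restrict)
  then show ?thesis
    using assms unfolding mk_arrow_def by (intro hdts_arrow.equality) (auto simp: hom_CTS)
qed

lemma hom_E:
  assumes "f \<in> hom (CTS \<kappa>) X Y"
  obtains f0 f1 where "f = mk_arrow X Y f0 f1" "hmor X Y f0 f1"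
    "X \<in> Obj (CTS \<kappa>)" "Y \<in> Obj (CTS \<kappa>)"
  by (rule that[OF hom_mk_arrow[OF assms, symmetric] hom_hmor[OF assms]])
    (use assms in \<open>simp_all add: hom_CTS\<close>)

lemma hom_eqI:
  assumes "f \<in> hom (CTS \<kappa>) X Y" "g \<in> hom (CTS \<kappa>) X Y"
    and "\<And>s. s \<in> states X \<Longrightarrow> state_map f s = state_map g s"
    and "\<And>u. u \<in> actions X \<Longrightarrow> action_map f u = action_map g u"
  shows "f = g"
  using hom_mk_arrow[OF assms(1)] hom_mk_arrow[OF assms(2)] assms(3,4)
    mk_arrow_eq_iff[of X Y "state_map f" "action_map f" "state_map g" "action_map g"]
  by simp

lemma Ident_CTS: "Ident (CTS \<kappa>) X = mk_arrow X X id id"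
  by (simp add: CTS_def full_subcat_def WHDTS_def mk_arrow_def)

lemma Comp_CTS:
  "Comp (CTS \<kappa>) g f = \<lparr>source = source f, target = target g,
     state_map = compose (states (source f)) (state_map g) (state_map f),
     action_map = compose (actions (source f)) (action_map g) (action_map f)\<rparr>"
  by (simp add: CTS_def full_subcat_def WHDTS_def)

lemma Comp_CTS_apply:
  assumes "f \<in> hom (CTS \<kappa>) X Y"
  shows "s \<in> states X \<Longrightarrow> state_map (Comp (CTS \<kappa>) g f) s = state_map g (state_map f s)"
    and "u \<in> actions X \<Longrightarrow> action_map (Comp (CTS \<kappa>) g f) u = action_map g (action_map f u)"
  using assms by (simp_all add: hom_CTS Comp_CTS compose_eq)

lemma Comp_mk_arrow:
  assumes "hmor X Y f0 f1"
  shows "Comp (CTS \<kappa>) (mk_arrow Y Z g0 g1) (mk_arrow X Y f0 f1) = mk_arrow X Z (g0 \<circ> f0) (g1 \<circ> f1)"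
  using hmorD(1,2)[OF assms]
  by (auto simp: Comp_CTS mk_arrow_def compose_def fun_eq_iff)

lemma Arr_CTS: "f \<in> Arr (CTS \<kappa>) \<longleftrightarrow> f \<in> hom (CTS \<kappa>) (source f) (target f)"
  by (simp add: hom_def)

lemma hom_Arr: "f \<in> hom (CTS \<kappa>) X Y \<Longrightarrow> f \<in> Arr (CTS \<kappa>)"
  by (simp add: hom_def)

lemma inj_on_mk_arrow:
  "inj_on (action_map (mk_arrow X Y f0 f1)) (actions X) \<longleftrightarrow> inj_on f1 (actions X)"
  by (rule inj_on_cong) simp

lemma mk_arrow_cofibration:
  assumes "X \<in> Obj (CTS \<kappa>)" "Y \<in> Obj (CTS \<kappa>)" "hmor X Y f0 f1" "inj_on f1 (actions X)"
  shows "mk_arrow X Y f0 f1 \<in> CTS_cofibrations \<kappa>"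
  using hom_Arr[OF mk_arrow_hom[OF assms(1,2), THEN iffD2, OF assms(3)]] assms(4)
  by (simp add: CTS_cofibrations_def inj_on_mk_arrow)

section \<open>Trivial fibrations\<close>

lemma lift_along_cofibration:
  assumes p: "p \<in> rlp (CTS \<kappa>) (CTS_cofibrations \<kappa>)" "p = mk_arrow X Y p0 p1"
      "X \<in> Obj (CTS \<kappa>)" "Y \<in> Obj (CTS \<kappa>)"
    and i: "A \<in> Obj (CTS \<kappa>)" "B \<in> Obj (CTS \<kappa>)" "hmor A B i0 i1" "inj_on i1 (actions A)"
    and u: "hmor A X u0 u1" and v: "hmor B Y v0 v1"
    and sq: "\<forall>s \<in> states A. p0 (u0 s) = v0 (i0 s)" "\<forall>x \<in> actions A. p1 (u1 x) = v1 (i1 x)"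
  shows "\<exists>h0 h1. hmor B X h0 h1 \<and>
    (\<forall>s \<in> states A. h0 (i0 s) = u0 s) \<and> (\<forall>x \<in> actions A. h1 (i1 x) = u1 x) \<and>
    (\<forall>s \<in> states B. p0 (h0 s) = v0 s) \<and> (\<forall>x \<in> actions B. p1 (h1 x) = v1 x)"
proof -
  let ?i = "mk_arrow A B i0 i1" and ?u = "mk_arrow A X u0 u1" and ?v = "mk_arrow B Y v0 v1"
  have "has_lift (CTS \<kappa>) ?i p"
    using p(1) mk_arrow_cofibration[OF i] by (simp add: rlp_def)
  moreover have "?u \<in> hom (CTS \<kappa>) A X" "?v \<in> hom (CTS \<kappa>) B Y"
    using u v by (simp_all add: mk_arrow_hom p i)
  moreover have "Comp (CTS \<kappa>) p ?u = Comp (CTS \<kappa>) ?v ?i"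
    unfolding p(2) Comp_mk_arrow[OF u] Comp_mk_arrow[OF i(3)] mk_arrow_eq_iff using sq by simp
  ultimately obtain h where h: "h \<in> hom (CTS \<kappa>) B X" "Comp (CTS \<kappa>) h ?i = ?u" "Comp (CTS \<kappa>) p h = ?v"
    unfolding has_lift_def by (auto simp: p(2))
  obtain h0 h1 where hm: "h = mk_arrow B X h0 h1" "hmor B X h0 h1"
    using h(1) by (rule hom_E)
  have "mk_arrow A X (h0 \<circ> i0) (h1 \<circ> i1) = ?u"
    using h(2) unfolding hm(1) Comp_mk_arrow[OF i(3)] .
  moreover have "mk_arrow B Y (p0 \<circ> h0) (p1 \<circ> h1) = ?v"
    using h(3) unfolding p(2) hm(1) Comp_mk_arrow[OF hm(2)] .
  ultimately show ?thesis
    using hm(2) unfolding mk_arrow_eq_iff o_apply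
    by - (rule exI[of _ h0], rule exI[of _ h1], elim conjE, intro conjI)
qed

text \<open>On states the projection is the identity, so a lift must be \<open>v0\<close> there. On
  actions the lifting problem is one of sets, an injection against a surjection, and
  \<open>hmor_lift_sys\<close> takes care of the transitions.\<close>

lemma lift_sys_trivial_fibration:
  assumes X: "X \<in> Obj (CTS \<kappa>)" and \<pi>: "\<pi> ` A = actions X" and A: "|A| <o \<kappa>"
  shows "lift_sys X A \<pi> \<in> Obj (CTS \<kappa>)"
    and "mk_arrow (lift_sys X A \<pi>) X id \<pi> \<in> rlp (CTS \<kappa>) (CTS_cofibrations \<kappa>)"
proof -
  let ?L = "lift_sys X A \<pi>" and ?C = "CTS \<kappa>"
  show L: "?L \<in> Obj ?C"
    using X A cubical_lift_sys[OF _ \<pi>] by (simp add: Obj_CTS)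
  have p: "hmor ?L X id \<pi>" by (rule hmor_lift_sys_proj) (simp add: \<pi>)
  have "has_lift ?C i (mk_arrow ?L X id \<pi>)" if i: "i \<in> CTS_cofibrations \<kappa>" for i
    unfolding has_lift_def
  proof (intro ballI impI, unfold Dom_CTS Cod_CTS mk_arrow_simps(1,2))
    fix u v assume u: "u \<in> hom ?C (source i) ?L" and v: "v \<in> hom ?C (target i) X"
      and sq: "Comp ?C (mk_arrow ?L X id \<pi>) u = Comp ?C v i"
    obtain A' B where AB: "source i = A'" "target i = B" by simp
    have "i \<in> hom ?C A' B" and inj: "inj_on (action_map i) (actions A')"
      using i AB by (auto simp: CTS_cofibrations_def Arr_CTS)
    obtain i0 i1 where ii: "i = mk_arrow A' B i0 i1" "hmor A' B i0 i1" "A' \<in> Obj ?C" "B \<in> Obj ?C"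
      using \<open>i \<in> hom ?C A' B\<close> by (rule hom_E)
    have inj: "inj_on i1 (actions A')" using inj unfolding ii(1) inj_on_mk_arrow .
    obtain u0 u1 where uu: "u = mk_arrow A' ?L u0 u1" "hmor A' ?L u0 u1"
      using u unfolding AB by (rule hom_E)
    obtain v0 v1 where vv: "v = mk_arrow B X v0 v1" "hmor B X v0 v1"
      using v unfolding AB by (rule hom_E)
    have sq0: "u0 s = v0 (i0 s)" if "s \<in> states A'" for s
      using sq that unfolding uu(1) vv(1) ii(1) Comp_mk_arrow[OF uu(2)] Comp_mk_arrow[OF ii(2)]
        mk_arrow_eq_iff by simp
    have sq1: "\<pi> (u1 x) = v1 (i1 x)" if "x \<in> actions A'" for x
      using sq that unfolding uu(1) vv(1) ii(1) Comp_mk_arrow[OF uu(2)] Comp_mk_arrow[OF ii(2)]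
        mk_arrow_eq_iff by simp
    \<comment> \<open>On the image of \<open>i1\<close> the value is forced by \<open>u1\<close>,
      and it is well defined because \<open>i1\<close> is injective; elsewhere any preimage under
      \<open>\<pi>\<close> will do.\<close>
    define h1 where "h1 b = (if b \<in> i1 ` actions A' then u1 (inv_into (actions A') i1 b)
      else inv_into A \<pi> (v1 b))" for b
    have h1: "h1 (i1 x) = u1 x" if "x \<in> actions A'" for x
      using that inj by (simp add: h1_def)
    have h1A: "h1 b \<in> A \<and> \<pi> (h1 b) = v1 b" if b: "b \<in> actions B" for b
    proof (cases "b \<in> i1 ` actions A'")
      case True
      then show ?thesis using h1 sq1 hmorD(2)[OF uu(2)] by auto
    next
      case False
      have "v1 b \<in> \<pi> ` A" using hmorD(2)[OF vv(2) b] \<pi> by simp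
      then show ?thesis using False by (simp add: h1_def inv_into_into f_inv_into_f)
    qed
    have h: "hmor B ?L v0 h1"
      using hmor_lift_sys[OF vv(2) Obj_space[OF ii(4)] h1A] .
    have "Comp ?C (mk_arrow B ?L v0 h1) i = u"
      unfolding ii(1) uu(1) Comp_mk_arrow[OF ii(2)] mk_arrow_eq_iff using h1 sq0 by simp
    moreover have "Comp ?C (mk_arrow ?L X id \<pi>) (mk_arrow B ?L v0 h1) = v"
      unfolding vv(1) Comp_mk_arrow[OF h] mk_arrow_eq_iff using h1A by simp
    moreover have "mk_arrow B ?L v0 h1 \<in> hom ?C B ?L"
      using h mk_arrow_hom[OF ii(4) L] by blast
    ultimately show "\<exists>h \<in> hom ?C (target i) ?L. Comp ?C h i = u \<and>
        Comp ?C (mk_arrow ?L X id \<pi>) h = v"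
      unfolding AB(2) by blast
  qed
  then show "mk_arrow ?L X id \<pi> \<in> rlp ?C (CTS_cofibrations \<kappa>)"
    using hom_Arr mk_arrow_hom[OF L X] p unfolding rlp_def by blast
qed

lemma finite_small:
  assumes "Card_order \<kappa>" "infinite (Field \<kappa>)" "finite S"
  shows "|S| <o \<kappa>"
  by (rule finite_ordLess_infinite[OF card_of_Well_order card_order_on_well_order_on[OF assms(1)]])
    (use assms(2,3) in \<open>simp_all add: Field_card_of\<close>)

text \<open>Supplies the small test objects against which the lifting property is exploited.\<close>

lemma finite_dim1_Obj:
  assumes \<kappa>: "Card_order \<kappa>" "infinite (Field \<kappa>)" and fin: "finite S" "finite A"
    and T: "T \<subseteq> {(\<alpha>, [u], \<beta>) | \<alpha> u \<beta>. \<alpha> \<in> S \<and> \<beta> \<in> S \<and> u \<in> A}"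
    and used: "\<And>u. u \<in> A \<Longrightarrow> \<exists>\<alpha> \<beta>. (\<alpha>, [u], \<beta>) \<in> T"
  shows "\<lparr>states = S, actions = A, label = restrict l A, trans = T\<rparr> \<in> Obj (CTS \<kappa>)" (is "?X \<in> _")
  unfolding Obj_CTS
proof (intro conjI cubical_dim1)
  show "|states ?X| <o \<kappa>" "|actions ?X| <o \<kappa>" using finite_small[OF \<kappa>] fin by simp_all
  show "label ?X \<in> extensional (actions ?X)" by simp
  show "\<exists>\<alpha> \<beta>. (\<alpha>, [u], \<beta>) \<in> hdts.trans ?X" if "u \<in> actions ?X" for u using used that by simp
  fix \<alpha> us \<beta> assume "(\<alpha>, us, \<beta>) \<in> hdts.trans ?X"
  then have "(\<alpha>, us, \<beta>) \<in> {(\<alpha>, [u], \<beta>) | \<alpha> u \<beta>. \<alpha> \<in> S \<and> \<beta> \<in> S \<and> u \<in> A}"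
    by (intro subsetD[OF T]) simp
  then show "\<alpha> \<in> states ?X" "\<beta> \<in> states ?X" "\<exists>u \<in> actions ?X. us = [u]" by auto
qed

lemma rlp_cofibrations_in_orth:
  assumes p: "p \<in> rlp (CTS \<kappa>) (CTS_cofibrations \<kappa> :: ('u, 'l) hdts_arrow set)"
    and \<kappa>: "Card_order \<kappa>" "infinite (Field \<kappa>)"
  shows "p \<in> orth (CTS \<kappa>) {X. CSA1 X}"
proof -
  let ?C = "CTS \<kappa> :: (('u, 'u, 'l) hdts, ('u, 'l) hdts_arrow) cat"
  obtain X Y where pXY: "p \<in> hom ?C X Y"
    using p by (auto simp: rlp_def Arr_CTS)
  obtain p0 p1 where pp: "p = mk_arrow X Y p0 p1" "hmor X Y p0 p1" "X \<in> Obj ?C" "Y \<in> Obj ?C"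
    using pXY by (rule hom_E)
  note lift = lift_along_cofibration[OF p pp(1,3,4)]
  \<comment> \<open>The empty system, with its labelling in the form that
    \<open>finite_dim1_Obj\<close> produces. The map from it to \<open>Y\<close> is a cofibration,
    and the lift of the identity is a section of \<open>p\<close>.\<close>
  let ?E = "\<lparr>states = {}, actions = {}, label = restrict undefined {}, trans = {}\<rparr> :: ('u, 'u, 'l) hdts"
  have E: "?E \<in> Obj ?C"
    by (rule finite_dim1_Obj[OF \<kappa>]; simp)+
  have 0: "hmor ?E Y id id" "hmor ?E X id id" "hmor Y Y id id"
    by (simp_all add: hmor_def)
  have "inj_on id (actions ?E)" "\<forall>s \<in> states ?E. p0 (id s) = id (id s)"
    "\<forall>x \<in> actions ?E. p1 (id x) = id (id x)" by simp_all
  from lift[OF E pp(4) 0(1) this(1) 0(2,3) this(2,3)]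
  obtain h0 h1 where h: "hmor Y X h0 h1" and ph: "\<forall>s \<in> states Y. p0 (h0 s) = id s"
      "\<forall>u \<in> actions Y. p1 (h1 u) = id u"
    by (elim exE conjE)
  have ph0: "p0 (h0 s) = s" if "s \<in> states Y" for s using ph(1) that by simp
  have ph1: "p1 (h1 u) = u" if "u \<in> actions Y" for u using ph(2) that by simp
  have inj: "a = b" if a: "a \<in> states X" and b: "b \<in> states X" and ab: "p0 a = p0 b" for a b
  proof -
    \<comment> \<open>Collapsing two states to one is a cofibration, as no actions are involved. A
      lift sends the single state of \<open>?B\<close> both to \<open>a\<close> and to
      \<open>b\<close>.\<close>
    let ?A = "\<lparr>states = {a, b}, actions = {}, label = restrict undefined {}, trans = {}\<rparr> :: ('u, 'u, 'l) hdts"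
    let ?B = "\<lparr>states = {p0 a}, actions = {}, label = restrict undefined {}, trans = {}\<rparr> :: ('u, 'u, 'l) hdts"
    have A: "?A \<in> Obj ?C" and B: "?B \<in> Obj ?C"
      by (rule finite_dim1_Obj[OF \<kappa>]; auto)+
    have 1: "hmor ?A ?B p0 id" "hmor ?A X id id" "hmor ?B Y id id"
      using a b ab hmorD(1)[OF pp(2)] by (auto simp: hmor_def)
    have "inj_on id (actions ?A)" "\<forall>s \<in> states ?A. p0 (id s) = id (p0 s)"
      "\<forall>x \<in> actions ?A. p1 (id x) = id (id x)" by simp_all
    from lift[OF A B 1(1) this(1) 1(2,3) this(2,3)]
    obtain k0 :: "'u \<Rightarrow> 'u" where "\<forall>s \<in> states ?A. k0 (p0 s) = id s" by (elim exE conjE)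
    then have k0: "k0 (p0 a) = a" "k0 (p0 b) = b" by simp_all
    show ?thesis by (rule HOL.trans[OF HOL.trans[OF k0(1)[symmetric] arg_cong[OF ab, of k0]] k0(2)])
  qed
  have g_eq: "g1 u = g1 u'"
    if Z: "CSA1 Z" and g: "hmor X Z g0 g1" and u: "u \<in> actions X" and u': "u' \<in> actions X"
      and eq: "p1 u = p1 u'" for Z :: "('u, 'u, 'l) hdts" and g0 g1 u u'
  proof -
    have X: "cubical X" using pp(3) by (simp add: Obj_CTS)
    obtain \<alpha> \<beta> where t: "(\<alpha>, [u], \<beta>) \<in> trans X" using used_actions[OF X u] by blast
    obtain \<alpha>' \<beta>' where t': "(\<alpha>', [u'], \<beta>') \<in> trans X" using used_actions[OF X u'] by blast
    note tD = trans_spaceD[OF Obj_space[OF pp(3)] t] and t'D = trans_spaceD[OF Obj_space[OF pp(3)] t']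
    \<comment> \<open>\<open>?B\<close> adds to \<open>?A\<close> the endpoints of a transition of
      \<open>u'\<close> as a second transition of \<open>u\<close>. It maps to \<open>Y\<close>
      because \<open>p\<close> identifies \<open>u\<close> and \<open>u'\<close>.\<close>
    let ?A = "\<lparr>states = {\<alpha>, \<beta>, \<alpha>', \<beta>'}, actions = {u}, label = restrict (label X) {u}, trans = {(\<alpha>, [u], \<beta>)}\<rparr>"
    let ?B = "\<lparr>states = {\<alpha>, \<beta>, \<alpha>', \<beta>'}, actions = {u}, label = restrict (label X) {u},
      trans = {(\<alpha>, [u], \<beta>), (\<alpha>', [u], \<beta>')}\<rparr>"
    have A: "?A \<in> Obj ?C" and B: "?B \<in> Obj ?C"
      by (rule finite_dim1_Obj[OF \<kappa>]; auto)+
    have i: "hmor ?A ?B id id" "hmor ?A X id id"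
      using t tD t'D u by (auto simp: hmor_def)
    have v: "hmor ?B Y p0 p1"
      using tD t'D hmorD(1)[OF pp(2)] hmorD(2,3)[OF pp(2) u] hmorD(4)[OF pp(2) t] hmorD(4)[OF pp(2) t'] eq
      by (auto simp: hmor_def)
    have "inj_on id (actions ?A)" "\<forall>s \<in> states ?A. p0 (id s) = p0 (id s)"
      "\<forall>x \<in> actions ?A. p1 (id x) = p1 (id x)" by simp_all
    from lift[OF A B i(1) this(1) i(2) v this(2,3)]
    obtain k0 k1 where k: "hmor ?B X k0 k1" "\<forall>s \<in> states ?A. k0 (id s) = id s"
      "\<forall>x \<in> actions ?A. k1 (id x) = id x" by (elim exE conjE)
    \<comment> \<open>The lift fixes the states and \<open>u\<close>, so \<open>u\<close> acquires
      the transition of \<open>u'\<close> in \<open>X\<close>. The two actions are then parallel,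
      and a \<open>CSA1\<close> target cannot separate their images.\<close>
    have "(\<alpha>', [u], \<beta>') \<in> hdts.trans X"
      using hmorD(4)[OF k(1), of \<alpha>' "[u]" \<beta>'] k(2,3) by simp
    from hmorD(4)[OF g this] hmorD(4)[OF g t']
    have "(g0 \<alpha>', [g1 u], g0 \<beta>') \<in> trans Z" "(g0 \<alpha>', [g1 u'], g0 \<beta>') \<in> trans Z" by simp_all
    moreover have "label Z (g1 u) = label Z (g1 u')"
      using hmorD(3)[OF g u] hmorD(3)[OF g u'] hmorD(3)[OF pp(2) u] hmorD(3)[OF pp(2) u'] eq by simp
    ultimately show ?thesis using Z unfolding CSA1_def by blast
  qed
  show ?thesis
  proof (rule orthI[OF category_CTS pXY])
    fix Z g assume Z: "Z \<in> Obj ?C \<inter> {X. CSA1 X}" and "g \<in> hom ?C X Z"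
    then obtain g0 g1 where g: "g = mk_arrow X Z g0 g1" "hmor X Z g0 g1" by (elim hom_E)
    have Z': "Z \<in> Obj ?C" "CSA1 Z" using Z by auto
    \<comment> \<open>The extension of \<open>g\<close> along \<open>p\<close> is \<open>g\<close>
      after the section of \<open>p\<close>.\<close>
    let ?k = "mk_arrow Y Z (g0 \<circ> h0) (g1 \<circ> h1)"
    show "\<exists>!k. k \<in> hom ?C Y Z \<and> Comp ?C k p = g"
    proof (rule ex1I[of _ ?k])
      have "h0 (p0 s) = s" if "s \<in> states X" for s
        by (rule inj) (use that hmorD(1)[OF pp(2)] hmorD(1)[OF h] ph0 in auto)
      moreover have "g1 (h1 (p1 x)) = g1 x" if "x \<in> actions X" for x
        by (rule g_eq[OF Z'(2) g(2)]) (use that hmorD(2)[OF pp(2)] hmorD(2)[OF h] ph1 in auto)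
      ultimately have "Comp ?C ?k p = g"
        unfolding pp(1) g(1) Comp_mk_arrow[OF pp(2)] mk_arrow_eq_iff by simp
      then show "?k \<in> hom ?C Y Z \<and> Comp ?C ?k p = g"
        using mk_arrow_hom[OF pp(4) Z'(1)] hmor_comp[OF h g(2)] by blast
      fix k assume k: "k \<in> hom ?C Y Z \<and> Comp ?C k p = g"
      then obtain k0 k1 where kk: "k = mk_arrow Y Z k0 k1" by (elim conjE hom_E)
      have kp: "mk_arrow X Z (k0 \<circ> p0) (k1 \<circ> p1) = g"
        using k unfolding kk pp(1) Comp_mk_arrow[OF pp(2)] by blast
      show "k = ?k"
        unfolding kk mk_arrow_eq_iff
      proof (intro conjI ballI)
        show "k0 s = (g0 \<circ> h0) s" if "s \<in> states Y" for s
          using kp hmorD(1)[OF h that] ph0[OF that] unfolding g(1) mk_arrow_eq_iff by fastforce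
        show "k1 x = (g1 \<circ> h1) x" if "x \<in> actions Y" for x
          using kp hmorD(2)[OF h that] ph1[OF that] unfolding g(1) mk_arrow_eq_iff by fastforce
      qed
    qed
  qed
qed

section \<open>Pushouts and colimits of cofibrations\<close>

lemma small_Un:
  assumes "Card_order \<kappa>" "infinite (Field \<kappa>)" "|S| <o \<kappa>" "|T| <o \<kappa>"
  shows "|S \<union> T| <o \<kappa>"
  using card_of_Un_ordLess_infinite_Field[OF assms(2,1,3,4)] .

lemma ex_fresh:
  fixes \<kappa> :: "'u rel" and S :: "'u set"
  assumes "Card_order \<kappa>" "|S| <o \<kappa>"
  shows "\<exists>x. x \<notin> S"
proof (rule ccontr)
  assume "\<nexists>x. x \<notin> S"
  then have "Field \<kappa> \<subseteq> S" by blast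
  then have "|Field \<kappa>| \<le>o |S|" by (rule card_of_mono1)
  then have "\<kappa> \<le>o |S|"
    using card_of_Field_ordIso[OF assms(1)] ordIso_symmetric ordIso_ordLeq_trans by blast
  then show False using assms(2) not_ordLess_ordLeq by blast
qed

lemma po_data_pushout:
  fixes u0 u1 :: "'u \<Rightarrow> 'u"
  assumes \<kappa>: "Card_order \<kappa>" "infinite (Field \<kappa>)" and po: "po_data A B D u0 u1"
    and AO: "A \<in> Obj (CTS \<kappa>)" and BO: "B \<in> Obj (CTS \<kappa>)" and DO: "D \<in> Obj (CTS \<kappa>)"
  shows "po_sys A B D u0 u1 \<in> Obj (CTS \<kappa>)"
    and "is_pushout (CTS \<kappa>) (mk_arrow A B id id) (mk_arrow A D u0 u1)
      (mk_arrow D (po_sys A B D u0 u1) id id) (mk_arrow B (po_sys A B D u0 u1) u0 (po_map A u1))"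
proof -
  interpret po_data A B D u0 u1 by (rule po)
  let ?C = "CTS \<kappa>"
  have "|actions B - actions A| <o \<kappa>"
    by (rule ordLeq_ordLess_trans[OF card_of_mono1[OF Diff_subset]]) (use BO in \<open>simp add: Obj_CTS\<close>)
  then have "|actions P| <o \<kappa>"
    using small_Un[OF \<kappa>, of "actions D" "actions B - actions A"] DO by (simp only: Obj_CTS po_sys_simps)
  moreover have "cubical P" by (rule cubical_P) (use BO DO in \<open>simp_all add: Obj_CTS\<close>)
  ultimately show PO: "P \<in> Obj ?C"
    using DO by (simp only: Obj_CTS po_sys_simps(1) simp_thms)
  let ?i = "mk_arrow A B id id" and ?u = "mk_arrow A D u0 u1"
    and ?j = "mk_arrow D P id id" and ?v = "mk_arrow B P u0 v1"
  have homs: "?i \<in> hom ?C A B" "?u \<in> hom ?C A D" "?j \<in> hom ?C D P" "?v \<in> hom ?C B P"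
    by (rule mk_arrow_hom[THEN iffD2]; fact AO BO DO PO AB(2) u hmor_D hmor_B)+
  have sq: "Comp ?C ?j ?u = Comp ?C ?v ?i"
    unfolding Comp_mk_arrow[OF u] Comp_mk_arrow[OF AB(2)] mk_arrow_eq_iff
    by (simp add: po_map_def)
  have univ: "\<exists>!h. h \<in> hom ?C P Q \<and> Comp ?C h ?j = a \<and> Comp ?C h ?v = b"
    if a: "a \<in> hom ?C D Q" and b: "b \<in> hom ?C B Q" and ab: "Comp ?C a ?u = Comp ?C b ?i" for Q a b
  proof -
    obtain a0 a1 where aa: "a = mk_arrow D Q a0 a1" "hmor D Q a0 a1" and Q: "Q \<in> Obj ?C"
      using a by (rule hom_E)
    obtain b0 b1 where bb: "b = mk_arrow B Q b0 b1" "hmor B Q b0 b1"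
      using b by (rule hom_E)
    have eq0: "a0 (u0 s) = b0 s" if "s \<in> states A" for s
      using ab that unfolding aa(1) bb(1) Comp_mk_arrow[OF u] Comp_mk_arrow[OF AB(2)] mk_arrow_eq_iff
      by simp
    have eq1: "a1 (u1 x) = b1 x" if "x \<in> actions A" for x
      using ab that unfolding aa(1) bb(1) Comp_mk_arrow[OF u] Comp_mk_arrow[OF AB(2)] mk_arrow_eq_iff
      by simp
    define h1 where "h1 = (\<lambda>x. if x \<in> actions D then a1 x else b1 x)"
    let ?h = "mk_arrow P Q a0 h1"
    have h: "hmor P Q a0 h1"
      unfolding h1_def
      by (rule hmor_out[OF aa(2) bb(2) cubical_weak]) (use Q eq0 eq1 in \<open>simp_all add: Obj_CTS\<close>)
    have hv: "h1 (v1 x) = b1 x" if "x \<in> actions B" for x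
      using that eq1[of x] hmorD(2)[OF u, of x] disj by (auto simp: po_map_def h1_def)
    show ?thesis
    proof (rule ex1I[of _ ?h])
      have "Comp ?C ?h ?j = a"
        unfolding aa(1) Comp_mk_arrow[OF hmor_D] mk_arrow_eq_iff by (simp add: h1_def)
      moreover have "Comp ?C ?h ?v = b"
        unfolding bb(1) Comp_mk_arrow[OF hmor_B] mk_arrow_eq_iff using eq0 hv AB(1) by simp
      ultimately show "?h \<in> hom ?C P Q \<and> Comp ?C ?h ?j = a \<and> Comp ?C ?h ?v = b"
        using mk_arrow_hom[OF PO Q] h by blast
      fix k assume k: "k \<in> hom ?C P Q \<and> Comp ?C k ?j = a \<and> Comp ?C k ?v = b"
      then obtain k0 k1 where kk: "k = mk_arrow P Q k0 k1" by (elim conjE hom_E)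
      have kj: "mk_arrow D Q (k0 \<circ> id) (k1 \<circ> id) = mk_arrow D Q a0 a1"
        using k unfolding kk aa(1) Comp_mk_arrow[OF hmor_D] by blast
      have kv: "mk_arrow B Q (k0 \<circ> u0) (k1 \<circ> v1) = mk_arrow B Q b0 b1"
        using k unfolding kk bb(1) Comp_mk_arrow[OF hmor_B] by blast
      show "k = ?h"
        unfolding kk mk_arrow_eq_iff
      proof (intro conjI ballI)
        show "k0 s = a0 s" if "s \<in> states P" for s
          using kj that unfolding mk_arrow_eq_iff by simp
        show "k1 x = h1 x" if x: "x \<in> actions P" for x
        proof (cases "x \<in> actions D")
          case True
          then show ?thesis using kj unfolding mk_arrow_eq_iff h1_def by simp
        next
          case False
          then have "x \<in> actions B" "v1 x = x" using x by (auto simp: po_map_def)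
          then show ?thesis using kv False unfolding mk_arrow_eq_iff h1_def by auto
        qed
      qed
    qed
  qed
  show "is_pushout ?C ?i ?u ?j ?v"
    unfolding is_pushout_def Dom_CTS Cod_CTS mk_arrow_simps(1,2)
    using homs hom_Arr sq univ by blast
qed

text \<open>
  \<open>P\<close> with a twin \<open>pt\<close> of its action \<open>a\<close>.  If \<open>P\<close> is a colimit and two actions mapped to \<open>a\<close> can be told
  apart by a cocone over \<open>sep_sys P a pt\<close>, one sent to \<open>pt\<close> and the other to \<open>a\<close>, then they cannot have
  become equal in \<open>P\<close>.
\<close>

definition sep_sys :: "('s, 'a, 'l) hdts \<Rightarrow> 'a \<Rightarrow> 'a \<Rightarrow> ('s, 'a, 'l) hdts" where
  "sep_sys P a pt = lift_sys P (insert pt (actions P)) (\<lambda>x. if x = pt then a else x)"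

lemma sep_sys_Obj:
  assumes \<kappa>: "Card_order \<kappa>" "infinite (Field \<kappa>)" and P: "P \<in> Obj (CTS \<kappa>)"
    and a: "a \<in> actions P" and pt: "pt \<notin> actions P"
  shows "sep_sys P a pt \<in> Obj (CTS \<kappa>)"
  unfolding sep_sys_def
proof (rule lift_sys_trivial_fibration(1)[OF P])
  show "(\<lambda>x. if x = pt then a else x) ` insert pt (actions P) = actions P"
    using a pt by (auto simp: image_iff)
  show "|insert pt (actions P)| <o \<kappa>"
    using small_Un[OF \<kappa> finite_small[OF \<kappa>], of "{pt}" "actions P"] P by (simp add: Obj_CTS)
qed

lemma hmor_sep_sys:
  assumes f: "hmor X P f0 f1" and X: "trans X \<subseteq> trans_space (states X) (actions X)"
    and pt: "pt \<notin> actions P" and E: "\<And>x. x \<in> E \<Longrightarrow> x \<in> actions X \<Longrightarrow> f1 x = a"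
  shows "hmor X (sep_sys P a pt) f0 (\<lambda>x. if x \<in> E then pt else f1 x)"
  unfolding sep_sys_def
proof (rule hmor_lift_sys[OF f X])
  fix x assume x: "x \<in> actions X"
  have "f1 x \<noteq> pt" using hmorD(2)[OF f x] pt by blast
  then show "(if x \<in> E then pt else f1 x) \<in> insert pt (actions P) \<and>
      (if (if x \<in> E then pt else f1 x) = pt then a else (if x \<in> E then pt else f1 x)) = f1 x"
    using hmorD(2)[OF f x] E[OF _ x] by auto
qed

text \<open>If \<open>j\<close> merged \<open>a\<close> with a different action \<open>a'\<close>,
  the cocone into the system with a twin of \<open>j1 a\<close> that sends only \<open>a\<close> to
  the twin could not factor through the pushout.\<close>

lemma cofibrations_pushout:
  fixes i :: "('u, 'l) hdts_arrow"
  assumes \<kappa>: "Card_order \<kappa>" "infinite (Field \<kappa>)"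
    and i: "i \<in> CTS_cofibrations \<kappa>" and po: "is_pushout (CTS \<kappa>) i u j v"
  shows "j \<in> CTS_cofibrations \<kappa>"
proof -
  let ?C = "CTS \<kappa> :: (('u, 'u, 'l) hdts, ('u, 'l) hdts_arrow) cat"
  obtain A B D P where ob: "source i = A" "target i = B" "target u = D" "target j = P" by simp
  have ih: "i \<in> hom ?C A B" and uh: "u \<in> hom ?C A D" and jh: "j \<in> hom ?C D P" and vh: "v \<in> hom ?C B P"
    and sq: "Comp ?C j u = Comp ?C v i"
    using po ob unfolding is_pushout_def by (auto simp: hom_def)
  obtain i0 i1 where ii: "i = mk_arrow A B i0 i1" "hmor A B i0 i1" and A: "A \<in> Obj ?C" and B: "B \<in> Obj ?C"
    using ih by (rule hom_E)
  obtain u0 u1 where uu: "u = mk_arrow A D u0 u1" "hmor A D u0 u1" using uh by (rule hom_E)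
  obtain j0 j1 where jj: "j = mk_arrow D P j0 j1" "hmor D P j0 j1" and D: "D \<in> Obj ?C" and P: "P \<in> Obj ?C"
    using jh by (rule hom_E)
  obtain v0 v1 where vv: "v = mk_arrow B P v0 v1" "hmor B P v0 v1" using vh by (rule hom_E)
  have sq0: "j0 (u0 s) = v0 (i0 s)" if "s \<in> states A" for s
    using sq that unfolding jj(1) uu(1) vv(1) ii(1) Comp_mk_arrow[OF uu(2)] Comp_mk_arrow[OF ii(2)]
      mk_arrow_eq_iff by simp
  have sq1: "j1 (u1 x) = v1 (i1 x)" if "x \<in> actions A" for x
    using sq that unfolding jj(1) uu(1) vv(1) ii(1) Comp_mk_arrow[OF uu(2)] Comp_mk_arrow[OF ii(2)]
      mk_arrow_eq_iff by simp
  have inji: "inj_on i1 (actions A)"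
    using i ob unfolding CTS_cofibrations_def ii(1) by (simp add: inj_on_mk_arrow)
  have "a = a'" if a: "a \<in> actions D" and a': "a' \<in> actions D" and eq: "j1 a = j1 a'" for a a'
  proof (rule ccontr)
    assume "a \<noteq> a'"
    obtain pt where pt: "pt \<notin> actions P" using ex_fresh[OF \<kappa>(1)] P by (auto simp: Obj_CTS)
    let ?Q = "sep_sys P (j1 a) pt"
    \<comment> \<open>The actions of \<open>B\<close> that have to follow \<open>a\<close> to the
      twin. Injectivity of \<open>i1\<close> ensures that this does not move any other action of
      \<open>A\<close>, so the two legs agree on \<open>A\<close>.\<close>
    let ?E = "i1 ` {x \<in> actions A. u1 x = a}"
    let ?\<phi> = "\<lambda>x. if x \<in> {a} then pt else j1 x" and ?\<psi> = "\<lambda>x. if x \<in> ?E then pt else v1 x"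
    have Q: "?Q \<in> Obj ?C" by (rule sep_sys_Obj[OF \<kappa> P hmorD(2)[OF jj(2) a] pt])
    have \<phi>: "hmor D ?Q j0 ?\<phi>"
      by (rule hmor_sep_sys[OF jj(2) Obj_space[OF D] pt]) simp
    have \<psi>: "hmor B ?Q v0 ?\<psi>"
      by (rule hmor_sep_sys[OF vv(2) Obj_space[OF B] pt]) (use sq1 in auto)
    have "i1 x \<in> ?E \<longleftrightarrow> u1 x = a" if "x \<in> actions A" for x
      using that inji by (auto dest: inj_onD)
    then have "Comp ?C (mk_arrow D ?Q j0 ?\<phi>) u = Comp ?C (mk_arrow B ?Q v0 ?\<psi>) i"
      unfolding uu(1) ii(1) Comp_mk_arrow[OF uu(2)] Comp_mk_arrow[OF ii(2)] mk_arrow_eq_iff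
      using sq0 sq1 by simp
    moreover have "mk_arrow D ?Q j0 ?\<phi> \<in> hom ?C D ?Q" "mk_arrow B ?Q v0 ?\<psi> \<in> hom ?C B ?Q"
      using mk_arrow_hom[OF D Q] mk_arrow_hom[OF B Q] \<phi> \<psi> by blast+
    ultimately have "\<exists>!h. h \<in> hom ?C P ?Q \<and> Comp ?C h j = mk_arrow D ?Q j0 ?\<phi> \<and>
        Comp ?C h v = mk_arrow B ?Q v0 ?\<psi>"
      using po Q ob unfolding is_pushout_def Dom_CTS Cod_CTS by simp
    then obtain h where h: "h \<in> hom ?C P ?Q" "Comp ?C h j = mk_arrow D ?Q j0 ?\<phi>"
      by (elim ex1E conjE)
    obtain h0 h1 where hh: "h = mk_arrow P ?Q h0 h1" using h(1) by (rule hom_E)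
    have "h1 (j1 x) = ?\<phi> x" if "x \<in> actions D" for x
      using h(2) that unfolding hh jj(1) Comp_mk_arrow[OF jj(2)] mk_arrow_eq_iff by simp
    then have "?\<phi> a = ?\<phi> a'" using a a' eq by metis
    then show False using \<open>a \<noteq> a'\<close> pt hmorD(2)[OF jj(2) a'] by auto
  qed
  then have "inj_on j1 (actions D)" by (rule inj_onI)
  then show ?thesis
    using mk_arrow_cofibration[OF D P jj(2)] jj(1) by simp
qed

text \<open>The twin argument again: a cocone sends to the twin exactly those actions that
  eventually become equal to \<open>a\<close>. Injectivity of the maps between the stages keeps
  \<open>a'\<close> out of this class, so the colimit cannot merge \<open>a\<close> and
  \<open>a'\<close>.\<close>

lemma cofibrations_colimit:
  fixes D :: "'i \<Rightarrow> ('u, 'u, 'l) hdts"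
  assumes \<kappa>: "Card_order \<kappa>" "infinite (Field \<kappa>)"
    and r: "Well_order r" and dia: "is_diagram (CTS \<kappa>) r D d"
    and col: "is_colimit (CTS \<kappa>) r I D d P c" and I: "I \<subseteq> Field r"
    and inj: "\<And>x y. x \<in> I \<Longrightarrow> y \<in> I \<Longrightarrow> (x, y) \<in> r \<Longrightarrow> inj_on (action_map (d x y)) (actions (D x))"
    and x: "x \<in> I"
  shows "inj_on (action_map (c x)) (actions (D x))"
proof (rule inj_onI, rule ccontr)
  let ?C = "CTS \<kappa> :: (('u, 'u, 'l) hdts, ('u, 'l) hdts_arrow) cat"
  fix a a' assume a: "a \<in> actions (D x)" and a': "a' \<in> actions (D x)"
    and eq: "action_map (c x) a = action_map (c x) a'" and ne: "a \<noteq> a'"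
  have c: "c y \<in> hom ?C (D y) P" if "y \<in> I" for y
    using col that unfolding is_colimit_def is_cocone_def by blast
  have cc: "Comp ?C (c z) (d y z) = c y" if "y \<in> I" "z \<in> I" "(y, z) \<in> r" for y z
    using col that unfolding is_colimit_def is_cocone_def by blast
  have P: "P \<in> Obj ?C" using col unfolding is_colimit_def is_cocone_def by blast
  note d = diagramD(3)[OF dia] and DO = diagramD(1)[OF dia subsetD[OF I]]
  have dd: "action_map (d y w) u = action_map (d z w) (action_map (d y z) u)"
    if "(y, z) \<in> r" "(z, w) \<in> r" "u \<in> actions (D y)" for y z w u
    using diagramD(4)[OF dia that(1,2)] Comp_CTS_apply(2)[OF d[OF that(1)] that(3), of "d z w"] by simp
  have total: "(y, z) \<in> r \<or> (z, y) \<in> r" if "y \<in> I" "z \<in> I" for y z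
    using wo_rel.TOTALS[of r] r I that unfolding wo_rel_def by blast
  have refl: "(y, y) \<in> r" if "y \<in> I" for y using total[OF that that] by blast
  obtain pt where pt: "pt \<notin> actions P" using ex_fresh[OF \<kappa>(1)] P by (auto simp: Obj_CTS)
  let ?p = "action_map (c x) a"
  let ?Q = "sep_sys P ?p pt"
  have Q: "?Q \<in> Obj ?C" by (rule sep_sys_Obj[OF \<kappa> P hmorD(2)[OF hom_hmor[OF c[OF x]] a] pt])
  \<comment> \<open>\<open>E y\<close> is the set of actions at stage \<open>y\<close> that coincide
    with \<open>a\<close> at some later stage \<open>z\<close>; \<open>E2\<close> says that these
    sets are compatible with the diagram.\<close>
  define E where "E y = {u \<in> actions (D y). \<exists>z \<in> I. (x, z) \<in> r \<and> (y, z) \<in> r \<and>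
      action_map (d y z) u = action_map (d x z) a}" for y
  have cd: "action_map (c y) u = action_map (c z) (action_map (d y z) u)"
    if "y \<in> I" "z \<in> I" "(y, z) \<in> r" "u \<in> actions (D y)" for y z u
    using cc[OF that(1-3)] Comp_CTS_apply(2)[OF d[OF that(3)] that(4), of "c z"] by simp
  have E1: "action_map (c y) u = ?p" if y: "y \<in> I" and u: "u \<in> E y" for y u
  proof -
    obtain z where z: "z \<in> I" "(x, z) \<in> r" "(y, z) \<in> r" "u \<in> actions (D y)"
        "action_map (d y z) u = action_map (d x z) a"
      using u unfolding E_def by blast
    have "action_map (c y) u = action_map (c z) (action_map (d y z) u)" by (rule cd[OF y z(1,3,4)])
    also have "\<dots> = ?p" unfolding z(5) by (rule cd[OF x z(1,2) a, symmetric])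
    finally show ?thesis .
  qed
  have E2: "action_map (d y z) u \<in> E z \<longleftrightarrow> u \<in> E y"
    if y: "y \<in> I" and z: "z \<in> I" and yz: "(y, z) \<in> r" and u: "u \<in> actions (D y)" for y z u
  proof
    assume "action_map (d y z) u \<in> E z"
    then obtain w where w: "w \<in> I" "(x, w) \<in> r" "(z, w) \<in> r"
        "action_map (d z w) (action_map (d y z) u) = action_map (d x w) a"
      unfolding E_def by blast
    have "(y, w) \<in> r" using diagramD(3)[OF dia] yz w(3) wo_rel.TRANS[of r] r unfolding wo_rel_def
      by (meson transD)
    then show "u \<in> E y" using w u dd[OF yz w(3) u] unfolding E_def by auto
  next
    assume "u \<in> E y"
    then obtain w where w: "w \<in> I" "(x, w) \<in> r" "(y, w) \<in> r"
        "action_map (d y w) u = action_map (d x w) a"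
      unfolding E_def by blast
    have du: "action_map (d y z) u \<in> actions (D z)" by (rule hmorD(2)[OF hom_hmor[OF d[OF yz]] u])
    show "action_map (d y z) u \<in> E z"
    \<comment> \<open>The stage \<open>w\<close> witnessing the coincidence may come before
      \<open>z\<close>; the equality is then pushed forward to \<open>z\<close>, which becomes the
      witness.\<close>
    proof (cases "(z, w) \<in> r")
      case True
      then show ?thesis using w du dd[OF yz True u] unfolding E_def by auto
    next
      case False
      then have wz: "(w, z) \<in> r" using total[OF w(1) z] by blast
      have xz: "(x, z) \<in> r" using w(2) wz wo_rel.TRANS[of r] r unfolding wo_rel_def by (meson transD)
      have "action_map (d y z) u = action_map (d x z) a"
        using dd[OF w(3) wz u] dd[OF w(2) wz a] w(4) by simp
      then have "action_map (d z z) (action_map (d y z) u) = action_map (d x z) a"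
        using dd[OF yz refl[OF z] u] by simp
      then show ?thesis using z xz refl[OF z] du unfolding E_def by auto
    qed
  qed
  let ?q = "\<lambda>y. mk_arrow (D y) ?Q (state_map (c y)) (\<lambda>u. if u \<in> E y then pt else action_map (c y) u)"
  have q: "hmor (D y) ?Q (state_map (c y)) (\<lambda>u. if u \<in> E y then pt else action_map (c y) u)"
    if "y \<in> I" for y
    by (rule hmor_sep_sys[OF hom_hmor[OF c[OF that]] Obj_space[OF DO[OF that]] pt]) (rule E1[OF that])
  have qh: "?q y \<in> hom ?C (D y) ?Q" if "y \<in> I" for y
    using mk_arrow_hom[OF DO[OF that] Q] q[OF that] by blast
  have "is_cocone ?C r I D d ?Q ?q"
    unfolding is_cocone_def
  proof (intro conjI ballI impI Q qh)
    fix y z assume y: "y \<in> I" and z: "z \<in> I" and yz: "(y, z) \<in> r"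
    show "Comp ?C (?q z) (d y z) = ?q y"
    proof (rule hom_eqI[OF hom_comp[OF category_CTS d[OF yz] qh[OF z]] qh[OF y]])
      note app = Comp_CTS_apply[OF d[OF yz]]
      note dyz = hmorD(1,2)[OF hom_hmor[OF d[OF yz]]]
      show "state_map (Comp ?C (?q z) (d y z)) s = state_map (?q y) s" if s: "s \<in> states (D y)" for s
        using app(1)[OF s, of "?q z"] app(1)[OF s, of "c z"] cc[OF y z yz] dyz(1)[OF s] s by simp
      show "action_map (Comp ?C (?q z) (d y z)) u = action_map (?q y) u" if u: "u \<in> actions (D y)" for u
        using app(2)[OF u, of "?q z"] cd[OF y z yz u] E2[OF y z yz u] dyz(2)[OF u] u by simp
    qed
  qed
  then have "\<exists>!h. h \<in> hom ?C P ?Q \<and> (\<forall>y \<in> I. Comp ?C h (c y) = ?q y)"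
    using col unfolding is_colimit_def by blast
  then obtain h where h: "Comp ?C h (c x) = ?q x" using x by (elim ex1E conjE) blast
  have "(if u \<in> E x then pt else action_map (c x) u) = action_map h (action_map (c x) u)"
    if "u \<in> actions (D x)" for u
    using Comp_CTS_apply(2)[OF c[OF x] that, of h] that unfolding h by simp
  from this[OF a] this[OF a'] have qq: "(if a \<in> E x then pt else action_map (c x) a) =
      (if a' \<in> E x then pt else action_map (c x) a')"
    unfolding eq by (simp only:)
  have "a \<in> E x" using a x refl[OF x] unfolding E_def by blast
  moreover have "a' \<notin> E x"
  proof
    assume "a' \<in> E x"
    then obtain z where "z \<in> I" "(x, z) \<in> r" "action_map (d x z) a' = action_map (d x z) a"
      unfolding E_def by blast
    then show False using inj[OF x] a a' ne by (auto dest: inj_onD)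
  qed
  ultimately have "pt = action_map (c x) a'" using qq by (simp only: if_True if_False)
  then show False using pt hmorD(2)[OF hom_hmor[OF c[OF x]] a'] by simp
qed

text \<open>The induction treats the maps from all earlier stages, not only from the first one,
  because \<open>cofibrations_colimit\<close> needs injectivity between any two stages.\<close>

lemma cofibrations_transfinite_composite:
  fixes f :: "('u, 'l) hdts_arrow"
  assumes \<kappa>: "Card_order \<kappa>" "infinite (Field \<kappa>)"
    and f: "transfinite_composite (CTS \<kappa>) r (CTS_cofibrations \<kappa>) f"
  shows "f \<in> CTS_cofibrations \<kappa>"
proof -
  let ?C = "CTS \<kappa> :: (('u, 'u, 'l) hdts, ('u, 'l) hdts_arrow) cat"
  obtain D d P c x0 where r: "Well_order r" and dia: "is_diagram ?C r D d"
    and colim: "\<And>y. limit_index r y \<Longrightarrow> is_colimit ?C r (underS r y) D d (D y) (\<lambda>x. d x y)"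
    and step: "\<And>x y. immediate_succ r x y \<Longrightarrow> d x y \<in> CTS_cofibrations \<kappa>"
    and col: "is_colimit ?C r (Field r) D d P c"
    and x0: "x0 \<in> Field r" "underS r x0 = {}" and fc: "f = c x0"
    using f unfolding transfinite_composite_def
    by (elim conjE exE bexE) (rule that, assumption+, simp_all)
  note d = diagramD(3)[OF dia]
  have inj: "\<forall>x. (x, y) \<in> r \<longrightarrow> inj_on (action_map (d x y)) (actions (D x))" if "y \<in> Field r" for y
    using r that
  proof (induction rule: well_order_cases_induct)
    case (zero y)
    have "x = y" if "(x, y) \<in> r" for x using zero(2) that unfolding underS_def by blast
    moreover have "inj_on (action_map (d y y)) (actions (D y))"
      using diagramD(2)[OF dia zero(1)] inj_on_mk_arrow[of "D y" "D y" id id] by (simp add: Ident_CTS)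
    ultimately show ?case by blast
  next
    case (succ y z)
    have yz: "(y, z) \<in> r" using succ(1) by (simp add: immediate_succ_def)
    have z: "z \<in> Field r" using yz by (rule FieldI2)
    have sz: "inj_on (action_map (d y z)) (actions (D y))"
      using step[OF succ(1)] d[OF yz] by (simp add: CTS_cofibrations_def hom_CTS)
    show ?case
    proof (intro allI impI)
      fix x assume xz: "(x, z) \<in> r"
      show "inj_on (action_map (d x z)) (actions (D x))"
      proof (cases "(x, y) \<in> r")
        case True
        have "inj_on (action_map (d y z) \<circ> action_map (d x y)) (actions (D x))"
        proof (rule comp_inj_on)
          show "inj_on (action_map (d x y)) (actions (D x))" using succ(2) True by blast
          show "inj_on (action_map (d y z)) (action_map (d x y) ` actions (D x))"
            using hmorD(2)[OF hom_hmor[OF d[OF True]]] by (intro inj_on_subset[OF sz]) blast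
        qed
        moreover have "action_map (d x z) u = (action_map (d y z) \<circ> action_map (d x y)) u"
          if "u \<in> actions (D x)" for u
          using Comp_CTS_apply(2)[OF d[OF True] that, of "d y z"] diagramD(4)[OF dia True yz] by simp
        ultimately show ?thesis using inj_on_cong by metis
      next
        case False
        have "x \<in> Field r" "y \<in> Field r" using xz yz by (auto intro: FieldI1)
        then have "(y, x) \<in> r" using False wo_rel.TOTALS[of r] r unfolding wo_rel_def by blast
        moreover have "x \<noteq> y" using False \<open>(y, x) \<in> r\<close> by blast
        ultimately have "(z, x) \<in> r" using succ(1) unfolding immediate_succ_def by blast
        then have "x = z" using xz wo_rel.ANTISYM[of r] r unfolding wo_rel_def by (meson antisymD)
        then show ?thesis
          using diagramD(2)[OF dia z] inj_on_mk_arrow[of "D z" "D z" id id] by (simp add: Ident_CTS)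
      qed
    qed
  next
    case (lim z)
    have z: "z \<in> Field r" using lim(1) by (simp add: limit_index_def)
    show ?case
    proof (intro allI impI)
      fix x assume xz: "(x, z) \<in> r"
      show "inj_on (action_map (d x z)) (actions (D x))"
      proof (cases "x = z")
        case True
        then show ?thesis
          using diagramD(2)[OF dia z] inj_on_mk_arrow[of "D z" "D z" id id] by (simp add: Ident_CTS)
      next
        case False
        then have x: "x \<in> underS r z" using xz by (simp add: underS_def)
        show ?thesis
        proof (rule cofibrations_colimit[OF \<kappa> r dia colim[OF lim(1)] _ _ x])
          show "underS r z \<subseteq> Field r" by (auto dest: underS_Field)
        qed (use lim(2) in blast)
      qed
    qed
  qed
  have "inj_on (action_map (c x0)) (actions (D x0))"
    by (rule cofibrations_colimit[OF \<kappa> r dia col order_refl _ x0(1)]) (use inj in blast)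
  moreover have "c x0 \<in> hom ?C (D x0) P"
    using col x0 unfolding is_colimit_def is_cocone_def by blast
  ultimately show ?thesis
    unfolding fc CTS_cofibrations_def by (simp add: hom_def)
qed

text \<open>Bounds the smallest localizer from above, which is the implication from weak equivalence
  to invertible reflection.\<close>

lemma localizer_orth:
  assumes \<kappa>: "Card_order \<kappa>" "infinite (Field \<kappa>)"
  shows "localizer \<kappa> (CTS \<kappa>) (CTS_cofibrations \<kappa>) (orth (CTS \<kappa>) {X. CSA1 X})"
  unfolding localizer_def
proof (intro conjI)
  let ?W = "orth (CTS \<kappa>) {X. CSA1 X}"
  show "?W \<subseteq> Arr (CTS \<kappa>)" by (auto simp: orth_def)
  show "two_out_of_three (CTS \<kappa>) ?W" by (rule two_out_of_three_orth[OF category_CTS])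
  show "rlp (CTS \<kappa>) (CTS_cofibrations \<kappa>) \<subseteq> ?W"
    by (rule subsetI) (rule rlp_cofibrations_in_orth[OF _ \<kappa>])
  show "closed_under_pushout (CTS \<kappa>) (CTS_cofibrations \<kappa> \<inter> ?W)"
    unfolding closed_under_pushout_def
  proof (intro ballI allI impI IntI; elim IntE)
    fix i u j v assume po: "is_pushout (CTS \<kappa>) i u j v"
    show "j \<in> CTS_cofibrations \<kappa>" if "i \<in> CTS_cofibrations \<kappa>"
      by (rule cofibrations_pushout[OF \<kappa> that po])
    show "j \<in> ?W" if "i \<in> ?W" by (rule orth_pushout[OF category_CTS that po])
  qed
  show "closed_under_transfinite_composition \<kappa> (CTS \<kappa>) (CTS_cofibrations \<kappa> \<inter> ?W)"
    unfolding closed_under_transfinite_composition_def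
  proof (intro allI impI IntI; elim conjE)
    fix r f assume f: "transfinite_composite (CTS \<kappa>) r (CTS_cofibrations \<kappa> \<inter> ?W) f"
    show "f \<in> CTS_cofibrations \<kappa>"
      by (rule cofibrations_transfinite_composite[OF \<kappa> transfinite_composite_mono[OF f Int_lower1]])
    show "f \<in> ?W"
      by (rule orth_transfinite_composite[OF category_CTS transfinite_composite_mono[OF f Int_lower2]])
  qed
qed

section \<open>Identifying parallel actions\<close>

definition parallel :: "('s, 'a, 'l) hdts \<Rightarrow> ('a \<times> 'a) set" where
  "parallel X = {(a, b). label X a = label X b \<and>
     (\<exists>\<alpha> \<beta>. (\<alpha>, [a], \<beta>) \<in> trans X \<and> (\<alpha>, [b], \<beta>) \<in> trans X)}"

text \<open>Two systems occur because one round of the construction takes the transitions and the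
  parallelism from \<open>X\<close> and puts the results into \<open>Y\<close>. The closed state
  reached in the limit is \<open>replaceable V V\<close>.\<close>

definition replaceable :: "('s, 'a, 'l) hdts \<Rightarrow> ('s, 'a, 'l) hdts \<Rightarrow> bool" where
  "replaceable X Y \<longleftrightarrow> (\<forall>\<alpha> us vs \<beta>. (\<alpha>, us, \<beta>) \<in> trans X \<and>
     list_all2 (\<lambda>a b. (a, b) \<in> parallel X) us vs \<longrightarrow> (\<alpha>, vs, \<beta>) \<in> trans Y)"

lemma parallel_actions:
  assumes "trans X \<subseteq> trans_space (states X) (actions X)" "(a, b) \<in> parallel X"
  shows "a \<in> actions X" "b \<in> actions X" "label X a = label X b"
  using assms(2) trans_spaceD(4)[OF assms(1)] unfolding parallel_def by fastforce+

section \<open>Small sets of fresh actions\<close>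

lemma small_subset:
  assumes "S \<subseteq> T" "|T| <o \<kappa>"
  shows "|S| <o \<kappa>"
  using ordLeq_ordLess_trans[OF card_of_mono1[OF assms(1)] assms(2)] .

text \<open>The disjoint sum bounds both factors, and an infinite set is equinumerous with its
  square.\<close>

lemma small_Times:
  assumes "Card_order \<kappa>" "infinite (Field \<kappa>)" "|S| <o \<kappa>" "|T| <o \<kappa>"
  shows "|S \<times> T| <o \<kappa>"
proof -
  let ?U = "S <+> T"
  have U: "|?U| <o \<kappa>"
    by (rule card_of_Plus_ordLess_infinite_Field[OF assms(2,1,3,4)])
  have "|?U \<times> ?U| <o \<kappa>"
  proof (cases "finite ?U")
    case True
    then show ?thesis by (intro finite_small[OF assms(1,2)]) (rule finite_cartesian_product)
  next
    case False
    show ?thesis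
      by (rule ordIso_ordLess_trans[OF card_of_Times_same_infinite[OF False] U])
  qed
  moreover have "|S \<times> T| \<le>o |?U \<times> ?U|"
    by (rule ordLeq_transitive[OF card_of_Times_mono1[OF card_of_Plus1]
          card_of_Times_mono2[OF card_of_Plus2]])
  ultimately show ?thesis by (rule ordLeq_ordLess_trans[rotated])
qed

lemma small_image: "|S| <o \<kappa> \<Longrightarrow> |f ` S| <o \<kappa>"
  using card_of_image ordLeq_ordLess_trans by blast

text \<open>The part of \<open>Field \<kappa>\<close> outside \<open>T\<close> is large enough to
  hold \<open>S\<close>; otherwise \<open>Field \<kappa>\<close> would be covered by two small
  sets.\<close>

lemma ex_small_inj:
  fixes \<kappa> :: "'u rel" and T :: "'u set" and S :: "'c set"
  assumes \<kappa>: "Card_order \<kappa>" "infinite (Field \<kappa>)" and S: "|S| <o \<kappa>" and T: "|T| <o \<kappa>"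
  shows "\<exists>\<iota>. inj_on \<iota> S \<and> \<iota> ` S \<inter> T = {}"
proof -
  have "\<not> |Field \<kappa> - T| <o |S|"
  proof
    assume "|Field \<kappa> - T| <o |S|"
    then have "|Field \<kappa> - T| <o \<kappa>" by (rule ordLess_transitive[OF _ S])
    from small_Un[OF \<kappa> this T] have "|Field \<kappa>| <o \<kappa>"
      by (rule small_subset[rotated]) blast
    then show False
      using card_of_Field_ordIso[OF \<kappa>(1)] not_ordLess_ordIso by blast
  qed
  then have "|S| \<le>o |Field \<kappa> - T|"
    using ordLess_or_ordLeq[OF card_of_Well_order card_of_Well_order] by blast
  then obtain \<iota> where "inj_on \<iota> S" "\<iota> ` S \<subseteq> Field \<kappa> - T"
    using card_of_ordLeq[of S "Field \<kappa> - T"] by blast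
  then show ?thesis by blast
qed

text \<open>Every parallel pair is named twice: \<open>I0\<close> will be the actions of an
  auxiliary system, and \<open>I1\<close> the copies actually adjoined to \<open>X\<close>, which
  therefore has to avoid the actions of \<open>X\<close>. The map \<open>\<rho>\<close> sends a name
  in \<open>I1\<close> to the name in \<open>I0\<close> of the same pair.\<close>

lemma ex_parallel_copies:
  fixes X :: "('u, 'u, 'l) hdts"
  assumes \<kappa>: "Card_order \<kappa>" "infinite (Field \<kappa>)" and X: "X \<in> Obj (CTS \<kappa>)"
  obtains I0 I1 and a b \<rho> :: "'u \<Rightarrow> 'u"
  where "I0 \<inter> I1 = {}" "I1 \<inter> actions X = {}" "|I0| <o \<kappa>" "|I1| <o \<kappa>"
    "\<And>i. i \<in> I0 \<union> I1 \<Longrightarrow> (a i, b i) \<in> parallel X" "\<And>p. p \<in> parallel X \<Longrightarrow> \<exists>i \<in> I1. (a i, b i) = p"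
    "\<And>i. i \<in> I0 \<Longrightarrow> \<rho> i = i" "\<And>i. i \<in> I1 \<Longrightarrow> \<rho> i \<in> I0"
    "\<And>i. i \<in> I0 \<union> I1 \<Longrightarrow> a (\<rho> i) = a i \<and> b (\<rho> i) = b i"
proof -
  let ?P = "parallel X" and ?S = "parallel X \<times> (UNIV :: bool set)"
  have act: "|actions X| <o \<kappa>" using X by (simp add: Obj_CTS)
  have "?P \<subseteq> actions X \<times> actions X"
    using parallel_actions[OF Obj_space[OF X]] by auto
  then have P: "|?P| <o \<kappa>" by (rule small_subset[OF _ small_Times[OF \<kappa> act act]])
  have S: "|?S| <o \<kappa>"
    by (rule small_Times[OF \<kappa> P finite_small[OF \<kappa>]]) simp
  obtain \<iota> where \<iota>: "inj_on \<iota> ?S" "\<iota> ` ?S \<inter> actions X = {}"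
    using ex_small_inj[OF \<kappa> S act] by blast
  define dec where "dec = inv_into ?S \<iota>"
  have dec: "dec (\<iota> (p, c)) = (p, c)" if "p \<in> ?P" for p c
    using that \<iota>(1) unfolding dec_def by (intro inv_into_f_f) auto
  define I0 where "I0 = \<iota> ` (?P \<times> {False})"
  define I1 where "I1 = \<iota> ` (?P \<times> {True})"
  define a where "a i = fst (fst (dec i))" for i
  define b where "b i = snd (fst (dec i))" for i
  define \<rho> where "\<rho> i = \<iota> (fst (dec i), False)" for i
  have ab: "a (\<iota> (p, c)) = fst p" "b (\<iota> (p, c)) = snd p" "\<rho> (\<iota> (p, c)) = \<iota> (p, False)"
    if "p \<in> ?P" for p c
    using dec[OF that] by (simp_all add: a_def b_def \<rho>_def)
  show ?thesis
  proof (rule that[of I0 I1 a b \<rho>])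
    show "I0 \<inter> I1 = {}"
      unfolding I0_def I1_def by (subst inj_on_image_Int[OF \<iota>(1), symmetric]) auto
    show "I1 \<inter> actions X = {}" using \<iota>(2) unfolding I1_def by blast
    show "|I0| <o \<kappa>" "|I1| <o \<kappa>"
      unfolding I0_def I1_def by (rule small_image[OF small_subset[OF _ S]]; blast)+
    show "(a i, b i) \<in> ?P" if "i \<in> I0 \<union> I1" for i
      using that ab(1,2) unfolding I0_def I1_def by auto
    show "\<exists>i \<in> I1. (a i, b i) = p" if "p \<in> ?P" for p
      using that ab(1,2)[OF that, of True] unfolding I1_def by (intro bexI[of _ "\<iota> (p, True)"]) auto
    show "\<rho> i = i" if "i \<in> I0" for i using that ab(3) unfolding I0_def by auto
    show "\<rho> i \<in> I0" if "i \<in> I1" for i using that ab(3) unfolding I0_def I1_def by auto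
    show "a (\<rho> i) = a i \<and> b (\<rho> i) = b i" if "i \<in> I0 \<union> I1" for i
      using that ab unfolding I0_def I1_def by auto
  qed
qed

section \<open>Reflections inside an arbitrary localizer\<close>

locale cts_localizer =
  fixes \<kappa> :: "'u rel" and W :: "('u, 'l) hdts_arrow set"
  assumes \<kappa>: "Card_order \<kappa>" "infinite (Field \<kappa>)" "natLeq <o \<kappa>"
    and W: "localizer \<kappa> (CTS \<kappa>) (CTS_cofibrations \<kappa>) W"
begin

abbreviation "C \<equiv> CTS \<kappa> :: (('u, 'u, 'l) hdts, ('u, 'l) hdts_arrow) cat"

lemma W_rlp: "p \<in> rlp C (CTS_cofibrations \<kappa>) \<Longrightarrow> p \<in> W"
  using W unfolding localizer_def by blast

lemma W_two_out_of_three: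
  assumes "f \<in> hom C X Y" "g \<in> hom C Y Z"
  shows "f \<in> W \<Longrightarrow> g \<in> W \<Longrightarrow> Comp C g f \<in> W" "f \<in> W \<Longrightarrow> Comp C g f \<in> W \<Longrightarrow> g \<in> W"
    "g \<in> W \<Longrightarrow> Comp C g f \<in> W \<Longrightarrow> f \<in> W"
proof -
  have "two_out_of_three C W" using W by (simp add: localizer_def)
  then have "(f \<in> W \<and> g \<in> W \<longrightarrow> Comp C g f \<in> W) \<and> (f \<in> W \<and> Comp C g f \<in> W \<longrightarrow> g \<in> W) \<and>
      (g \<in> W \<and> Comp C g f \<in> W \<longrightarrow> f \<in> W)"
    using assms unfolding two_out_of_three_def hom_def mem_Collect_eq Dom_CTS Cod_CTS by blast
  then show "f \<in> W \<Longrightarrow> g \<in> W \<Longrightarrow> Comp C g f \<in> W" "f \<in> W \<Longrightarrow> Comp C g f \<in> W \<Longrightarrow> g \<in> W"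
    "g \<in> W \<Longrightarrow> Comp C g f \<in> W \<Longrightarrow> f \<in> W" by blast+
qed

lemma W_iso: "is_iso C f \<Longrightarrow> f \<in> W"
  by (rule W_rlp, rule iso_in_rlp[OF category_CTS]) (auto simp: CTS_cofibrations_def)

lemma W_ident:
  assumes X: "X \<in> Obj C"
  shows "mk_arrow X X id id \<in> W"
proof (rule W_iso)
  have "Ident C X \<in> hom C X X" by (rule hom_ident[OF category_CTS X])
  then show "is_iso C (mk_arrow X X id id)"
    unfolding Ident_CTS[of \<kappa>, symmetric] is_iso_def
    using comp_ident[OF category_CTS \<open>Ident C X \<in> hom C X X\<close>] by (auto simp: hom_def)
qed

text \<open>The inclusion is a section of the trivial fibration \<open>lift_sys X A \<pi>\<close>
  over \<open>X\<close>, so two-out-of-three applied to the identity puts it into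
  \<open>W\<close>.\<close>

lemma section_in_W:
  assumes X: "X \<in> Obj C" and A: "|A| <o \<kappa>" "actions X \<subseteq> A" "\<pi> ` A = actions X"
    and id: "\<And>x. x \<in> actions X \<Longrightarrow> \<pi> x = x"
  shows "mk_arrow X (lift_sys X A \<pi>) id id \<in> CTS_cofibrations \<kappa> \<inter> W"
    and "hmor X (lift_sys X A \<pi>) id id" and "lift_sys X A \<pi> \<in> Obj C"
proof -
  let ?L = "lift_sys X A \<pi>"
  note L = lift_sys_trivial_fibration[OF X A(3,1)]
  show "?L \<in> Obj C" by (rule L(1))
  have p: "hmor ?L X id \<pi>" by (rule hmor_lift_sys_proj) (simp add: A(3))
  show i: "hmor X ?L id id"
  proof (rule hmor_lift_sys[OF _ Obj_space[OF X]])
    show "hmor X X id id" by (simp add: hmor_def)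
  qed (use id A(2) in auto)
  have "Comp C (mk_arrow ?L X id \<pi>) (mk_arrow X ?L id id) = mk_arrow X X id id"
    unfolding Comp_mk_arrow[OF i] mk_arrow_eq_iff using id by simp
  then have "Comp C (mk_arrow ?L X id \<pi>) (mk_arrow X ?L id id) \<in> W"
    using W_ident[OF X] by (simp only:)
  moreover have "mk_arrow X ?L id id \<in> hom C X ?L" "mk_arrow ?L X id \<pi> \<in> hom C ?L X"
    by (rule mk_arrow_hom[THEN iffD2]; fact X L i p)+
  ultimately have "mk_arrow X ?L id id \<in> W"
    using W_two_out_of_three(3) W_rlp[OF L(2)] by blast
  then show "mk_arrow X ?L id id \<in> CTS_cofibrations \<kappa> \<inter> W"
    using mk_arrow_cofibration[OF X L(1) i] by simp
qed

lemma pushout_in_W: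
  assumes "po_data A B D u0 u1" "A \<in> Obj C" "B \<in> Obj C" "D \<in> Obj C"
    and "mk_arrow A B id id \<in> CTS_cofibrations \<kappa> \<inter> W"
  shows "mk_arrow D (po_sys A B D u0 u1) id id \<in> CTS_cofibrations \<kappa> \<inter> W"
proof -
  have "closed_under_pushout C (CTS_cofibrations \<kappa> \<inter> W)"
    using W by (simp add: localizer_def)
  then show ?thesis
    using assms(5) po_data_pushout(2)[OF \<kappa>(1,2) assms(1-4)]
    unfolding closed_under_pushout_def by blast
qed

lemma parallel_step:
  assumes X: "X \<in> Obj C"
  shows "\<exists>X1 \<in> Obj C. states X1 = states X \<and> actions X1 = actions X \<and> hmor X X1 id id \<and>
    mk_arrow X X1 id id \<in> CTS_cofibrations \<kappa> \<inter> W \<and> replaceable X X1"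
proof -
  obtain I0 I1 a b \<rho> where I: "I0 \<inter> I1 = {}" "I1 \<inter> actions X = {}" "|I0| <o \<kappa>" "|I1| <o \<kappa>"
    and ab: "\<And>i. i \<in> I0 \<union> I1 \<Longrightarrow> (a i, b i) \<in> parallel X"
    and surj: "\<And>p. p \<in> parallel X \<Longrightarrow> \<exists>i \<in> I1. (a i, b i) = p"
    and \<rho>0: "\<And>i. i \<in> I0 \<Longrightarrow> \<rho> i = i" and \<rho>1: "\<And>i. i \<in> I1 \<Longrightarrow> \<rho> i \<in> I0"
    and ab\<rho>: "\<And>i. i \<in> I0 \<union> I1 \<Longrightarrow> a (\<rho> i) = a i \<and> b (\<rho> i) = b i"
    by (rule ex_parallel_copies[OF \<kappa>(1,2) X]) (rule that; assumption)
  note XD = Obj_space[OF X]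
  have wX: "weak_hdts X" using X by (simp add: Obj_CTS cubical_weak)
  have abX: "a i \<in> actions X" "b i \<in> actions X" "label X (a i) = label X (b i)" if "i \<in> I0 \<union> I1" for i
    using parallel_actions[OF XD ab[OF that]] .
  \<comment> \<open>The action \<open>i\<close> carries exactly the \<open>1\<close>-transitions
    that \<open>a i\<close> and \<open>b i\<close> share, so \<open>Y\<close> maps to
    \<open>X\<close> both by \<open>a\<close> and by \<open>b\<close>. Parallelism makes each action
    occur in a transition, which cubicality requires.\<close>
  define Y where "Y = \<lparr>states = states X, actions = I0, label = restrict (label X \<circ> a) I0,
    trans = {(\<alpha>, [i], \<beta>) | \<alpha> i \<beta>. i \<in> I0 \<and> (\<alpha>, [a i], \<beta>) \<in> trans X \<and> (\<alpha>, [b i], \<beta>) \<in> trans X}\<rparr>"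
  have Y: "states Y = states X" "actions Y = I0" "\<And>i. i \<in> I0 \<Longrightarrow> label Y i = label X (a i)"
    "\<And>\<alpha> us \<beta>. (\<alpha>, us, \<beta>) \<in> trans Y \<longleftrightarrow> (\<exists>i \<in> I0. us = [i] \<and> (\<alpha>, [a i], \<beta>) \<in> trans X \<and> (\<alpha>, [b i], \<beta>) \<in> trans X)"
    by (auto simp: Y_def)
  have "cubical Y"
  proof (rule cubical_dim1)
    show "label Y \<in> extensional (actions Y)" by (simp add: Y_def)
    show "\<alpha> \<in> states Y \<and> \<beta> \<in> states Y \<and> (\<exists>u \<in> actions Y. us = [u])" if "(\<alpha>, us, \<beta>) \<in> trans Y" for \<alpha> us \<beta>
      using that trans_spaceD(1,2)[OF XD] unfolding Y by blast
    show "\<exists>\<alpha> \<beta>. (\<alpha>, [u], \<beta>) \<in> trans Y" if "u \<in> actions Y" for u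
      using ab[of u] that unfolding Y parallel_def by auto
  qed
  then have YO: "Y \<in> Obj C" using X I(3) by (simp add: Obj_CTS Y)
  \<comment> \<open>Every action of \<open>Y\<close> gets a second copy with the same
    transitions.\<close>
  define Y2 where "Y2 = lift_sys Y (I0 \<union> I1) \<rho>"
  have im: "\<rho> ` (I0 \<union> I1) = actions Y" using \<rho>0 \<rho>1 unfolding Y by force
  note sec = section_in_W[OF YO small_Un[OF \<kappa>(1,2) I(3,4)] _ im, folded Y2_def]
  have i: "mk_arrow Y Y2 id id \<in> CTS_cofibrations \<kappa> \<inter> W" and ih: "hmor Y Y2 id id" and Y2O: "Y2 \<in> Obj C"
    by (rule sec; use \<rho>0 in \<open>simp add: Y\<close>)+
  have Y2t: "\<exists>j \<in> I0 \<union> I1. us = [j] \<and> (\<alpha>, [a j], \<beta>) \<in> trans X \<and> (\<alpha>, [b j], \<beta>) \<in> trans X"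
    if "(\<alpha>, us, \<beta>) \<in> trans Y2" for \<alpha> us \<beta>
  proof -
    have us: "set us \<subseteq> I0 \<union> I1" "(\<alpha>, map \<rho> us, \<beta>) \<in> trans Y" using that by (simp_all add: Y2_def)
    from us(2) obtain k where k: "map \<rho> us = [k]" "(\<alpha>, [a k], \<beta>) \<in> trans X" "(\<alpha>, [b k], \<beta>) \<in> trans X"
      unfolding Y(4) by (elim bexE conjE)
    then obtain j where j: "us = [j]" "\<rho> j = k" by auto
    then show ?thesis using k(2,3) us(1) ab\<rho>[of j] by auto
  qed
  have Y2s: "states Y2 = states X" "actions Y2 = I0 \<union> I1" by (simp_all add: Y2_def Y)
  have Y2l: "label Y2 j = label X (a j)" if "j \<in> I0 \<union> I1" for j
  proof -
    have "\<rho> j \<in> I0" using that \<rho>0 \<rho>1 by auto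
    then show ?thesis using that ab\<rho>[OF that] by (simp add: Y2_def Y(3))
  qed
  have u: "hmor Y X id a"
    by (rule hmorI) (use abX in \<open>auto simp: Y\<close>)
  have po: "po_data Y Y2 X id a"
    by unfold_locales
      (use YO Y2O wX ih u I in \<open>auto simp: Obj_CTS cubical_weak Y Y2s\<close>)
  \<comment> \<open>Gluing \<open>Y2\<close> to \<open>X\<close> along \<open>a\<close> adjoins to
    \<open>X\<close> the copies in \<open>I1\<close>, with only the shared
    \<open>1\<close>-transitions as new generators.\<close>
  define X' where "X' = po_sys Y Y2 X id a"
  note X'O = po_data_pushout(1)[OF \<kappa>(1,2) po YO Y2O X, folded X'_def]
  note XX' = pushout_in_W[OF po YO Y2O X i, folded X'_def]
  have X's: "states X' = states X" "actions X' = actions X \<union> I1"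
    using I(1) by (auto simp: X'_def Y Y2s)
  have hXX': "hmor X X' id id" unfolding X'_def by (rule po_data.hmor_D[OF po])
  \<comment> \<open>The two ways to send a copy back to an old action: \<open>\<pi>\<close> returns
    the action it was copied from, \<open>e\<close> the one parallel to it. On \<open>N\<close>, the
    lift along \<open>\<pi>\<close>, only the former is guaranteed to preserve transitions; on
    \<open>X'\<close> the latter does too.\<close>
  define \<pi> where "\<pi> x = (if x \<in> actions X then x else a x)" for x
  define e where "e x = (if x \<in> actions X then x else b x)" for x
  have im: "\<pi> ` (actions X \<union> I1) = actions X" using abX unfolding \<pi>_def by (auto simp: image_iff)
  define N where "N = lift_sys X (actions X \<union> I1) \<pi>"
  have aX: "|actions X| <o \<kappa>" using X by (simp add: Obj_CTS)
  note sec = section_in_W[OF X small_Un[OF \<kappa>(1,2) aX I(4)] _ im, folded N_def]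
  have XN: "mk_arrow X N id id \<in> CTS_cofibrations \<kappa> \<inter> W" and hXN: "hmor X N id id" and NO: "N \<in> Obj C"
    by (rule sec; simp add: \<pi>_def)+
  have Ns: "states N = states X" "actions N = actions X \<union> I1" by (simp_all add: N_def)
  have hid: "hmor X X id id" by (simp add: hmor_def)
  have wN: "weak_hdts N" using NO by (simp add: Obj_CTS cubical_weak)
  have hY2a: "hmor Y2 X id a"
  proof (rule hmorI)
    show "(id \<alpha>, map a us, id \<beta>) \<in> trans X" if "(\<alpha>, us, \<beta>) \<in> trans Y2" for \<alpha> us \<beta>
      using Y2t[OF that] by auto
  qed (use abX Y2l in \<open>auto simp: Y2s\<close>)
  \<comment> \<open>Actions in \<open>I0\<close> are glued to \<open>X\<close> and must go to
    \<open>a i\<close>; those in \<open>I1\<close> stay themselves. Both lie over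
    \<open>a i\<close>. The resulting map from \<open>X'\<close> to \<open>N\<close> is the
    identity, and cancelling the two sections puts it into \<open>W\<close>.\<close>
  have "hmor Y2 N id (\<lambda>i. if i \<in> I0 then a i else i)"
    unfolding N_def
  proof (rule hmor_lift_sys[OF hY2a Obj_space[OF Y2O]])
    fix i assume "i \<in> actions Y2"
    then have i: "i \<in> I0 \<or> i \<in> I1" by (simp add: Y2s)
    then have "a i \<in> actions X" using abX(1) by blast
    then show "(if i \<in> I0 then a i else i) \<in> actions X \<union> I1 \<and> \<pi> (if i \<in> I0 then a i else i) = a i"
      using i I(2) by (auto simp: \<pi>_def)
  qed
  from po_data.hmor_out[OF po hXN this wN]
  have "hmor X' N id (\<lambda>x. if x \<in> actions X then id x else if x \<in> I0 then a x else x)"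
    unfolding X'_def by (simp add: Y)
  moreover have "hmor X' N id (\<lambda>x. if x \<in> actions X then id x else if x \<in> I0 then a x else x) = hmor X' N id id"
    by (rule hmor_cong[OF Obj_space[OF X'O]]) (use I(1) in \<open>auto simp: X's\<close>)
  ultimately have hX'N: "hmor X' N id id" by blast
  have homs: "mk_arrow X X' id id \<in> hom C X X'" "mk_arrow X' N id id \<in> hom C X' N"
    by (rule mk_arrow_hom[THEN iffD2]; fact X X'O NO hXX' hX'N)+
  have "Comp C (mk_arrow X' N id id) (mk_arrow X X' id id) = mk_arrow X N id id"
    unfolding Comp_mk_arrow[OF hXX'] by simp
  then have "mk_arrow X' N id id \<in> W"
    using W_two_out_of_three(2)[OF homs] XX' XN by simp
  then have X'N: "mk_arrow X' N id id \<in> CTS_cofibrations \<kappa> \<inter> W"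
    using mk_arrow_cofibration[OF X'O NO hX'N] by simp
  \<comment> \<open>Compatibility with the gluing forces \<open>a\<close> on \<open>I0\<close>,
    while \<open>b\<close> is allowed on \<open>I1\<close> because all transitions of
    \<open>Y2\<close> are shared by both actions.\<close>
  have hY2X: "hmor Y2 X id (\<lambda>i. if i \<in> I0 then a i else b i)"
  proof (rule hmorI)
    show "(id \<alpha>, map (\<lambda>i. if i \<in> I0 then a i else b i) us, id \<beta>) \<in> trans X" if "(\<alpha>, us, \<beta>) \<in> trans Y2" for \<alpha> us \<beta>
      using Y2t[OF that] by auto
  qed (use abX Y2l in \<open>auto simp: Y2s\<close>)
  from po_data.hmor_out[OF po hid hY2X wX]
  have "hmor X' X id (\<lambda>x. if x \<in> actions X then id x else if x \<in> I0 then a x else b x)"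
    unfolding X'_def by (simp add: Y)
  moreover have "hmor X' X id (\<lambda>x. if x \<in> actions X then id x else if x \<in> I0 then a x else b x) = hmor X' X id e"
    by (rule hmor_cong[OF Obj_space[OF X'O]]) (use I(1) in \<open>auto simp: X's e_def\<close>)
  ultimately have hX'X: "hmor X' X id e" by blast
  have po1: "po_data X' N X id e"
    by unfold_locales
      (use X'O NO wX hX'N hX'X in \<open>auto simp: Obj_CTS cubical_weak X's Ns\<close>)
  \<comment> \<open>\<open>X'\<close> and \<open>N\<close> have the same states and actions, so this
    pushout leaves those of \<open>X\<close> unchanged and only adds transitions.\<close>
  define X1 where "X1 = po_sys X' N X id e"
  show ?thesis
  proof (intro bexI[of _ X1] conjI)
    show "X1 \<in> Obj C" unfolding X1_def by (rule po_data_pushout(1)[OF \<kappa>(1,2) po1 X'O NO X])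
    show "states X1 = states X" "actions X1 = actions X" by (auto simp: X1_def X's Ns)
    show "hmor X X1 id id" unfolding X1_def by (rule po_data.hmor_D[OF po1])
    show "mk_arrow X X1 id id \<in> CTS_cofibrations \<kappa> \<inter> W"
      unfolding X1_def by (rule pushout_in_W[OF po1 X'O NO X X'N])
    show "replaceable X X1"
      unfolding replaceable_def
    proof (intro allI impI, elim conjE)
      fix \<alpha> us vs \<beta> assume t: "(\<alpha>, us, \<beta>) \<in> trans X" and l: "list_all2 (\<lambda>a b. (a, b) \<in> parallel X) us vs"
      \<comment> \<open>The copies remember a pair each, so one list over \<open>I1\<close> encodes
        both \<open>us\<close> and \<open>vs\<close>: it is a transition of \<open>N\<close> because
        \<open>us\<close> is one of \<open>X\<close>, and it is sent to \<open>vs\<close> in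
        \<open>X1\<close>.\<close>
      from l have "\<exists>ws. set ws \<subseteq> I1 \<and> map a ws = us \<and> map b ws = vs"
      proof (induction rule: list_all2_induct)
        case (Cons x xs y ys)
        then obtain ws where "set ws \<subseteq> I1" "map a ws = xs" "map b ws = ys" by (elim exE conjE)
        moreover obtain j where "j \<in> I1" "a j = x" "b j = y" using surj[OF Cons(1)] by blast
        ultimately have "set (j # ws) \<subseteq> I1 \<and> map a (j # ws) = x # xs \<and> map b (j # ws) = y # ys" by simp
        then show ?case by (rule exI)
      qed simp
      then obtain ws where ws: "set ws \<subseteq> I1" "map a ws = us" "map b ws = vs" by (elim exE conjE)
      have "map \<pi> ws = us" using ws(1) I(2) unfolding ws(2)[symmetric] \<pi>_def by auto
      then have "(\<alpha>, ws, \<beta>) \<in> trans N" using t ws(1) by (auto simp: N_def)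
      from hmorD(4)[OF po_data.hmor_B[OF po1] this]
      have "(\<alpha>, map (po_map X' e) ws, \<beta>) \<in> trans X1" by (simp add: X1_def)
      moreover have "map (po_map X' e) ws = vs"
        using ws(1) I(2) unfolding ws(3)[symmetric] po_map_def e_def X's by auto
      ultimately show "(\<alpha>, vs, \<beta>) \<in> trans X1" by (simp only:)
    qed
  qed
qed

text \<open>Since the chain is constant on states and actions, its colimit is the union of the sets
  of transitions.\<close>

lemma omega_chain_in_W:
  fixes F :: "nat \<Rightarrow> ('u, 'u, 'l) hdts"
  assumes F: "\<And>n. F n \<in> Obj C" and S: "\<And>n. states (F n) = states (F 0)"
    and A: "\<And>n. actions (F n) = actions (F 0)"
    and step: "\<And>n. hmor (F n) (F (Suc n)) id id"
    and W': "\<And>n. mk_arrow (F n) (F (Suc n)) id id \<in> CTS_cofibrations \<kappa> \<inter> W"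
  defines "V \<equiv> (F 0)\<lparr>trans := (\<Union>n. trans (F n))\<rparr>"
  shows "V \<in> Obj C" and "mk_arrow (F 0) V id id \<in> CTS_cofibrations \<kappa> \<inter> W"
    and "\<And>n. hmor (F n) V id id" and "\<And>m n. m \<le> n \<Longrightarrow> trans (F m) \<subseteq> trans (F n)"
proof -
  have V: "states V = states (F 0)" "actions V = actions (F 0)" "label V = label (F 0)"
    "trans V = (\<Union>n. trans (F n))"
    by (simp_all add: V_def)
  have hF: "hmor (F m) (F n) id id" if "m \<le> n" for m n
    using that
  proof (induction rule: dec_induct)
    case base show ?case by (simp add: hmor_def)
  next
    case (step k)
    from hmor_comp[OF step(3) assms(4)[of k]] show ?case by simp
  qed
  show mono: "trans (F m) \<subseteq> trans (F n)" if "m \<le> n" for m n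
    using hmorD(4)[OF hF[OF that]] by auto
  show hV: "hmor (F n) V id id" for n
  proof (rule hmorI)
    show "label V (id u) = label (F n) u" if "u \<in> actions (F n)" for u
      using hmorD(3)[OF hF[of 0 n], of u] that A[of n] by (simp add: V)
  qed (use S[of n] A[of n] in \<open>auto simp: V\<close>)
  \<comment> \<open>Coherence has five premises, which need not come from the same stage; finitely
    many transitions always lie in a common later stage.\<close>
  have ex2: "\<exists>n. T \<subseteq> trans (F n)" if "finite T" "T \<subseteq> trans V" for T
    using that
  proof (induction rule: finite_induct)
    case (insert t T)
    then obtain n where n: "T \<subseteq> trans (F n)" by blast
    obtain m where m: "t \<in> trans (F m)" using insert.prems unfolding V(4) by blast
    have "insert t T \<subseteq> trans (F (max m n))"
      using n m mono[of m "max m n"] mono[of n "max m n"] by auto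
    then show ?case by blast
  qed simp
  have wF: "weak_hdts (F n)" for n using F[of n] by (simp add: Obj_CTS cubical_weak)
  have wV: "weak_hdts V"
    unfolding weak_hdts_iff
  proof (intro conjI)
    show "label V \<in> extensional (actions V)" using weak_hdtsD(1)[OF wF[of 0]] by (simp add: V)
    show "trans V \<subseteq> trans_space (states V) (actions V)"
    proof
      fix t assume "t \<in> trans V"
      then obtain n where "t \<in> trans (F n)" unfolding V(4) by blast
      then show "t \<in> trans_space (states V) (actions V)"
        using weak_hdtsD(2)[OF wF[of n]] S[of n] A[of n] by (auto simp: V(1,2))
    qed
    show "trans_closed (trans V)"
    proof (rule trans_closedI, goal_cases)
      case (1 \<alpha> us vs \<beta>)
      then obtain n where "(\<alpha>, us, \<beta>) \<in> trans (F n)" unfolding V(4) by blast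
      from trans_closedD(1)[OF weak_hdtsD(3)[OF wF] this 1(2)] show ?case unfolding V(4) by blast
    next
      case (2 \<alpha> us vs ws \<beta> \<nu>1 \<nu>2)
      obtain n where n: "{(\<alpha>, us @ vs @ ws, \<beta>), (\<alpha>, us, \<nu>1), (\<nu>1, vs @ ws, \<beta>), (\<alpha>, us @ vs, \<nu>2), (\<nu>2, ws, \<beta>)}
          \<subseteq> trans (F n)"
        using ex2[of "{(\<alpha>, us @ vs @ ws, \<beta>), (\<alpha>, us, \<nu>1), (\<nu>1, vs @ ws, \<beta>), (\<alpha>, us @ vs, \<nu>2), (\<nu>2, ws, \<beta>)}"]
          2(4-8) by auto
      have "(\<nu>1, vs, \<nu>2) \<in> trans (F n)"
        by (rule trans_closedD(2)[OF weak_hdtsD(3)[OF wF[of n]] 2(1-3), of \<alpha> \<beta>]) (use n in simp_all)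
      then show ?case unfolding V(4) by blast
    qed
  qed
  have "cubical V"
  proof (rule cubicalI[OF wV])
    fix U assume U: "subsystem U V" "factors_cubes V U"
    have h: "hmor (F n) U id id" for n
      by (rule cubical_hmor_factors[OF _ hV U]) (use F in \<open>simp add: Obj_CTS\<close>)
    have "trans (F n) \<subseteq> trans U" for n using hmorD(4)[OF h] by auto
    then show "states V \<subseteq> states U \<and> actions V \<subseteq> actions U \<and> trans V \<subseteq> trans U"
      using hmorD(1,2)[OF h[of 0]] unfolding V by auto
  qed
  then show VO: "V \<in> Obj C" using F[of 0] by (simp add: Obj_CTS V)
  have FV: "mk_arrow (F n) V id id \<in> hom C (F n) V" for n
    by (rule mk_arrow_hom[THEN iffD2]; fact F VO hV)
  have "infinite (UNIV :: 'u set)" using \<kappa>(2) rev_finite_subset by blast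
  then obtain g :: "nat \<Rightarrow> 'u" where g: "inj g" using infinite_countable_subset by blast
  \<comment> \<open>Closure under transfinite composition quantifies over well-orders on the type
    \<open>'u\<close>, so the order of the natural numbers is transported along an
    injection.\<close>
  define r where "r = dir_image natLeq g"
  have r_iff: "(x, y) \<in> r \<longleftrightarrow> (\<exists>m n. x = g m \<and> y = g n \<and> m \<le> n)" for x y
    by (auto simp: r_def dir_image_def natLeq_def)
  have gr: "(g m, g n) \<in> r \<longleftrightarrow> m \<le> n" for m n
    unfolding r_iff using injD[OF g] by auto
  have wr: "Well_order r"
    unfolding r_def by (rule Well_order_dir_image[OF natLeq_Well_order]) (use g in \<open>simp add: Field_natLeq\<close>)
  have Fr: "Field r = range g" by (simp add: r_def dir_image_Field Field_natLeq)
  have "|range g| \<le>o |UNIV :: nat set|" by (rule card_of_image)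
  then have small: "|Field r| <o \<kappa>"
    unfolding Fr
    by (rule ordLeq_ordLess_trans) (rule ordIso_ordLess_trans[OF card_of_nat \<kappa>(3)])
  define D where "D x = F (inv g x)" for x
  define d where "d x y = mk_arrow (D x) (D y) id id" for x y
  define c where "c x = mk_arrow (D x) V id id" for x
  have Dg [simp]: "D (g n) = F n" for n by (simp add: D_def g)
  have dia: "is_diagram C r D d"
    unfolding is_diagram_def
  proof (intro conjI allI impI ballI)
    fix x assume "x \<in> Field r"
    then obtain n where [simp]: "x = g n" unfolding Fr by blast
    show "D x \<in> Obj C" "d x x = Ident C (D x)" using F by (simp_all add: d_def Ident_CTS)
  next
    fix x y assume "(x, y) \<in> r"
    then obtain m n where mn: "x = g m" "y = g n" "m \<le> n" unfolding r_iff by blast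
    show "d x y \<in> hom C (D x) (D y)"
      unfolding d_def mn Dg by (rule mk_arrow_hom[THEN iffD2]; fact F hF[OF mn(3)])
  next
    fix x y z assume "(x, y) \<in> r \<and> (y, z) \<in> r"
    then obtain m n k where mn: "x = g m" "y = g n" "z = g k" "m \<le> n"
      unfolding r_iff by blast
    show "d x z = Comp C (d y z) (d x y)"
      unfolding d_def mn Dg Comp_mk_arrow[OF hF[OF mn(4)]] by simp
  qed
  \<comment> \<open>Below \<open>omega\<close> every nonzero index is a successor, so the colimit
    condition at limit indices is vacuous.\<close>
  have nolim: "\<not> limit_index r y" for y
  proof
    assume y: "limit_index r y"
    then obtain x where x: "x \<in> underS r y" unfolding limit_index_def by blast
    then obtain m n where mn: "x = g m" "y = g n" "m \<le> n" "m \<noteq> n"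
      unfolding underS_def r_iff by blast
    then obtain k where k: "n = Suc k" by (cases n) auto
    have "immediate_succ r (g k) y"
      unfolding immediate_succ_def
    proof (intro conjI allI impI)
      show "(g k, y) \<in> r" unfolding mn k gr by simp
      show "g k \<noteq> y" unfolding mn k using injD[OF g] by fastforce
      fix z assume z: "(g k, z) \<in> r \<and> z \<noteq> g k"
      then obtain l where l: "z = g l" unfolding r_iff by blast
      show "(y, z) \<in> r" using z unfolding l mn k gr by (metis Suc_leI le_neq_implies_less)
    qed
    then show False using y unfolding limit_index_def by blast
  qed
  have succ: "d x y \<in> CTS_cofibrations \<kappa> \<inter> W" if xy: "immediate_succ r x y" for x y
  proof -
    obtain m n where mn: "x = g m" "y = g n" "m \<le> n" "m \<noteq> n"
      using xy unfolding immediate_succ_def r_iff by blast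
    have "(g m, g (Suc m)) \<in> r \<and> g (Suc m) \<noteq> g m" unfolding gr using injD[OF g] by fastforce
    then have "(y, g (Suc m)) \<in> r" using xy unfolding immediate_succ_def mn by blast
    then have "n = Suc m" using mn(3,4) unfolding mn gr by simp
    then show ?thesis using W'[of m] by (simp add: d_def mn)
  qed
  have col: "is_colimit C r (Field r) D d V c"
    unfolding is_colimit_def
  proof (intro conjI allI impI)
    show "is_cocone C r (Field r) D d V c"
      unfolding is_cocone_def
    proof (intro conjI ballI impI)
      show "V \<in> Obj C" by (rule VO)
      show "c x \<in> hom C (D x) V" if "x \<in> Field r" for x
        using that FV unfolding Fr c_def by auto
      fix x y assume "(x, y) \<in> r"
      then obtain m n where mn: "x = g m" "y = g n" "m \<le> n" unfolding r_iff by blast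
      show "Comp C (c y) (d x y) = c x"
        unfolding c_def d_def mn Dg Comp_mk_arrow[OF hF[OF mn(3)]] by simp
    qed
  next
    fix Q q assume q: "is_cocone C r (Field r) D d Q q"
    then have Q: "Q \<in> Obj C" and qh: "q (g n) \<in> hom C (F n) Q" for n
      unfolding is_cocone_def Fr by (simp, metis Dg rangeI)
    \<comment> \<open>All legs of a cocone have the same underlying functions as the first one,
      because the maps of the chain are identities.\<close>
    define q0 where "q0 = state_map (q (g 0))"
    define q1 where "q1 = action_map (q (g 0))"
    have qeq: "q (g n) = mk_arrow (F n) Q q0 q1" and qhm: "hmor (F n) Q q0 q1" for n
    proof -
      have "Comp C (q (g n)) (d (g 0) (g n)) = q (g 0)"
        using q gr[of 0 n] unfolding is_cocone_def Fr by blast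
      moreover obtain a b where ab: "q (g n) = mk_arrow (F n) Q a b" "hmor (F n) Q a b"
        using qh[of n] by (rule hom_E)
      moreover have "q (g 0) = mk_arrow (F 0) Q q0 q1"
        using hom_mk_arrow[OF qh[of 0]] by (simp add: q0_def q1_def)
      ultimately have "mk_arrow (F 0) Q (a \<circ> id) (b \<circ> id) = mk_arrow (F 0) Q q0 q1"
        using Comp_mk_arrow[OF hF[of 0 n]] by (simp add: d_def)
      then have eq: "\<forall>s \<in> states (F n). a s = q0 s" "\<forall>u \<in> actions (F n). b u = q1 u"
        using S[of n] A[of n] unfolding mk_arrow_eq_iff by simp_all
      then show "q (g n) = mk_arrow (F n) Q q0 q1"
        unfolding ab(1) mk_arrow_eq_iff by simp
      show "hmor (F n) Q q0 q1"
        using hmor_cong[OF Obj_space[OF F[of n]], of a q0 b q1 Q] eq ab(2) by simp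
    qed
    have hVQ: "hmor V Q q0 q1"
    proof (rule hmorI)
      fix \<alpha> us \<beta> assume "(\<alpha>, us, \<beta>) \<in> trans V"
      then obtain n where "(\<alpha>, us, \<beta>) \<in> trans (F n)" unfolding V(4) by blast
      then show "(q0 \<alpha>, map q1 us, q0 \<beta>) \<in> trans Q" by (rule hmorD(4)[OF qhm])
    qed (use hmorD[OF qhm[of 0]] in \<open>simp_all add: V\<close>)
    show "\<exists>!h. h \<in> hom C V Q \<and> (\<forall>x \<in> Field r. Comp C h (c x) = q x)"
    proof (rule ex1I[of _ "mk_arrow V Q q0 q1"], intro conjI ballI)
      show "mk_arrow V Q q0 q1 \<in> hom C V Q" by (rule mk_arrow_hom[THEN iffD2]; fact VO Q hVQ)
      fix x assume "x \<in> Field r"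
      then obtain n where n: "x = g n" unfolding Fr by blast
      show "Comp C (mk_arrow V Q q0 q1) (c x) = q x"
        unfolding n c_def Dg qeq Comp_mk_arrow[OF hV] by simp
    next
      fix h assume h: "h \<in> hom C V Q \<and> (\<forall>x \<in> Field r. Comp C h (c x) = q x)"
      then obtain h0 h1 where hh: "h = mk_arrow V Q h0 h1" by (elim conjE hom_E)
      have "Comp C h (c (g 0)) = q (g 0)" using h unfolding Fr by blast
      then have "mk_arrow (F 0) Q (h0 \<circ> id) (h1 \<circ> id) = mk_arrow (F 0) Q q0 q1"
        unfolding hh c_def Dg qeq Comp_mk_arrow[OF hV] .
      then show "h = mk_arrow V Q q0 q1"
        unfolding hh mk_arrow_eq_iff V by simp
    qed
  qed
  have "transfinite_composite C r (CTS_cofibrations \<kappa> \<inter> W) (c (g 0))"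
    unfolding transfinite_composite_def
  proof (intro conjI exI)
    show "Well_order r" by (rule wr)
    show "is_diagram C r D d" by (rule dia)
    show "is_colimit C r (Field r) D d V c" by (rule col)
    show "\<forall>x y. immediate_succ r x y \<longrightarrow> d x y \<in> CTS_cofibrations \<kappa> \<inter> W"
      using succ by blast
    show "\<forall>y. limit_index r y \<longrightarrow> is_colimit C r (underS r y) D d (D y) (\<lambda>x. d x y)"
      using nolim by blast
    have "underS r (g 0) = {}"
    proof (rule equals0I)
      fix x assume "x \<in> underS r (g 0)"
      then have "x \<noteq> g 0" "(x, g 0) \<in> r" by (auto simp: underS_def)
      then show False unfolding r_iff using injD[OF g] by fastforce
    qed
    then show "\<exists>x0 \<in> Field r. underS r x0 = {} \<and> c (g 0) = c x0" unfolding Fr by blast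
  qed
  moreover have "closed_under_transfinite_composition \<kappa> C (CTS_cofibrations \<kappa> \<inter> W)"
    using W by (simp add: localizer_def)
  ultimately have "c (g 0) \<in> CTS_cofibrations \<kappa> \<inter> W"
    using small unfolding closed_under_transfinite_composition_def by blast
  then show "mk_arrow (F 0) V id id \<in> CTS_cofibrations \<kappa> \<inter> W" by (simp only: c_def Dg)
qed

text \<open>A transition of the union together with the finitely many parallel pairs needed to
  rewrite it appears at a finite stage, and the next stage contains the rewritten
  transition.\<close>

lemma parallel_closure:
  assumes X: "X \<in> Obj C"
  shows "\<exists>V \<in> Obj C. hmor X V id id \<and> mk_arrow X V id id \<in> W \<and> replaceable V V"
proof -
  let ?step = "\<lambda>X X1. states X1 = states X \<and> actions X1 = actions X \<and> hmor X X1 id id \<and>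
    mk_arrow X X1 id id \<in> CTS_cofibrations \<kappa> \<inter> W \<and> replaceable X X1"
  have "\<exists>F :: nat \<Rightarrow> ('u, 'u, 'l) hdts. \<forall>n. (F n \<in> Obj C \<and> (n = 0 \<longrightarrow> F n = X)) \<and> ?step (F n) (F (Suc n))"
  proof (rule dependent_nat_choice)
    show "\<exists>x. x \<in> Obj C \<and> (0 = (0 :: nat) \<longrightarrow> x = X)" using X by blast
    fix x :: "('u, 'u, 'l) hdts" and n :: nat
    assume "x \<in> Obj C \<and> (n = 0 \<longrightarrow> x = X)"
    then obtain y where "y \<in> Obj C" "?step x y" using parallel_step by blast
    then show "\<exists>y. (y \<in> Obj C \<and> (Suc n = 0 \<longrightarrow> y = X)) \<and> ?step x y" by (intro exI[of _ y]) simp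
  qed
  then obtain F :: "nat \<Rightarrow> ('u, 'u, 'l) hdts"
    where F': "\<forall>n. (F n \<in> Obj C \<and> (n = 0 \<longrightarrow> F n = X)) \<and> ?step (F n) (F (Suc n))" ..
  have F: "F n \<in> Obj C" and st: "?step (F n) (F (Suc n))" for n
    by (rule conjunct1[OF conjunct1[OF F'[rule_format]]], rule conjunct2[OF F'[rule_format]])
  have F0: "F 0 = X" using F'[rule_format, of 0] by simp
  have S: "states (F n) = states (F 0)" and A: "actions (F n) = actions (F 0)" for n
    by (induction n) (use st in simp_all)
  define V where "V = (F 0)\<lparr>trans := (\<Union>n. trans (F n))\<rparr>"
  have hst: "hmor (F n) (F (Suc n)) id id" and Wst: "mk_arrow (F n) (F (Suc n)) id id \<in> CTS_cofibrations \<kappa> \<inter> W"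
    and rst: "replaceable (F n) (F (Suc n))" for n
    using st[of n] by blast+
  note om = omega_chain_in_W[OF F S A hst Wst, folded V_def]
  have tV: "trans V = (\<Union>n. trans (F n))" by (simp add: V_def)
  have lF: "label V u = label (F n) u" if "u \<in> actions (F n)" for n u
    using hmorD(3)[OF om(3) that] by simp
  \<comment> \<open>Parallelism persists along the chain. Labels at two stages are compared through
    \<open>V\<close>, whose labelling extends that of every stage.\<close>
  have par: "(a, b) \<in> parallel (F n)" if ab: "(a, b) \<in> parallel (F m)" and mn: "m \<le> n" for a b m n
  proof -
    note pa = parallel_actions[OF Obj_space[OF F] ab]
    have "a \<in> actions (F n)" "b \<in> actions (F n)" using pa(1,2) A[of m] A[of n] by simp_all
    then have "label (F n) a = label (F n) b"
      using lF[of a n] lF[of b n] lF[OF pa(1)] lF[OF pa(2)] pa(3) by simp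
    moreover obtain \<alpha> \<beta> where "(\<alpha>, [a], \<beta>) \<in> trans (F m)" "(\<alpha>, [b], \<beta>) \<in> trans (F m)"
      using ab unfolding parallel_def by blast
    ultimately show ?thesis using om(4)[OF mn] unfolding parallel_def by blast
  qed
  have parV: "\<exists>n. (a, b) \<in> parallel (F n)" if ab: "(a, b) \<in> parallel V" for a b
  proof -
    obtain \<alpha> \<beta> where "(\<alpha>, [a], \<beta>) \<in> trans V" "(\<alpha>, [b], \<beta>) \<in> trans V" and l: "label V a = label V b"
      using ab unfolding parallel_def by blast
    then obtain m n where "(\<alpha>, [a], \<beta>) \<in> trans (F m)" "(\<alpha>, [b], \<beta>) \<in> trans (F n)"
      unfolding tV by blast
    then have t: "(\<alpha>, [a], \<beta>) \<in> trans (F (max m n))" "(\<alpha>, [b], \<beta>) \<in> trans (F (max m n))"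
      using om(4)[of m "max m n"] om(4)[of n "max m n"] by auto
    then have "a \<in> actions (F (max m n))" "b \<in> actions (F (max m n))"
      using trans_spaceD(4)[OF Obj_space[OF F]] by fastforce+
    then have "label (F (max m n)) a = label (F (max m n)) b" using lF l by metis
    then show ?thesis using t unfolding parallel_def by blast
  qed
  have "replaceable V V"
    unfolding replaceable_def
  proof (intro allI impI, elim conjE)
    fix \<alpha> us vs \<beta> assume t: "(\<alpha>, us, \<beta>) \<in> trans V" and l: "list_all2 (\<lambda>a b. (a, b) \<in> parallel V) us vs"
    obtain m where m: "(\<alpha>, us, \<beta>) \<in> trans (F m)" using t unfolding tV by blast
    from l have "\<exists>n. list_all2 (\<lambda>a b. (a, b) \<in> parallel (F n)) us vs"
    proof (induction rule: list_all2_induct)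
      case (Cons x xs y ys)
      obtain i where i: "list_all2 (\<lambda>a b. (a, b) \<in> parallel (F i)) xs ys" using Cons(3) by blast
      obtain j where j: "(x, y) \<in> parallel (F j)" using parV[OF Cons(1)] by blast
      have "list_all2 (\<lambda>a b. (a, b) \<in> parallel (F (max i j))) xs ys"
        by (rule list_all2_mono[OF i]) (rule par, assumption, simp)
      moreover have "(x, y) \<in> parallel (F (max i j))" by (rule par[OF j]) simp
      ultimately have "list_all2 (\<lambda>a b. (a, b) \<in> parallel (F (max i j))) (x # xs) (y # ys)" by simp
      then show ?case by (rule exI)
    qed simp
    then obtain n where n: "list_all2 (\<lambda>a b. (a, b) \<in> parallel (F n)) us vs" by blast
    have "list_all2 (\<lambda>a b. (a, b) \<in> parallel (F (max m n))) us vs"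
      by (rule list_all2_mono[OF n]) (rule par, assumption, simp)
    moreover have "(\<alpha>, us, \<beta>) \<in> trans (F (max m n))" using om(4)[of m "max m n"] m by auto
    ultimately have "(\<alpha>, vs, \<beta>) \<in> trans (F (Suc (max m n)))"
      using rst[of "max m n"] unfolding replaceable_def by blast
    then show "(\<alpha>, vs, \<beta>) \<in> trans V" unfolding tV by blast
  qed
  then show ?thesis using om(1,2) om(3)[of 0] unfolding F0 by blast
qed

text \<open>Once parallel actions are interchangeable in \<open>V\<close>, parallelism is an
  equivalence relation, and whether a list is a transition depends only on the classes of its
  entries. Thus \<open>V\<close> is the lift of a system of representatives along the choice map,
  and the map onto it is a trivial fibration.\<close>

lemma reflection_in_W:
  assumes X: "X \<in> Obj C"
  shows "\<exists>e \<in> W. Dom C e = X \<and> Cod C e \<in> Obj C \<inter> {X. CSA1 X}"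
proof -
  obtain V where VO: "V \<in> Obj C" and XV: "hmor X V id id" "mk_arrow X V id id \<in> W"
    and rep: "replaceable V V"
    using parallel_closure[OF X] by blast
  have cV: "cubical V" and wV: "weak_hdts V" using VO by (simp_all add: Obj_CTS cubical_weak)
  note VD = Obj_space[OF VO]
  let ?P = "parallel V"
  have repl: "(\<alpha>, vs, \<beta>) \<in> trans V"
    if "(\<alpha>, us, \<beta>) \<in> trans V" "list_all2 (\<lambda>a b. (a, b) \<in> ?P) us vs" for \<alpha> us vs \<beta>
    using rep that unfolding replaceable_def by blast
  \<comment> \<open>Cubicality enters here: an action without transitions would not be parallel to
    itself.\<close>
  have P_refl: "(a, a) \<in> ?P" if "a \<in> actions V" for a
    using used_actions[OF cV that] unfolding parallel_def by blast
  have P_sym: "(b, a) \<in> ?P" if "(a, b) \<in> ?P" for a b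
    using that unfolding parallel_def by auto
  \<comment> \<open>The two assumed parallelisms may be witnessed at different endpoints; replacing
    \<open>b\<close> by \<open>c\<close> in the first witness brings them together.\<close>
  have P_trans: "(a, c) \<in> ?P" if ab: "(a, b) \<in> ?P" and bc: "(b, c) \<in> ?P" for a b c
  proof -
    obtain \<alpha> \<beta> where t: "(\<alpha>, [a], \<beta>) \<in> trans V" "(\<alpha>, [b], \<beta>) \<in> trans V"
      using ab unfolding parallel_def by blast
    have "(\<alpha>, [c], \<beta>) \<in> trans V" by (rule repl[OF t(2)]) (simp add: bc)
    then show ?thesis using t(1) ab bc unfolding parallel_def by auto
  qed
  define q where "q a = (SOME b. (a, b) \<in> ?P)" for a
  have q: "(a, q a) \<in> ?P" if "a \<in> actions V" for a
    unfolding q_def using P_refl[OF that] by (rule someI)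
  have q_eq: "q a = q b" if "(a, b) \<in> ?P" for a b
  proof -
    have "(a, c) \<in> ?P \<longleftrightarrow> (b, c) \<in> ?P" for c
      using P_trans[OF that] P_trans[OF P_sym[OF that]] by blast
    then show ?thesis unfolding q_def by simp
  qed
  have q_act: "q a \<in> actions V" "label V (q a) = label V a" if "a \<in> actions V" for a
    using parallel_actions[OF VD q[OF that]] by simp_all
  have qq: "q (q a) = q a" if "a \<in> actions V" for a using q_eq[OF q[OF that]] by simp
  let ?A = "q ` actions V"
  \<comment> \<open>Representatives are used instead of equivalence classes so that the actions
    remain in \<open>'u\<close>.\<close>
  define R where "R = subsys V (states V) ?A (trans V \<inter> trans_space (states V) ?A)"
  have R: "states R = states V" "actions R = ?A" "label R = restrict (label V) ?A"
    "trans R = trans V \<inter> trans_space (states V) ?A"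
    by (simp_all add: R_def)
  have sub: "subsystem R V"
    unfolding R_def
    by (rule subsystem_subsys)
      (use q_act in \<open>auto intro: trans_closed_Int trans_closed_trans_space weak_hdtsD(3)[OF wV]\<close>)
  have map_q: "(\<alpha>, map q us, \<beta>) \<in> trans V \<longleftrightarrow> (\<alpha>, us, \<beta>) \<in> trans V" if us: "set us \<subseteq> actions V" for \<alpha> us \<beta>
  proof
    have 1: "list_all2 (\<lambda>a b. (a, b) \<in> ?P) us (map q us)"
      using us q by (auto simp: list_all2_conv_all_nth subset_iff)
    then show "(\<alpha>, map q us, \<beta>) \<in> trans V" if "(\<alpha>, us, \<beta>) \<in> trans V" by (rule repl[OF that])
    have "list_all2 (\<lambda>a b. (a, b) \<in> ?P) (map q us) us"
      using us q P_sym by (auto simp: list_all2_conv_all_nth subset_iff)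
    then show "(\<alpha>, us, \<beta>) \<in> trans V" if "(\<alpha>, map q us, \<beta>) \<in> trans V" by (rule repl[OF that])
  qed
  have mapR: "(\<alpha>, map q us, \<beta>) \<in> trans R \<longleftrightarrow> (\<alpha>, us, \<beta>) \<in> trans V" if us: "set us \<subseteq> actions V" for \<alpha> us \<beta>
  proof
    show "(\<alpha>, us, \<beta>) \<in> trans V" if "(\<alpha>, map q us, \<beta>) \<in> trans R"
      using that map_q[OF us] unfolding R(4) by blast
    assume t: "(\<alpha>, us, \<beta>) \<in> trans V"
    have "set (map q us) \<subseteq> ?A" using us by auto
    then show "(\<alpha>, map q us, \<beta>) \<in> trans R"
      using map_q[OF us] t trans_spaceD[OF VD t] unfolding R(4) by (simp add: trans_space_def)
  qed
  have hVR: "hmor V R id q"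
  proof (rule hmorI)
    show "(id \<alpha>, map q us, id \<beta>) \<in> trans R" if "(\<alpha>, us, \<beta>) \<in> trans V" for \<alpha> us \<beta>
      using mapR[OF trans_spaceD(4)[OF VD that]] that by simp
  qed (use q_act in \<open>auto simp: R\<close>)
  have "cubical R"
  proof (rule cubicalI[OF subsystemD(1)[OF sub]])
    fix U assume U: "subsystem U R" "factors_cubes R U"
    note h = hmorD[OF cubical_hmor_factors[OF cV hVR U]]
    have "(\<alpha>, us, \<beta>) \<in> trans U" if t: "(\<alpha>, us, \<beta>) \<in> trans R" for \<alpha> us \<beta>
    proof -
      have "set us \<subseteq> ?A" "(\<alpha>, us, \<beta>) \<in> trans V"
        using t unfolding R(4) trans_space_def by auto
      moreover from this have "map q us = us" using qq by (intro map_idI) auto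
      ultimately show ?thesis using h(4)[of \<alpha> us \<beta>] by simp
    qed
    then show "states R \<subseteq> states U \<and> actions R \<subseteq> actions U \<and> trans R \<subseteq> trans U"
      using h(1,2) unfolding R(1,2) by auto
  qed
  moreover have "|?A| <o \<kappa>" by (rule small_image) (use VO in \<open>simp add: Obj_CTS\<close>)
  ultimately have RO: "R \<in> Obj C" using VO by (simp add: Obj_CTS R(1,2))
  have "CSA1 R"
    unfolding CSA1_def
  \<comment> \<open>Actions violating \<open>CSA1\<close> in \<open>R\<close> would be parallel in
    \<open>V\<close>, hence have the same representative, and each is its own
    representative.\<close>
  proof (intro allI impI, elim conjE)
    fix \<alpha> \<beta> u u' assume t: "(\<alpha>, [u], \<beta>) \<in> trans R" "(\<alpha>, [u'], \<beta>) \<in> trans R"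
      and l: "label R u = label R u'"
    have uA: "u \<in> ?A" "u' \<in> ?A" using t unfolding R(4) trans_space_def by auto
    then have "(u, u') \<in> ?P" using t l unfolding parallel_def R by auto
    then have "q u = q u'" by (rule q_eq)
    moreover have "q u = u" "q u' = u'" using uA qq by auto
    ultimately show "u = u'" by simp
  qed
  \<comment> \<open>The systems are literally equal, since labellings are extensional and
    transitions are detected after applying \<open>q\<close>.\<close>
  have "V = lift_sys R (actions V) q"
  proof (rule hdts.equality)
    have "label V \<in> extensional (actions V)" by (rule weak_hdtsD(1)[OF wV])
    moreover have "label (lift_sys R (actions V) q) \<in> extensional (actions V)" by (simp add: lift_sys_def)
    ultimately show "label V = label (lift_sys R (actions V) q)"
      by (rule extensionalityI) (use q_act in \<open>simp add: R\<close>)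
    show "trans V = trans (lift_sys R (actions V) q)"
    proof (rule set_eqI)
      fix t :: "'u \<times> 'u list \<times> 'u"
      obtain \<alpha> us \<beta> where t: "t = (\<alpha>, us, \<beta>)" by (cases t)
      show "t \<in> trans V \<longleftrightarrow> t \<in> trans (lift_sys R (actions V) q)"
        unfolding t lift_sys_simps(4) using mapR[of us \<alpha> \<beta>] trans_spaceD(4)[OF VD, of \<alpha> us \<beta>] by blast
    qed
  qed (simp_all add: R)
  then have "mk_arrow V R id q \<in> rlp C (CTS_cofibrations \<kappa>)"
    using lift_sys_trivial_fibration(2)[OF RO, of q "actions V"] R(2) VO by (simp add: Obj_CTS)
  then have pW: "mk_arrow V R id q \<in> W" by (rule W_rlp)
  let ?e = "Comp C (mk_arrow V R id q) (mk_arrow X V id id)"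
  have homs: "mk_arrow X V id id \<in> hom C X V" "mk_arrow V R id q \<in> hom C V R"
    by (rule mk_arrow_hom[THEN iffD2]; fact X VO RO XV(1) hVR)+
  have "?e \<in> W" by (rule W_two_out_of_three(1)[OF homs XV(2) pW])
  moreover have "?e \<in> hom C X R" by (rule hom_comp[OF category_CTS homs])
  ultimately show ?thesis using RO \<open>CSA1 R\<close> by (intro bexI[of _ ?e]) (simp_all add: hom_def)
qed

end

section \<open>Weak equivalences and the reflector\<close>

theorem theorem7p10:
  fixes \<kappa> :: "'u rel" and f :: "('u, 'l) hdts_arrow"
  assumes "Card_order \<kappa>" and "regularCard \<kappa>" and "natLeq <o \<kappa>"
    and "f \<in> Arr (CTS \<kappa>)"
  shows "f \<in> left_determined_weak_equivalences \<kappa> (CTS \<kappa>) (CTS_cofibrations \<kappa>) \<longleftrightarrow>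
         is_iso (full_subcat (CTS \<kappa>) {X. CSA1 X}) (CSA1_reflector \<kappa> f)"
proof -
  let ?C = "CTS \<kappa> :: (('u, 'u, 'l) hdts, ('u, 'l) hdts_arrow) cat" and ?S = "{X :: ('u, 'u, 'l) hdts. CSA1 X}"
  let ?A = "CTS_cofibrations \<kappa> :: ('u, 'l) hdts_arrow set"
  define W where "W = smallest_localizer \<kappa> ?C ?A"
  have "natLeq \<le>o |Field \<kappa>|"
    by (rule ordLeq_ordIso_trans[OF ordLess_imp_ordLeq[OF assms(3)]
          ordIso_symmetric[OF card_of_Field_ordIso[OF assms(1)]]])
  then have inf: "infinite (Field \<kappa>)"
    using infinite_iff_natLeq_ordLeq by blast
  note lo = localizer_orth[OF assms(1) inf]
  have "localizer \<kappa> ?C ?A W" unfolding W_def by (rule localizer_smallest_localizer[OF lo])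
  then interpret cts_localizer \<kappa> W
    by unfold_locales (use assms inf in simp_all)
  have W_orth: "W \<subseteq> orth ?C ?S"
    unfolding W_def smallest_localizer_def using lo by blast
  \<comment> \<open>A map in \<open>W\<close> to a \<open>CSA1\<close> object is automatically a
    reflection, because members of \<open>W\<close> are local.\<close>
  have ref: "\<exists>e \<in> W. is_reflection ?C ?S X e" if X: "X \<in> Obj ?C" for X
    using reflection_in_W[OF X] W_orth unfolding is_reflection_iff_orth[OF category_CTS] by blast
  \<comment> \<open>The map \<open>h\<close> induced by \<open>f\<close> between the reflections is
    local with \<open>CSA1\<close> ends, hence an isomorphism and in \<open>W\<close>. The units are
    in \<open>W\<close> as well, so two-out-of-three in the naturality square gives
    \<open>f\<close>.\<close>
  have "f \<in> W" if f: "f \<in> orth ?C ?S"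
  proof -
    have fh: "f \<in> hom ?C (source f) (target f)" using assms(4) by (simp add: hom_def)
    note ob = hom_objs[OF category_CTS fh]
    obtain e where e: "e \<in> W" "is_reflection ?C ?S (source f) e" using ref[OF ob(1)] by blast
    obtain e' where e': "e' \<in> W" "is_reflection ?C ?S (target f) e'" using ref[OF ob(2)] by blast
    have eh: "e \<in> hom ?C (source f) (target e)" and e'h: "e' \<in> hom ?C (target f) (target e')"
      and S: "target e \<in> Obj ?C \<inter> ?S" "target e' \<in> Obj ?C \<inter> ?S"
      using e(2) e'(2) unfolding is_reflection_def hom_def by simp_all
    have e'f: "Comp ?C e' f \<in> hom ?C (source f) (target e')" by (rule hom_comp[OF category_CTS fh e'h])
    have "\<exists>!h. h \<in> hom ?C (target e) (target e') \<and> Comp ?C h e = Comp ?C e' f"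
      using e(2) S(2) e'f unfolding is_reflection_def by simp
    then obtain h where h: "h \<in> hom ?C (target e) (target e')" "Comp ?C h e = Comp ?C e' f"
      by (elim ex1E conjE)
    note t = two_out_of_three_orth[OF category_CTS, of \<kappa> ?S, unfolded two_out_of_three_def, rule_format]
    have orth: "e \<in> orth ?C ?S" "e' \<in> orth ?C ?S" using e(1) e'(1) W_orth by blast+
    have "Comp ?C e' f \<in> orth ?C ?S"
      using t[of f e'] f orth(2) fh e'h by (simp add: hom_def)
    then have "h \<in> orth ?C ?S"
      using t[of e h] h orth(1) eh by (simp add: hom_def)
    then have "is_iso ?C h"
      by (rule orth_iso[OF category_CTS]) (use h(1) S in \<open>simp_all add: hom_def\<close>)
    then have "h \<in> W" by (rule W_iso)
    then have "Comp ?C e' f \<in> W"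
      using W_two_out_of_three(1)[OF eh h(1) e(1)] h(2) by simp
    then show ?thesis by (rule W_two_out_of_three(3)[OF fh e'h e'(1)])
  qed
  then have "f \<in> W \<longleftrightarrow> f \<in> orth ?C ?S" using W_orth by blast
  also have "\<dots> \<longleftrightarrow> is_iso (full_subcat ?C ?S) (CSA1_reflector \<kappa> f)"
    unfolding CSA1_reflector_def
    by (rule is_iso_reflector_iff[OF category_CTS assms(4), symmetric]) (use ref in blast)
  finally show ?thesis
    unfolding left_determined_weak_equivalences_def W_def .
qed

end
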